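(* Assume condition (N) holds, that $G'(0)$ exists and is finite, and that $g(s,\tau)\leq g'(0,\tau)s$ for all $s\geq0$, $\tau\in X$. Let $\zeta_1\in(0,\zeta_2)$ be a number such that $G([\zeta_1,\zeta_2])\subseteq[\zeta_1,\zeta_2]$, $\min_{s\in[\zeta_1,\zeta_2]}G(s)=G(\zeta_1)$ and $G(s)>s$ for $s\in(0,\zeta_1]$. Suppose $\chi(0)<0$ and that $\chi$ is defined on some open interval $(0,\bar\omega)$ and changes its sign on it [respectively, is defined on some $(-\bar\omega,0)$ and changes its sign on it]. Then equation (E) has at least one semi-wavefront $\varphi$ with $\varphi(-\infty)=0$, $\sup_{s\in\mathbb{R}}\varphi(s)\leq\zeta_2$ and $\liminf_{t\to+\infty}\varphi(t)>\zeta_1$ [respectively, with $\varphi(+\infty)=0$ and $\liminf_{t\to-\infty}\varphi(t)>\zeta_1$]. Moreover, if the equation $G(s)=s$ has exactly two solutions $0$ and $\kappa$ on $[0,\infty)$, and $\kappa$ is globally attracting for the map $G:(0,\zeta_2]\to(0,\zeta_2]$, then $\varphi(+\infty)=\kappa$.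
   Context: Let $(X,\mu)$ be a finite measure space. Let $K:\mathbb{R}\times X\to[0,\infty)$ be measurable and integrable on $\mathbb{R}\times X$, with $\int_{\mathbb{R}}K(s,\tau)\,ds>0$ for every $\tau$. Let $g:[0,\infty)\times X\to[0,\infty)$ be measurable, with $g(0,\tau)=0$, $g(\cdot,\tau)$ continuous for each $\tau$, and the derivative $g'(0,\tau)$ at $0$ existing and positive for each $\tau$. Equation (E): $\phi(t)=\int_X d\mu(\tau)\int_{\mathbb{R}}K(s,\tau)\,g(\phi(t-s),\tau)\,ds$, $t\in\mathbb{R}$; solutions are continuous $\phi:\mathbb{R}\to[0,\infty)$. $\chi(z)=1-\int_X\int_{\mathbb{R}}K(s,\tau)g'(0,\tau)e^{-sz}\,ds\,d\mu(\tau)$ where the integral converges. A semi-wavefront of (E) is a positive bounded solution $\varphi$ with $\lim_{t\to-\infty}\varphi(t)=0$ or $\lim_{t\to+\infty}\varphi(t)=0$. Condition (N): (N1) there is $\tau_0\in X$ with $\mu(\{\tau_0\})=1$ such that $g(v,\tau)$ is increasing in $v$ for each $\tau\neq\tau_0$ and $g(v,\tau_0)>0$ for $v>0$; $\tilde g(v)=\int_{X\setminus\{\tau_0\}}g(v,\tau)\left(\int_{\mathbb{R}}K(s,\tau)ds\right)d\mu(\tau)$. (N2) there is $\zeta_2>0$ such that $\Theta(v)=v-\tilde g(v)$ is strictly increasing on $[0,\zeta_2]$ and $\Theta(\zeta_2)>C\max_{v\geq0}g(v,\tau_0)$, $C=\int_{\mathbb{R}}K(s,\tau_0)ds$. Define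 $G(v)=\Theta^{-1}(Cg(v,\tau_0))$, $v\geq0$, with $\Theta^{-1}$ the inverse of $\Theta|_{[0,\zeta_2]}$. "$\kappa$ globally attracting for $G:(0,\zeta_2]\to(0,\zeta_2]$" means $G^n(s)\to\kappa$ as $n\to\infty$ for every $s\in(0,\zeta_2]$. *)

theory Defs
  imports "HOL-Analysis.Analysis"
begin

text \<open>Equation (E):
  phi(t) = int_X dmu(tau) int_R K(s,tau) g(phi(t-s),tau) ds.
  The integrands are nonnegative, so the iterated integral is taken as a
  nonnegative (extended real) Lebesgue integral.\<close>

definition is_solution ::
  "'a measure \<Rightarrow> (real \<Rightarrow> 'a \<Rightarrow> real) \<Rightarrow> (real \<Rightarrow> 'a \<Rightarrow> real) \<Rightarrow> (real \<Rightarrow> real) \<Rightarrow> bool" where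
  "is_solution M K g \<phi> \<longleftrightarrow>
     continuous_on UNIV \<phi> \<and> (\<forall>t. 0 \<le> \<phi> t) \<and>
     (\<forall>t. ennreal (\<phi> t) =
        (\<integral>\<^sup>+ \<tau>. (\<integral>\<^sup>+ s. ennreal (K s \<tau> * g (\<phi> (t - s)) \<tau>) \<partial>lborel) \<partial>M))"

definition semi_wavefront ::
  "'a measure \<Rightarrow> (real \<Rightarrow> 'a \<Rightarrow> real) \<Rightarrow> (real \<Rightarrow> 'a \<Rightarrow> real) \<Rightarrow> (real \<Rightarrow> real) \<Rightarrow> bool" where
  "semi_wavefront M K g \<phi> \<longleftrightarrow>
     is_solution M K g \<phi> \<and> (\<forall>t. 0 < \<phi> t) \<and> bounded (range \<phi>) \<and>
     ((\<phi> \<longlongrightarrow> 0) at_bot \<or> (\<phi> \<longlongrightarrow> 0) at_top)"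

text \<open>The characteristic function chi(z) = 1 - int_X int_R K(s,tau) g'(0,tau) e^{-sz} ds dmu,
  defined where the (nonnegative) integral converges. gd tau stands for g'(0,tau).\<close>
definition chi_int ::
  "'a measure \<Rightarrow> (real \<Rightarrow> 'a \<Rightarrow> real) \<Rightarrow> ('a \<Rightarrow> real) \<Rightarrow> real \<Rightarrow> ennreal" where
  "chi_int M K gd z =
     (\<integral>\<^sup>+ \<tau>. (\<integral>\<^sup>+ s. ennreal (K s \<tau> * gd \<tau> * exp (- s * z)) \<partial>lborel) \<partial>M)"

definition chi_defined ::
  "'a measure \<Rightarrow> (real \<Rightarrow> 'a \<Rightarrow> real) \<Rightarrow> ('a \<Rightarrow> real) \<Rightarrow> real \<Rightarrow> bool" where
  "chi_defined M K gd z \<longleftrightarrow> chi_int M K gd z < \<infinity>"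

definition chi ::
  "'a measure \<Rightarrow> (real \<Rightarrow> 'a \<Rightarrow> real) \<Rightarrow> ('a \<Rightarrow> real) \<Rightarrow> real \<Rightarrow> real" where
  "chi M K gd z = 1 - enn2real (chi_int M K gd z)"

definition tilde_g ::
  "'a measure \<Rightarrow> (real \<Rightarrow> 'a \<Rightarrow> real) \<Rightarrow> (real \<Rightarrow> 'a \<Rightarrow> real) \<Rightarrow> 'a \<Rightarrow> real \<Rightarrow> ennreal" where
  "tilde_g M K g \<tau>0 v =
     (\<integral>\<^sup>+ \<tau> \<in> space M - {\<tau>0}. ennreal (g v \<tau>) * (\<integral>\<^sup>+ s. ennreal (K s \<tau>) \<partial>lborel) \<partial>M)"

definition Theta ::
  "'a measure \<Rightarrow> (real \<Rightarrow> 'a \<Rightarrow> real) \<Rightarrow> (real \<Rightarrow> 'a \<Rightarrow> real) \<Rightarrow> 'a \<Rightarrow> real \<Rightarrow> real" where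
  "Theta M K g \<tau>0 v = v - enn2real (tilde_g M K g \<tau>0 v)"

definition Cconst :: "(real \<Rightarrow> 'a \<Rightarrow> real) \<Rightarrow> 'a \<Rightarrow> real" where
  "Cconst K \<tau>0 = (\<integral> s. K s \<tau>0 \<partial>lborel)"

text \<open>Condition (N) (with the implicit requirement that tilde g is finite on [0,zeta2],
  so that Theta is a real-valued function there).\<close>
definition condN ::
  "'a measure \<Rightarrow> (real \<Rightarrow> 'a \<Rightarrow> real) \<Rightarrow> (real \<Rightarrow> 'a \<Rightarrow> real) \<Rightarrow> 'a \<Rightarrow> real \<Rightarrow> bool" where
  "condN M K g \<tau>0 \<zeta>2 \<longleftrightarrow>
     \<comment> \<open>(N1)\<close>
     \<tau>0 \<in> space M \<and> {\<tau>0} \<in> sets M \<and> emeasure M {\<tau>0} = 1 \<and>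
     (\<forall>\<tau> \<in> space M - {\<tau>0}. mono_on {0..} (\<lambda>v. g v \<tau>)) \<and>
     (\<forall>v > 0. 0 < g v \<tau>0) \<and>
     \<comment> \<open>(N2)\<close>
     0 < \<zeta>2 \<and>
     (\<forall>v \<in> {0..\<zeta>2}. tilde_g M K g \<tau>0 v < \<infinity>) \<and>
     strict_mono_on {0..\<zeta>2} (Theta M K g \<tau>0) \<and>
     (\<exists>v0 \<ge> 0. (\<forall>v \<ge> 0. g v \<tau>0 \<le> g v0 \<tau>0) \<and>
                Cconst K \<tau>0 * g v0 \<tau>0 < Theta M K g \<tau>0 \<zeta>2)"

definition Gmap ::
  "'a measure \<Rightarrow> (real \<Rightarrow> 'a \<Rightarrow> real) \<Rightarrow> (real \<Rightarrow> 'a \<Rightarrow> real) \<Rightarrow> 'a \<Rightarrow> real \<Rightarrow> real \<Rightarrow> real" where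
  "Gmap M K g \<tau>0 \<zeta>2 v = the_inv_into {0..\<zeta>2} (Theta M K g \<tau>0) (Cconst K \<tau>0 * g v \<tau>0)"

end

theory Submission
  imports Defs "HOL-Complex_Analysis.Great_Picard" "HOL-Real_Asymp.Real_Asymp"
begin

text \<open>Let \<open>A\<close> be the nonlinear convolution operator of (E). Only two consequences of the sign
  change of \<open>\<chi>\<close> matter: \<open>\<chi>(0) < 0\<close>, and \<open>\<chi>(b) > 0\<close> for some \<open>b > 0\<close>. By the second,
  \<open>q e\<^sup>b\<^sup>t\<close> is a strict supersolution of the linearisation, so Schauder's argument gives positive
  solutions of \<open>\<phi> = A \<phi> + \<epsilon> min(1, e\<^sup>b\<^sup>t)\<close> below \<open>q e\<^sup>b\<^sup>t\<close>. By the first, wherever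
  \<open>\<phi> \<le> \<delta>\<close> we have \<open>\<phi> \<ge> k * \<phi>\<close> for a compactly supported kernel \<open>k\<close> of mass \<open>m > 1\<close> with
  \<open>\<integral> k(s) e\<^sup>-\<^sup>b\<^sup>s ds < 1\<close>. Such a \<open>k\<close> pushes mass to the right: a supersolution below \<open>\<delta>\<close> on a right
  half-line vanishes far to the right, and a supersolution below \<open>\<delta>\<close> on \<open>(-\<infinity>, 0]\<close> has an integral there
  that is bounded independently of \<open>\<epsilon>\<close>. Translating the solutions so that they first reach \<open>\<delta>\<close> at
  \<open>0\<close> and letting \<open>\<epsilon> \<rightarrow> 0\<close> produces a solution that is integrable, hence tends to \<open>0\<close>, at \<open>-\<infinity>\<close>.
  The same facts keep it away from \<open>0\<close> at \<open>+\<infinity>\<close>, and limits of its translates confine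
  \<open>[liminf, limsup]\<close> to an interval on which the one-dimensional map \<open>G\<close> decides.\<close>

subsection \<open>Translations in \<open>L\<^sup>1\<close>, Brouwer's theorem and compactness\<close>

text \<open>A fixed point theorem alone might return the zero solution; the source excludes this,
  and its cap at \<epsilon> lets the strict inequality in (N2) absorb it below \<zeta>2. The
  majorant \<open>q * exp (b * t)\<close> does not survive the limit: moving the first time
  \<open>c\<close> at height \<delta> to 0 multiplies it by \<open>exp (b * c)\<close>, a factor not
  controlled as \<epsilon> tends to 0. It only makes the integral over the left half-line finite, so
  that an inequality of the form m X <= X + R \<delta> can be solved for X with a bound free of
  \<epsilon>. The derivative at 0 is not uniform in \<tau>. The kernel \<open>k\<close> therefore
  keeps only those \<tau> for which \<open>g\<close> is nearly linear on a common interval; monotone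
  convergence makes the loss of mass small. All compactness comes from one source: the translates of
  \<open>K\<close> depend continuously on the shift in L1, hence \<open>A f\<close> is
  equicontinuous uniformly in \<open>f\<close>. Zeros of limits are excluded because a solution that
  vanishes once vanishes identically.\<close>

lemma nn_integral_shift:
  fixes f :: "real \<Rightarrow> ennreal"
  assumes "f \<in> borel_measurable borel"
  shows "(\<integral>\<^sup>+x. f (x + c) \<partial>lborel) = (\<integral>\<^sup>+x. f x \<partial>lborel)"
  using nn_integral_real_affine[OF assms, of 1 c] by (simp add: add.commute)

lemma nn_integral_reflect:
  fixes f :: "real \<Rightarrow> ennreal"
  assumes "f \<in> borel_measurable borel"
  shows "(\<integral>\<^sup>+x. f (c - x) \<partial>lborel) = (\<integral>\<^sup>+x. f x \<partial>lborel)"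
  using nn_integral_real_affine[OF assms, of "-1" c] by simp

section \<open>Continuity of translation in the L1 norm\<close>

text \<open>A point of an open set stays inside under small translations, so the integrand is
  eventually 0 at each point; \<open>indicator U\<close> dominates.\<close>

lemma tendsto_indicator_open_diff:
  fixes U :: "real set" and h :: "nat \<Rightarrow> real"
  assumes "open U" "emeasure lborel U < \<infinity>" "h \<longlonglongrightarrow> 0"
  shows "(\<lambda>n. \<integral>\<^sup>+x. indicator U x * indicator (- U) (x + h n) \<partial>lborel) \<longlonglongrightarrow> 0"
proof -
  have [measurable]: "U \<in> sets borel" using assms(1) by simp
  have "(\<lambda>n. \<integral>\<^sup>+x. indicator U x * indicator (- U) (x + h n) \<partial>lborel) \<longlonglongrightarrow> (\<integral>\<^sup>+(x::real). 0 \<partial>lborel)"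
  proof (rule nn_integral_dominated_convergence[where w = "indicator U"])
    show "(\<integral>\<^sup>+ x. indicator U x \<partial>lborel) < \<infinity>" using assms(2) by simp
    show "AE x in lborel. (\<lambda>n. indicator U x * indicator (- U) (x + h n)) \<longlonglongrightarrow> (0::ennreal)"
    proof (rule AE_I2)
      fix x :: real
      show "(\<lambda>n. indicator U x * indicator (- U) (x + h n)) \<longlonglongrightarrow> (0::ennreal)"
      proof (cases "x \<in> U")
        case True
        have "(\<lambda>n. x + h n) \<longlonglongrightarrow> x" using tendsto_add[OF tendsto_const assms(3), of x] by simp
        then have "\<forall>\<^sub>F n in sequentially. x + h n \<in> U"
          by (rule topological_tendstoD[OF _ assms(1) True])
        then show ?thesis
          by (intro tendsto_eventually) (elim eventually_mono, simp)
      qed simp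
    qed
  qed (auto simp: indicator_def)
  then show ?thesis by simp
qed

lemma L1_translation_open:
  fixes U :: "real set" and h :: "nat \<Rightarrow> real"
  assumes U: "open U" "emeasure lborel U < \<infinity>" and h: "h \<longlonglongrightarrow> 0"
  shows "(\<lambda>n. \<integral>\<^sup>+x. ennreal \<bar>indicator U (x + h n) - indicator U x\<bar> \<partial>lborel) \<longlonglongrightarrow> 0"
proof -
  have [measurable]: "U \<in> sets borel" using assms(1) by simp
  have "(\<integral>\<^sup>+x. ennreal \<bar>indicator U (x + h n) - indicator U x\<bar> \<partial>lborel) =
        (\<integral>\<^sup>+x. indicator U x * indicator (- U) (x + h n) \<partial>lborel) +
        (\<integral>\<^sup>+x. indicator U x * indicator (- U) (x + - h n) \<partial>lborel)" for n
  proof -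
    \<comment> \<open>What the translate gains becomes, after a shift by \<open>h n\<close>, what is
      lost under translation by \<open>- h n\<close>; so openness of \<open>U\<close> handles both
      halves of the symmetric difference.\<close>
    have "(\<integral>\<^sup>+x. indicator U x * indicator (- U) (x + - h n) \<partial>lborel) =
      (\<integral>\<^sup>+x. indicator U (x + h n) * indicator (- U) (x + h n + - h n) \<partial>lborel)"
      by (rule nn_integral_shift[symmetric]) measurable
    also have "\<dots> = (\<integral>\<^sup>+x. indicator U (x + h n) * indicator (- U) x \<partial>lborel)" by simp
    finally show ?thesis
      by (simp only:, subst nn_integral_add[symmetric])
        (auto intro!: nn_integral_cong simp: indicator_def)
  qed
  moreover have "(\<lambda>n. (\<integral>\<^sup>+x. indicator U x * indicator (- U) (x + h n) \<partial>lborel) +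
        (\<integral>\<^sup>+x. indicator U x * indicator (- U) (x + - h n) \<partial>lborel)) \<longlonglongrightarrow> 0 + 0"
    using tendsto_indicator_open_diff[OF U h] tendsto_indicator_open_diff[OF U, of "\<lambda>n. - h n"] tendsto_minus[OF h]
    by (intro tendsto_add) auto
  ultimately show ?thesis by simp
qed

text \<open>Three-epsilon argument: translation preserves L1 distances, so L1 continuity of
  translation passes to L1 limits. It serves both for indicators and for the limit case of the
  induction.\<close>

lemma L1_translation_approx:
  fixes f :: "real \<Rightarrow> real" and h :: "nat \<Rightarrow> real"
  assumes [measurable]: "f \<in> borel_measurable borel"
    and approx: "\<And>e. 0 < e \<Longrightarrow> \<exists>g. g \<in> borel_measurable borel \<and>
        (\<integral>\<^sup>+x. ennreal \<bar>f x - g x\<bar> \<partial>lborel) < ennreal e \<and>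
        (\<lambda>n. \<integral>\<^sup>+x. ennreal \<bar>g (x + h n) - g x\<bar> \<partial>lborel) \<longlonglongrightarrow> 0"
  shows "(\<lambda>n. \<integral>\<^sup>+x. ennreal \<bar>f (x + h n) - f x\<bar> \<partial>lborel) \<longlonglongrightarrow> 0"
proof (rule tendsto_zero_ennreal)
  fix r :: real assume r: "0 < r"
  then obtain g where [measurable]: "g \<in> borel_measurable borel"
    and fg: "(\<integral>\<^sup>+x. ennreal \<bar>f x - g x\<bar> \<partial>lborel) < ennreal (r/3)"
    and lim: "(\<lambda>n. \<integral>\<^sup>+x. ennreal \<bar>g (x + h n) - g x\<bar> \<partial>lborel) \<longlonglongrightarrow> 0"
    using approx[of "r/3"] by auto
  have *: "(\<integral>\<^sup>+x. ennreal \<bar>f (x + h n) - f x\<bar> \<partial>lborel) \<le>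
     (\<integral>\<^sup>+x. ennreal \<bar>f x - g x\<bar> \<partial>lborel) + (\<integral>\<^sup>+x. ennreal \<bar>g (x + h n) - g x\<bar> \<partial>lborel)
     + (\<integral>\<^sup>+x. ennreal \<bar>f x - g x\<bar> \<partial>lborel)" for n
  proof -
    have "(\<integral>\<^sup>+x. ennreal \<bar>f (x + h n) - f x\<bar> \<partial>lborel) \<le>
      (\<integral>\<^sup>+x. ennreal \<bar>f (x + h n) - g (x + h n)\<bar> + ennreal \<bar>g (x + h n) - g x\<bar> + ennreal \<bar>f x - g x\<bar> \<partial>lborel)"
      by (intro nn_integral_mono) (auto simp flip: ennreal_plus intro!: ennreal_leI)
    also have "\<dots> = (\<integral>\<^sup>+x. ennreal \<bar>f (x + h n) - g (x + h n)\<bar> \<partial>lborel) + (\<integral>\<^sup>+x. ennreal \<bar>g (x + h n) - g x\<bar> \<partial>lborel)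
     + (\<integral>\<^sup>+x. ennreal \<bar>f x - g x\<bar> \<partial>lborel)"
      by (simp add: nn_integral_add)
    also have "(\<integral>\<^sup>+x. ennreal \<bar>f (x + h n) - g (x + h n)\<bar> \<partial>lborel) = (\<integral>\<^sup>+x. ennreal \<bar>f x - g x\<bar> \<partial>lborel)"
      by (rule nn_integral_shift[where f = "\<lambda>x. ennreal \<bar>f x - g x\<bar>"]) measurable
    finally show ?thesis .
  qed
  have "\<forall>\<^sub>F n in sequentially. (\<integral>\<^sup>+x. ennreal \<bar>g (x + h n) - g x\<bar> \<partial>lborel) < ennreal (r/3)"
    using lim r by (intro order_tendstoD(2)) auto
  then show "\<forall>\<^sub>F n in sequentially. (\<integral>\<^sup>+x. ennreal \<bar>f (x + h n) - f x\<bar> \<partial>lborel) < ennreal r"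
  proof eventually_elim
    case (elim n)
    note *[of n]
    also have "(\<integral>\<^sup>+x. ennreal \<bar>f x - g x\<bar> \<partial>lborel) + (\<integral>\<^sup>+x. ennreal \<bar>g (x + h n) - g x\<bar> \<partial>lborel)
     + (\<integral>\<^sup>+x. ennreal \<bar>f x - g x\<bar> \<partial>lborel) < ennreal (r/3) + ennreal (r/3) + ennreal (r/3)"
      by (intro add_strict_mono fg elim)
    also have "\<dots> = ennreal r" using r by (simp flip: ennreal_plus)
    finally show ?case .
  qed
qed

text \<open>Outer regularity gives an open superset that is close in measure, which reduces the
  claim to open sets.\<close>

lemma L1_translation_indicator:
  fixes A :: "real set" and h :: "nat \<Rightarrow> real"
  assumes A[measurable]: "A \<in> sets borel" and fin: "emeasure lborel A < \<infinity>" and h: "h \<longlonglongrightarrow> 0"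
  shows "(\<lambda>n. \<integral>\<^sup>+x. ennreal \<bar>indicator A (x + h n) - indicator A x\<bar> \<partial>lborel) \<longlonglongrightarrow> 0"
proof (rule L1_translation_approx)
  fix e :: real assume "0 < e"
  then obtain U where U: "open U" "A \<subseteq> U" "emeasure lborel (U - A) < ennreal e"
    using outer_regular_lborel[OF A, of e] by auto
  have [measurable]: "U \<in> sets borel" using U by simp
  have "emeasure lborel U \<le> emeasure lborel A + emeasure lborel (U - A)"
    using U(2) by (subst plus_emeasure) (auto intro!: emeasure_mono)
  also have "\<dots> < \<infinity>" using fin U(3) by (simp add: less_top[symmetric]) (metis infinity_ennreal_def less_top top.not_eq_extremum ennreal_less_top order.strict_trans)
  finally have "emeasure lborel U < \<infinity>" .
  then have "(\<lambda>n. \<integral>\<^sup>+x. ennreal \<bar>indicator U (x + h n) - indicator U x\<bar> \<partial>lborel) \<longlonglongrightarrow> 0"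
    by (rule L1_translation_open[OF U(1) _ h])
  moreover have "(\<integral>\<^sup>+x. ennreal \<bar>indicator A x - indicator U x\<bar> \<partial>lborel) = (\<integral>\<^sup>+x. indicator (U - A) x \<partial>lborel)"
    using U(2) by (intro nn_integral_cong) (auto simp: indicator_def)
  ultimately show "\<exists>g. g \<in> borel_measurable borel \<and>
        (\<integral>\<^sup>+x. ennreal \<bar>indicator A x - g x\<bar> \<partial>lborel) < ennreal e \<and>
        (\<lambda>n. \<integral>\<^sup>+x. ennreal \<bar>g (x + h n) - g x\<bar> \<partial>lborel) \<longlonglongrightarrow> 0"
    using U by (intro exI[of _ "indicator U"]) auto
qed measurable

lemma L1_translation:
  fixes f :: "real \<Rightarrow> real" and h :: "nat \<Rightarrow> real"
  assumes f: "integrable lborel f" and h: "h \<longlonglongrightarrow> 0"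
  shows "(\<lambda>n. \<integral>\<^sup>+x. ennreal \<bar>f (x + h n) - f x\<bar> \<partial>lborel) \<longlonglongrightarrow> 0"
  using f
proof (induction rule: integrable_induct)
  case (base A c)
  then have [measurable]: "A \<in> sets borel" by simp
  have "(\<integral>\<^sup>+x. ennreal \<bar>indicator A (x + h n) *\<^sub>R c - indicator A x *\<^sub>R c\<bar> \<partial>lborel)
     = ennreal \<bar>c\<bar> * (\<integral>\<^sup>+x. ennreal \<bar>indicator A (x + h n) - indicator A x\<bar> \<partial>lborel)" for n
    by (subst nn_integral_cmult[symmetric]) (auto intro!: nn_integral_cong simp: indicator_def)
  moreover have "(\<lambda>n. ennreal \<bar>c\<bar> * (\<integral>\<^sup>+x. ennreal \<bar>indicator A (x + h n) - indicator A x\<bar> \<partial>lborel)) \<longlonglongrightarrow> ennreal \<bar>c\<bar> * 0"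
    using base h by (intro ennreal_tendsto_cmult L1_translation_indicator) auto
  ultimately show ?case by simp
next
  case (add f g)
  have [measurable]: "f \<in> borel_measurable borel" "g \<in> borel_measurable borel"
    using add.hyps by (auto dest: borel_measurable_integrable)
  show ?case
  proof (rule tendsto_sandwich[OF _ _ tendsto_const])
    show "\<forall>\<^sub>F n in sequentially. (\<integral>\<^sup>+x. ennreal \<bar>f (x + h n) + g (x + h n) - (f x + g x)\<bar> \<partial>lborel)
      \<le> (\<integral>\<^sup>+x. ennreal \<bar>f (x + h n) - f x\<bar> \<partial>lborel) + (\<integral>\<^sup>+x. ennreal \<bar>g (x + h n) - g x\<bar> \<partial>lborel)"
      by (intro always_eventually allI, subst nn_integral_add[symmetric])
         (auto simp flip: ennreal_plus intro!: nn_integral_mono ennreal_leI)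
    show "(\<lambda>n. (\<integral>\<^sup>+x. ennreal \<bar>f (x + h n) - f x\<bar> \<partial>lborel) + (\<integral>\<^sup>+x. ennreal \<bar>g (x + h n) - g x\<bar> \<partial>lborel)) \<longlonglongrightarrow> 0"
      using tendsto_add[OF add.IH] by simp
  qed simp
next
  case (lim f s)
  have [measurable]: "f \<in> borel_measurable borel" "s i \<in> borel_measurable borel" for i
    using lim.hyps by (auto dest: borel_measurable_integrable)
  show ?case
  proof (rule L1_translation_approx)
    fix e :: real assume e: "0 < e"
    have fin: "(\<integral>\<^sup>+ x. ennreal (3 * \<bar>f x\<bar>) \<partial>lborel) < \<infinity>"
      using lim.hyps(4) by (simp add: ennreal_mult' nn_integral_cmult integrable_iff_bounded ennreal_mult_less_top)
    \<comment> \<open>The approximants of \<open>integrable_induct\<close> are bounded by twice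
      \<open>f\<close> in absolute value, whence the factor 3.\<close>
    have bd: "\<bar>f x - s i x\<bar> \<le> 3 * \<bar>f x\<bar>" for i x
      using lim.hyps(3)[of x i] by simp
    have ptw: "(\<lambda>i. ennreal \<bar>f x - s i x\<bar>) \<longlonglongrightarrow> 0" for x
    proof -
      have "(\<lambda>i. \<bar>f x - s i x\<bar>) \<longlonglongrightarrow> \<bar>f x - f x\<bar>"
        using lim.hyps(2)[of x] by (intro tendsto_intros) auto
      then show ?thesis by (simp add: ennreal_0[symmetric] del: ennreal_0)
    qed
    have "(\<lambda>i. \<integral>\<^sup>+x. ennreal \<bar>f x - s i x\<bar> \<partial>lborel) \<longlonglongrightarrow> (\<integral>\<^sup>+(x::real). 0 \<partial>lborel)"
      by (rule nn_integral_dominated_convergence[where w = "\<lambda>x. ennreal (3 * \<bar>f x\<bar>)"])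
         (use fin bd ptw in \<open>auto intro!: ennreal_leI\<close>)
    then have "\<forall>\<^sub>F i in sequentially. (\<integral>\<^sup>+x. ennreal \<bar>f x - s i x\<bar> \<partial>lborel) < ennreal e"
      using e by (intro order_tendstoD(2)) auto
    then obtain i where "(\<integral>\<^sup>+x. ennreal \<bar>f x - s i x\<bar> \<partial>lborel) < ennreal e"
      by (auto simp: eventually_sequentially)
    then show "\<exists>g. g \<in> borel_measurable borel \<and>
        (\<integral>\<^sup>+x. ennreal \<bar>f x - g x\<bar> \<partial>lborel) < ennreal e \<and>
        (\<lambda>n. \<integral>\<^sup>+x. ennreal \<bar>g (x + h n) - g x\<bar> \<partial>lborel) \<longlonglongrightarrow> 0"
      using lim.IH[of i] by (intro exI[of _ "s i"]) auto
  qed measurable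
qed

section \<open>Brouwer's theorem on a box\<close>

text \<open>The dimension \<open>n\<close> will be the number of grid cells and must be a variable,
  so points are functions on the naturals; \<open>cont\<close> also expresses that only coordinates
  below \<open>n\<close> matter. Kuhn's combinatorial lemma gives ever smaller cubes on which each
  coordinate is somewhere not decreased and somewhere not increased by \<open>F\<close>; a limit
  point of the cubes is fixed.\<close>

lemma brouwer_box:
  fixes F :: "(nat \<Rightarrow> real) \<Rightarrow> nat \<Rightarrow> real" and Z :: real
  assumes Z: "0 < Z"
    and maps: "\<And>y i. (\<And>j. j < n \<Longrightarrow> y j \<in> {0..Z}) \<Longrightarrow> i < n \<Longrightarrow> F y i \<in> {0..Z}"
    and cont: "\<And>u y i. (\<And>k j. j < n \<Longrightarrow> u k j \<in> {0..Z}) \<Longrightarrow> (\<And>j. j < n \<Longrightarrow> (\<lambda>k. u k j) \<longlonglongrightarrow> y j)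
        \<Longrightarrow> i < n \<Longrightarrow> (\<lambda>k. F (u k) i) \<longlonglongrightarrow> F y i"
  obtains y where "\<And>i. i < n \<Longrightarrow> y i \<in> {0..Z}" "\<And>i. i < n \<Longrightarrow> F y i = y i"
proof -
  define pt where "pt p x j = Z * real (x j) / real p" for p :: nat and x :: "nat \<Rightarrow> nat" and j :: nat
  have pt_range: "pt p x j \<in> {0..Z}" if "x j \<le> p" "0 < p" for p x j
    using that Z by (auto simp: pt_def field_simps intro: mult_left_mono)
  \<comment> \<open>Label 0 says that \<open>F\<close> does not decrease the coordinate. The clause
    \<open>x i \<noteq> p\<close> forces label 1 on the upper face, as Kuhn's lemma demands; there
    \<open>F\<close> cannot exceed \<open>Z\<close>, so label 1 still implies that \<open>F\<close>
    does not increase the coordinate.\<close>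
  define label where "label p x i = (if F (pt p x) i \<ge> pt p x i \<and> x i \<noteq> p then 0 else 1::nat)" for p x i
  define cube where "cube q r \<longleftrightarrow> (\<forall>j<n. q j \<le> r j \<and> r j \<le> q j + 1)" for q r :: "nat \<Rightarrow> nat"
  have ex: "\<exists>q. (\<forall>i<n. q i < p) \<and>
      (\<forall>i<n. \<exists>r s. cube q r \<and> cube q s \<and> label p r i = 0 \<and> label p s i = 1)"
    if p: "0 < p" for p
  proof (rule kuhn_lemma[of p n "label p"])
    show "\<forall>x. (\<forall>i<n. x i \<le> p) \<longrightarrow> (\<forall>i<n. x i = 0 \<longrightarrow> label p x i = 0)"
    proof (intro allI impI)
      fix x i assume x: "\<forall>i<n. x i \<le> p" "i < n" "x i = 0"
      have "F (pt p x) i \<in> {0..Z}" using x p by (intro maps pt_range) auto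
      then show "label p x i = 0" using x p by (simp add: label_def pt_def)
    qed
    fix q assume q: "\<forall>i<n. q i < p" and *: "\<forall>i<n. \<exists>r s. (\<forall>j<n. q j \<le> r j \<and> r j \<le> q j + 1) \<and>
      (\<forall>j<n. q j \<le> s j \<and> s j \<le> q j + 1) \<and> label p r i \<noteq> label p s i"
    have "\<exists>r s. cube q r \<and> cube q s \<and> label p r i = 0 \<and> label p s i = 1" if i: "i < n" for i
    proof -
      obtain r s where rs: "cube q r" "cube q s" "label p r i \<noteq> label p s i"
        using * i unfolding cube_def by blast
      have "label p r i = 0 \<and> label p s i = 1 \<or> label p s i = 0 \<and> label p r i = 1"
        using rs(3) by (auto simp: label_def split: if_splits)
      then show ?thesis using rs(1,2) by blast
    qed
    then show ?thesis using q by blast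
  qed (use p in \<open>auto simp: label_def\<close>)
  have "\<exists>q. \<forall>m. (\<forall>i<n. q m i < Suc m) \<and>
      (\<forall>i<n. \<exists>r s. cube (q m) r \<and> cube (q m) s \<and> label (Suc m) r i = 0 \<and> label (Suc m) s i = 1)"
    by (rule choice) (use ex in blast)
  then obtain q where q: "\<And>m i. i < n \<Longrightarrow> q m i < Suc m"
    and rs: "\<And>m i. i < n \<Longrightarrow> \<exists>r s. cube (q m) r \<and> cube (q m) s \<and>
      label (Suc m) r i = 0 \<and> label (Suc m) s i = 1"
    by blast
  define x where "x m = pt (Suc m) (q m)" for m
  have x: "x m j \<in> {0..Z}" if "j < n" for m j
    unfolding x_def using q[OF that, of m] by (intro pt_range) auto
  obtain k where k: "strict_mono k" and "\<And>j. j \<in> {..<n} \<Longrightarrow> \<exists>l. (\<lambda>m. x (k m) j) \<longlonglongrightarrow> l"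
    by (rule function_convergent_subsequence[of "{..<n}" x Z]) (use x in auto)
  then have "\<forall>j\<in>{..<n}. \<exists>l. (\<lambda>m. x (k m) j) \<longlonglongrightarrow> l" by blast
  from bchoice[OF this] obtain y where y: "\<And>j. j < n \<Longrightarrow> (\<lambda>m. x (k m) j) \<longlonglongrightarrow> y j"
    by blast
  \<comment> \<open>Each coordinate of a vertex of the cube number \<open>m\<close> is within
    \<open>Z / Suc m\<close> of the corner \<open>x m\<close>, so every choice \<open>W\<close> of
    vertices has the limit \<open>y\<close>.\<close>
  have near: "(\<lambda>m. pt (Suc (k m)) (W (k m)) j) \<longlonglongrightarrow> y j"
    if j: "j < n" and W: "\<And>m. q m j \<le> W m j \<and> W m j \<le> q m j + 1" for W :: "nat \<Rightarrow> nat \<Rightarrow> nat" and j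
  proof (rule tendsto_sandwich[OF _ _ y[OF j]])
    have "(\<lambda>m. Z / real (Suc m)) \<longlonglongrightarrow> 0"
      using LIMSEQ_Suc[OF lim_const_over_n[of Z]] by simp
    from LIMSEQ_subseq_LIMSEQ[OF this k]
    have "(\<lambda>m. Z / real (Suc (k m))) \<longlonglongrightarrow> 0" by (simp add: o_def)
    from tendsto_add[OF y[OF j] this]
    show "(\<lambda>m. x (k m) j + Z / real (Suc (k m))) \<longlonglongrightarrow> y j" by simp
    show "\<forall>\<^sub>F m in sequentially. x (k m) j \<le> pt (Suc (k m)) (W (k m)) j"
      using W Z by (auto simp: x_def pt_def divide_simps intro!: mult_left_mono always_eventually)
    show "\<forall>\<^sub>F m in sequentially. pt (Suc (k m)) (W (k m)) j \<le> x (k m) j + Z / real (Suc (k m))"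
    proof (intro always_eventually allI)
      fix m
      have "Z * real (W (k m) j) \<le> Z * real (q (k m) j + 1)"
        using W[of "k m"] Z by (intro mult_left_mono) auto
      also have "\<dots> = Z * real (q (k m) j) + Z" by (simp add: algebra_simps)
      finally show "pt (Suc (k m)) (W (k m)) j \<le> x (k m) j + Z / real (Suc (k m))"
        unfolding x_def pt_def add_divide_distrib[symmetric] by (intro divide_right_mono) auto
    qed
  qed
  show thesis
  proof
    show y_range: "y i \<in> {0..Z}" if "i < n" for i
      using x[OF that] by (intro closed_sequentially[OF closed_atLeastAtMost _ y[OF that]])
    show "F y i = y i" if i: "i < n" for i
    proof (rule antisym)
      obtain R S where RS: "\<And>m. cube (q m) (R m)" "\<And>m. cube (q m) (S m)"
        "\<And>m. label (Suc m) (R m) i = 0" "\<And>m. label (Suc m) (S m) i = 1"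
        using rs[OF i] by metis
      have R: "q m j \<le> R m j \<and> R m j \<le> q m j + 1" and S: "q m j \<le> S m j \<and> S m j \<le> q m j + 1"
        if "j < n" for m j
        using RS(1,2)[of m] that by (auto simp: cube_def)
      have S_le: "S m j \<le> Suc m" and R_le: "R m j \<le> Suc m" if "j < n" for m j
        using S[OF that, of m] R[OF that, of m] q[OF that, of m] by auto
      have "(\<lambda>m. F (pt (Suc (k m)) (S (k m))) i) \<longlonglongrightarrow> F y i"
        using S i S_le by (intro cont near pt_range) auto
      moreover have "F (pt (Suc m) (S m)) i \<le> pt (Suc m) (S m) i" for m
      proof (cases "S m i = Suc m")
        case True
        have "F (pt (Suc m) (S m)) i \<in> {0..Z}" using i S_le by (intro maps pt_range) auto
        then show ?thesis using True by (simp add: pt_def)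
      qed (use RS(4)[of m] in \<open>auto simp: label_def split: if_splits\<close>)
      ultimately show "F y i \<le> y i"
        using near[OF i, of S] S[OF i] by (intro LIMSEQ_le) auto
      have "(\<lambda>m. F (pt (Suc (k m)) (R (k m))) i) \<longlonglongrightarrow> F y i"
        using R i R_le by (intro cont near pt_range) auto
      moreover have "F (pt (Suc m) (R m)) i \<ge> pt (Suc m) (R m) i" for m
        using RS(3)[of m] by (auto simp: label_def split: if_splits)
      ultimately show "y i \<le> F y i"
        using near[OF i, of R] R[OF i] by (intro LIMSEQ_le) auto
    qed
  qed
qed

section \<open>Sum sets and left half-lines\<close>

text \<open>The convolution of \<open>indicator A\<close> with itself has the square of the measure
  of \<open>A\<close> as its integral, so it is positive at some \<open>x0\<close>; L1 continuity of
  translation keeps it positive nearby. The interval starts at \<open>x0\<close> itself, which makes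
  its left end positive.\<close>

lemma convolution_indicator_pos:
  fixes A :: "real set"
  assumes A[measurable]: "A \<in> sets borel" and pos: "0 < emeasure lborel A" and fin: "emeasure lborel A < \<infinity>"
    and A_pos: "A \<subseteq> {0<..}"
  obtains p q where "0 < p" "p < q"
    "\<And>x. p < x \<Longrightarrow> x < q \<Longrightarrow> 0 < (\<integral>\<^sup>+s. indicator A s * indicator A (x - s) \<partial>lborel)"
proof -
  define F where "F x = (\<integral>\<^sup>+s. indicator A s * indicator A (x - s) \<partial>lborel)" for x
  have "(\<integral>\<^sup>+x. F x \<partial>lborel) = (\<integral>\<^sup>+s. (\<integral>\<^sup>+x. indicator A s * indicator A (x - s) \<partial>lborel) \<partial>lborel)"
    unfolding F_def by (rule lborel_pair.Fubini') measurable
  also have "\<dots> = (\<integral>\<^sup>+s. indicator A s * emeasure lborel A \<partial>lborel)"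
    using nn_integral_shift[of "indicator A" "- s" for s] by (simp add: nn_integral_cmult)
  also have "\<dots> = emeasure lborel A * emeasure lborel A"
    by (subst nn_integral_multc) auto
  also have "\<dots> > 0" using pos by (simp add: ennreal_zero_less_mult_iff)
  finally have "(\<integral>\<^sup>+x. F x \<partial>lborel) \<noteq> 0" by simp
  then obtain x0 where x0: "F x0 > 0"
    by (metis nn_integral_0_iff_AE nn_integral_cong nn_integral_const mult_zero_left not_gr_zero)
  have x0_pos: "0 < x0"
  proof (rule ccontr)
    assume "\<not> 0 < x0"
    then have "indicator A s * indicator A (x0 - s) = (0::ennreal)" for s
      using A_pos by (auto simp: indicator_def subset_eq) (smt (verit))
    then have "F x0 = 0" unfolding F_def by (simp del: mult_eq_0_iff)
    then show False using x0 by simp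
  qed
  have "\<exists>d>0. \<forall>x. \<bar>x - x0\<bar> < d \<longrightarrow> F x > 0"
  proof (rule ccontr)
    assume "\<not> ?thesis"
    then have "\<forall>n. \<exists>x. \<bar>x - x0\<bar> < 1 / real (Suc n) \<and> F x = 0"
      by (metis not_gr_zero of_nat_0_less_iff zero_less_Suc zero_less_divide_1_iff)
    then obtain x where x: "\<And>n. \<bar>x n - x0\<bar> < 1 / real (Suc n)" "\<And>n. F (x n) = 0" by metis
    have lim: "(\<lambda>n. x0 - x n) \<longlonglongrightarrow> 0"
    proof (rule tendsto_rabs_zero_cancel, rule tendsto_sandwich[OF _ _ tendsto_const])
      show "\<forall>\<^sub>F n in sequentially. \<bar>x0 - x n\<bar> \<le> inverse (real (Suc n))"
        using x(1) by (intro always_eventually allI) (simp add: abs_minus_commute inverse_eq_divide less_imp_le)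
    qed (use LIMSEQ_inverse_real_of_nat in auto)
    \<comment> \<open>Passing from \<open>x0\<close> to \<open>x n\<close>, where the convolution
      vanishes, costs at most the L1 modulus of \<open>indicator A\<close>.\<close>
    have "F x0 \<le> (\<integral>\<^sup>+u. ennreal \<bar>indicator A (u + (x0 - x n)) - indicator A u\<bar> \<partial>lborel)" for n
    proof -
      have "F x0 \<le> (\<integral>\<^sup>+s. indicator A s * indicator A (x n - s) +
          ennreal \<bar>indicator A (x n - s + (x0 - x n)) - indicator A (x n - s)\<bar> \<partial>lborel)"
        unfolding F_def by (intro nn_integral_mono) (auto simp: indicator_def)
      also have "\<dots> = F (x n) + (\<integral>\<^sup>+s. ennreal \<bar>indicator A (x n - s + (x0 - x n)) - indicator A (x n - s)\<bar> \<partial>lborel)"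
        unfolding F_def by (subst nn_integral_add) auto
      also have "\<dots> = (\<integral>\<^sup>+u. ennreal \<bar>indicator A (u + (x0 - x n)) - indicator A u\<bar> \<partial>lborel)"
        using x(2)[of n] nn_integral_reflect[of "\<lambda>u. ennreal \<bar>indicator A (u + (x0 - x n)) - indicator A u\<bar>" "x n"]
        by simp
      finally show ?thesis .
    qed
    then have "F x0 \<le> 0"
      using L1_translation_indicator[OF A fin lim] by (intro LIMSEQ_le_const) auto
    then show False using x0 by simp
  qed
  then obtain d where "d > 0" "\<And>x. \<bar>x - x0\<bar> < d \<Longrightarrow> F x > 0" by blast
  then show thesis
    using x0_pos that[of x0 "x0 + d"] by (auto simp: F_def)
qed

text \<open>Sums of n elements of the interval from p to q fill the interval from n p to n q, and
  these intervals overlap once n is large.\<close>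

lemma left_ray_of_shift_invariant:
  fixes Z :: "real set"
  assumes pq: "0 < p" "p < q" and step: "\<And>t x. t \<in> Z \<Longrightarrow> p < x \<Longrightarrow> x < q \<Longrightarrow> t - x \<in> Z" and t1: "t1 \<in> Z"
  obtains T where "\<And>t. t < T \<Longrightarrow> t \<in> Z"
proof -
  have iter: "\<forall>x. real (Suc n) * p < x \<and> x < real (Suc n) * q \<longrightarrow> t1 - x \<in> Z" for n
  proof (induction n)
    case 0
    then show ?case using step[OF t1] by simp
  next
    case (Suc n)
    show ?case
    proof (intro allI impI)
      fix x assume x: "real (Suc (Suc n)) * p < x \<and> x < real (Suc (Suc n)) * q"
      define y where "y = x / real (Suc (Suc n))"
      have xy: "x = real (Suc (Suc n)) * y" by (simp add: y_def)
      have y: "p < y" "y < q" using x by (auto simp: y_def field_simps)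
      have "t1 - real (Suc n) * y \<in> Z"
        using Suc.IH y by simp
      then have "t1 - real (Suc n) * y - y \<in> Z" using step y by blast
      then show "t1 - x \<in> Z" by (simp add: xy algebra_simps)
    qed
  qed
  \<comment> \<open>For \<open>x > T\<close> the interval from \<open>x / q\<close> to
    \<open>x / p\<close> is longer than 1, hence contains an integer; this is the number of
    summands.\<close>
  define T where "T = 1 / (1 / p - 1 / q)"
  have "1 / q < 1 / p" using pq by (simp add: frac_less2)
  have "t1 - x \<in> Z" if x: "T < x" for x
  proof -
    have "0 < T" using \<open>1 / q < 1 / p\<close> by (simp add: T_def)
    have "1 < x * (1 / p - 1 / q)"
      using x \<open>1 / q < 1 / p\<close> by (simp add: T_def divide_less_eq)
    then have *: "x / q + 1 < x / p" by (simp add: algebra_simps)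
    define n where "n = nat \<lfloor>x / q\<rfloor>"
    have "0 \<le> x / q" using \<open>0 < T\<close> x pq by simp
    then have "real n \<le> x / q" "x / q < real (Suc n)" unfolding n_def by linarith+
    then have "x / q < real (Suc n)" "real (Suc n) < x / p"
      using * by linarith+
    then have "x < real (Suc n) * q" "real (Suc n) * p < x"
      using pq by (simp_all only: pos_divide_less_eq pos_less_divide_eq)
    then show ?thesis using iter by blast
  qed
  then have "t \<in> Z" if "t < t1 - T" for t
    using that by (metis diff_diff_eq2 diff_add_cancel add.commute add_diff_cancel less_diff_eq)
  then show thesis using that by blast
qed

section \<open>Compactness, decay and almost-everywhere zeros\<close>

text \<open>Arzela-Ascoli: a subsequence converges on the rationals, and equicontinuity makes it
  Cauchy everywhere. Only pointwise convergence is recorded, since the limits are later taken under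
  the integral by dominated convergence.\<close>

lemma equicontinuous_convergent_subsequence:
  fixes F :: "nat \<Rightarrow> real \<Rightarrow> real"
  assumes bd: "\<And>n x. \<bar>F n x\<bar> \<le> M"
    and equi: "\<And>e. 0 < e \<Longrightarrow> \<exists>d>0. \<forall>n x y. \<bar>x - y\<bar> < d \<longrightarrow> \<bar>F n x - F n y\<bar> < e"
  obtains k \<phi> where "strict_mono (k :: nat \<Rightarrow> nat)" "\<And>x. (\<lambda>n. F (k n) x) \<longlonglongrightarrow> \<phi> x"
proof -
  obtain k where k: "strict_mono k" and conv: "\<And>x. x \<in> \<rat> \<Longrightarrow> \<exists>l. (\<lambda>n. F (k n) x) \<longlonglongrightarrow> l"
    by (rule function_convergent_subsequence[of \<rat> F M]) (use bd in \<open>auto simp: countable_rat\<close>)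
  have "Cauchy (\<lambda>n. F (k n) x)" for x
  proof (rule metric_CauchyI)
    fix e :: real assume e: "0 < e"
    then obtain d where d: "d > 0" "\<And>n x y. \<bar>x - y\<bar> < d \<Longrightarrow> \<bar>F n x - F n y\<bar> < e / 3"
      using equi[of "e/3"] by auto
    obtain r where r: "r \<in> \<rat>" "x < r" "r < x + d" using Rats_dense_in_real[of x "x + d"] d(1) by auto
    then have "Cauchy (\<lambda>n. F (k n) r)" using conv LIMSEQ_imp_Cauchy by blast
    then obtain N where N: "\<And>m n. m \<ge> N \<Longrightarrow> n \<ge> N \<Longrightarrow> dist (F (k m) r) (F (k n) r) < e / 3"
      using metric_CauchyD[of _ "e/3"] e by (metis zero_less_divide_iff zero_less_numeral)
    have "dist (F (k m) x) (F (k n) x) < e" if "m \<ge> N" "n \<ge> N" for m n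
      using N[OF that] d(2)[of x r "k m"] d(2)[of x r "k n"] r unfolding dist_real_def by linarith
    then show "\<exists>N. \<forall>m\<ge>N. \<forall>n\<ge>N. dist (F (k m) x) (F (k n) x) < e" by blast
  qed
  then have "\<forall>x. \<exists>l. (\<lambda>n. F (k n) x) \<longlonglongrightarrow> l"
    using Cauchy_convergent convergent_def by blast
  from choice[OF this] show thesis using that k by blast
qed

text \<open>Barbalat's argument: by uniform continuity a value \<open>e\<close> far to the left
  forces a bump of area \<open>e / 2 * d\<close>, more than the remaining tail of the
  integral.\<close>

lemma tendsto_at_bot_0_of_integrable:
  fixes f :: "real \<Rightarrow> real"
  assumes [measurable]: "f \<in> borel_measurable borel" and nonneg: "\<And>t. 0 \<le> f t"
    and unif: "\<And>e. 0 < e \<Longrightarrow> \<exists>d>0. \<forall>x y. \<bar>x - y\<bar> < d \<longrightarrow> \<bar>f x - f y\<bar> < e"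
    and fin: "(\<integral>\<^sup>+t. ennreal (f t) * indicator {..a} t \<partial>lborel) < \<infinity>"
  shows "(f \<longlongrightarrow> 0) at_bot"
proof (rule tendstoI)
  fix e :: real assume e: "0 < e"
  obtain d where d: "d > 0" "\<And>x y. \<bar>x - y\<bar> < d \<Longrightarrow> \<bar>f x - f y\<bar> < e / 2"
    using unif[of "e/2"] e by auto
  have "(\<lambda>n. \<integral>\<^sup>+t. ennreal (f t) * indicator {..a - real n} t \<partial>lborel) \<longlonglongrightarrow> (\<integral>\<^sup>+(t::real). 0 \<partial>lborel)"
  proof (rule nn_integral_dominated_convergence[where w = "\<lambda>t. ennreal (f t) * indicator {..a} t"])
    show "AE t in lborel. (\<lambda>n. ennreal (f t) * indicator {..a - real n} t) \<longlonglongrightarrow> 0"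
    proof (intro AE_I2 tendsto_eventually)
      fix t
      obtain N where "a - t < real N" using reals_Archimedean2 by blast
      then show "\<forall>\<^sub>F n in sequentially. ennreal (f t) * indicator {..a - real n} t = 0"
        by (intro eventually_sequentiallyI[of N]) auto
    qed
  qed (use fin in \<open>auto simp: indicator_def\<close>)
  then have "\<forall>\<^sub>F n in sequentially. (\<integral>\<^sup>+t. ennreal (f t) * indicator {..a - real n} t \<partial>lborel) < ennreal (e / 2 * d)"
    using e d(1) by (intro order_tendstoD(2)) auto
  then obtain n where n: "(\<integral>\<^sup>+t. ennreal (f t) * indicator {..a - real n} t \<partial>lborel) < ennreal (e / 2 * d)"
    by (auto simp: eventually_sequentially)
  have "f t < e" if t: "t \<le> a - real n" for t
  proof (rule ccontr)
    assume "\<not> f t < e"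
    then have "f x \<ge> e / 2" if "x \<in> {t - d<..t}" for x
      using d(2)[of x t] that unfolding greaterThanAtMost_iff by arith
    then have "(\<integral>\<^sup>+x. ennreal (e / 2) * indicator {t - d<..t} x \<partial>lborel) \<le> (\<integral>\<^sup>+t. ennreal (f t) * indicator {..a - real n} t \<partial>lborel)"
      using t by (intro nn_integral_mono) (auto simp: indicator_def intro!: ennreal_leI)
    moreover have "(\<integral>\<^sup>+x. ennreal (e / 2) * indicator {t - d<..t} x \<partial>lborel) = ennreal (e / 2 * d)"
      using d(1) e by (subst nn_integral_cmult_indicator) (auto simp: ennreal_mult'[symmetric])
    ultimately show False using n by simp
  qed
  then show "\<forall>\<^sub>F t in at_bot. dist (f t) 0 < e"
    using nonneg by (auto simp: eventually_at_bot_linorder intro!: exI[of _ "a - real n"])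
qed

lemma continuous_AE_eq_0:
  fixes u :: "real \<Rightarrow> real"
  assumes cont: "continuous_on UNIV u" and AE: "AE x in lborel. a < x \<longrightarrow> x < c \<longrightarrow> u x = 0" and x: "a < x" "x < c"
  shows "u x = 0"
proof (rule ccontr)
  assume ux: "u x \<noteq> 0"
  define S where "S = {a<..<c} \<inter> {y. u y \<noteq> 0}"
  have "open S"
    unfolding S_def using cont by (intro open_Int open_Collect_neq) auto
  moreover have "x \<in> S" using x ux by (simp add: S_def)
  ultimately obtain d where d: "d > 0" "\<And>y. dist y x < d \<Longrightarrow> y \<in> S"
    unfolding open_dist by blast
  obtain N where N: "{y \<in> space lborel. \<not> (a < y \<longrightarrow> y < c \<longrightarrow> u y = 0)} \<subseteq> N"
      "emeasure lborel N = 0" "N \<in> sets lborel"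
    by (rule AE_E[OF AE])
  have "{x - d / 2..x + d / 2} \<subseteq> N"
  proof
    fix y assume "y \<in> {x - d / 2..x + d / 2}"
    then have "y \<in> S" using d(1) by (intro d(2)) (auto simp: dist_real_def)
    then show "y \<in> N" using N(1) by (auto simp: S_def)
  qed
  then have "emeasure lborel {x - d / 2..x + d / 2} \<le> emeasure lborel N"
    using N(3) by (intro emeasure_mono)
  then show False using d(1) N(2) by simp
qed

lemma nn_integral_exp_left_finite:
  assumes "0 < b" "0 \<le> c"
  shows "(\<integral>\<^sup>+ t. ennreal (c * exp (b * t)) * indicator {..0} t \<partial>lborel) < \<infinity>"
proof -
  have "(\<integral>\<^sup>+ t. ennreal (c * exp (b * t)) * indicator {..0} t \<partial>lborel) =
    (\<integral>\<^sup>+ t. ennreal (c * exp (- b * t)) * indicator {0..} t \<partial>lborel)"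
    using nn_integral_reflect[of "\<lambda>t. ennreal (c * exp (b * t)) * indicator {..0} t" 0, symmetric]
    by (simp add: indicator_def if_distrib cong: if_cong)
  also have "\<dots> = ennreal (0 - (- c / b * exp (- b * 0)))"
  proof (rule nn_integral_FTC_atLeast[where F = "\<lambda>t. - c / b * exp (- b * t)"])
    show "((\<lambda>t. - c / b * exp (- b * t)) \<longlongrightarrow> 0) at_top" using assms(1) by real_asymp
  qed (use assms in \<open>auto intro!: derivative_eq_intros\<close>)
  finally show ?thesis by simp
qed

subsection \<open>Supersolutions of a kernel with drift\<close>

text \<open>Values in ennreal make finiteness of the mass irrelevant. Because of the bounded
  support, comparing \<open>f\<close> with its convolution at \<open>t\<close> involves only values
  within distance \<open>R\<close> of \<open>t\<close>, where smallness of \<open>f\<close> can be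
  verified.\<close>

locale drift_kernel =
  fixes k :: "real \<Rightarrow> ennreal" and R b :: real
  assumes k_meas[measurable]: "k \<in> borel_measurable borel"
    and R_pos: "0 < R" and supp: "\<And>s. R < \<bar>s\<bar> \<Longrightarrow> k s = 0"
    and b_pos: "0 < b"
    and mass: "1 < (\<integral>\<^sup>+s. k s \<partial>lborel)"
    and contr: "(\<integral>\<^sup>+s. k s * ennreal (exp (- b * s)) \<partial>lborel) < 1"
begin

lemma mass_lower_bound:
  obtains r where "1 < r" "ennreal r < (\<integral>\<^sup>+s. k s \<partial>lborel)"
proof -
  obtain z where "1 < z" "z < (\<integral>\<^sup>+s. k s \<partial>lborel)" using dense[OF mass] by auto
  moreover from this have "z < top" by (meson order_less_le_trans top_greatest)
  then have eq: "ennreal (enn2real z) = z" by simp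
  moreover have "1 < enn2real z"
    using \<open>1 < z\<close> eq by (metis ennreal_1 ennreal_less_iff zero_le_one)
  ultimately show thesis using that[of "enn2real z"] by simp
qed

lemma exp_moment:
  obtains \<epsilon> \<alpha> where "0 < \<epsilon>" "\<epsilon> < b" "1 < \<alpha>"
    "ennreal \<alpha> \<le> (\<integral>\<^sup>+s. k s * ennreal (exp (- \<epsilon> * s)) \<partial>lborel)"
proof -
  obtain r where r: "1 < r" "ennreal r < (\<integral>\<^sup>+s. k s \<partial>lborel)"
    by (rule mass_lower_bound)
  define \<alpha> where "\<alpha> = (1 + r) / 2"
  \<comment> \<open>On the support the exponential is at least
    \<open>exp (- \<epsilon> * R)\<close>, and this choice gives
    \<open>r * exp (- \<epsilon> * R) \<ge> \<alpha>\<close>; the term \<open>b / 2\<close> keeps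
    \<epsilon> below \<open>b\<close>.\<close>
  define \<epsilon> where "\<epsilon> = min (b / 2) (ln (r / \<alpha>) / R)"
  have \<alpha>: "1 < \<alpha>" "\<alpha> < r" using r by (auto simp: \<alpha>_def)
  have "0 < ln (r / \<alpha>)" using \<alpha> by simp
  then have \<epsilon>: "0 < \<epsilon>" "\<epsilon> < b" using b_pos R_pos unfolding \<epsilon>_def by (simp, linarith)
  have "\<epsilon> * R \<le> ln (r / \<alpha>)" using R_pos by (simp add: \<epsilon>_def min_def field_simps)
  then have "exp (\<epsilon> * R) \<le> r / \<alpha>" using \<alpha> by (metis divide_pos_pos exp_le_cancel_iff exp_ln less_trans zero_less_one)
  then have "\<alpha> \<le> r * exp (- \<epsilon> * R)" using \<alpha> by (simp add: exp_minus field_simps)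
  then have "ennreal \<alpha> \<le> ennreal r * ennreal (exp (- \<epsilon> * R))"
    using r by (simp add: ennreal_mult'[symmetric] ennreal_leI)
  also have "\<dots> \<le> (\<integral>\<^sup>+s. k s \<partial>lborel) * ennreal (exp (- \<epsilon> * R))"
    using r by (intro mult_right_mono) auto
  also have "\<dots> = (\<integral>\<^sup>+s. k s * ennreal (exp (- \<epsilon> * R)) \<partial>lborel)"
    by (simp add: nn_integral_multc)
  also have "\<dots> \<le> (\<integral>\<^sup>+s. k s * ennreal (exp (- \<epsilon> * s)) \<partial>lborel)"
  proof (rule nn_integral_mono)
    fix s
    show "k s * ennreal (exp (- \<epsilon> * R)) \<le> k s * ennreal (exp (- \<epsilon> * s))"
      using supp[of s] \<epsilon> by (cases "R < \<bar>s\<bar>") (auto intro!: mult_left_mono ennreal_leI)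
  qed
  finally show thesis using that \<alpha> \<epsilon> by blast
qed

text \<open>The truncated difference of exponentials is a strict subsolution of the adjoint
  inequality; testing against it excludes nonzero supersolutions on a right half-line.\<close>

lemma supersolution_eventually_0:
  fixes f :: "real \<Rightarrow> real"
  assumes [measurable]: "f \<in> borel_measurable borel" and f: "\<And>t. 0 \<le> f t" "\<And>t. f t \<le> B"
    and super: "\<And>t. a \<le> t \<Longrightarrow> (\<integral>\<^sup>+s. k s * ennreal (f (t - s)) \<partial>lborel) \<le> ennreal (f t)"
  shows "AE t in lborel. a < t \<longrightarrow> f t = 0"
proof -
  obtain \<epsilon> \<alpha> where \<epsilon>: "0 < \<epsilon>" "\<epsilon> < b" and \<alpha>: "1 < \<alpha>"
    and mom: "ennreal \<alpha> \<le> (\<integral>\<^sup>+s. k s * ennreal (exp (- \<epsilon> * s)) \<partial>lborel)"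
    by (rule exp_moment)
  \<comment> \<open>The slowly decaying exponential is amplified by the kernel (moment above 1), the
    fast one is damped (moment below 1), so their difference is amplified. It vanishes at
    \<open>a\<close> and would be negative to the left of \<open>a\<close>.\<close>
  define w where "w t = (if a \<le> t then exp (- \<epsilon> * (t - a)) - exp (- b * (t - a)) else 0)" for t
  have [measurable]: "w \<in> borel_measurable borel" unfolding w_def by measurable
  have w_nonneg: "0 \<le> w t" for t
    using \<epsilon> by (auto simp: w_def intro!: mult_right_mono)
  have w_pos: "0 < w t" if "a < t" for t
    using \<epsilon> that by (auto simp: w_def)
  have adj: "ennreal (\<alpha> * w t) \<le> (\<integral>\<^sup>+s. k s * ennreal (w (t + s)) \<partial>lborel)" for t
  proof (cases "a \<le> t")
    case True
    define W where "W = (\<integral>\<^sup>+s. k s * ennreal (w (t + s)) \<partial>lborel)"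
    define E where "E = exp (- \<epsilon> * (t - a))"
    define E' where "E' = exp (- b * (t - a))"
    have pw: "ennreal E * ennreal (exp (- \<epsilon> * s)) \<le> ennreal (w (t + s)) + ennreal E' * ennreal (exp (- b * s))" for s
    proof -
      \<comment> \<open>Left of \<open>a\<close> the truncation replaces a negative value by 0,
        which only helps.\<close>
      have "exp (- \<epsilon> * (t + s - a)) \<le> w (t + s) + exp (- b * (t + s - a))"
      proof (cases "a \<le> t + s")
        case False
        then have "b * (t + s - a) \<le> \<epsilon> * (t + s - a)" using \<epsilon> by (intro mult_right_mono_neg) auto
        then show ?thesis using False by (simp add: w_def)
      qed (simp add: w_def)
      moreover have "exp (- \<epsilon> * (t + s - a)) = E * exp (- \<epsilon> * s)" "exp (- b * (t + s - a)) = E' * exp (- b * s)"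
        by (auto simp: E_def E'_def algebra_simps simp flip: exp_add)
      ultimately show ?thesis
        using w_nonneg by (simp add: E_def E'_def ennreal_leI flip: ennreal_mult' ennreal_plus)
    qed
    have "ennreal (E * \<alpha>) \<le> ennreal E * (\<integral>\<^sup>+s. k s * ennreal (exp (- \<epsilon> * s)) \<partial>lborel)"
      using mom \<alpha> by (simp add: E_def ennreal_mult' mult_left_mono)
    also have "\<dots> = (\<integral>\<^sup>+s. k s * (ennreal E * ennreal (exp (- \<epsilon> * s))) \<partial>lborel)"
      by (subst nn_integral_cmult[symmetric]) (auto simp: mult_ac)
    also have "\<dots> \<le> (\<integral>\<^sup>+s. k s * (ennreal (w (t + s)) + ennreal E' * ennreal (exp (- b * s))) \<partial>lborel)"
      by (intro nn_integral_mono mult_left_mono pw) auto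
    also have "\<dots> = W + ennreal E' * (\<integral>\<^sup>+s. k s * ennreal (exp (- b * s)) \<partial>lborel)"
      unfolding W_def distrib_left
      by (subst nn_integral_add) (auto simp: mult_ac nn_integral_cmult[symmetric])
    also have "\<dots> \<le> W + ennreal E' * 1"
      using contr by (intro add_left_mono mult_left_mono) auto
    finally have *: "ennreal (E * \<alpha>) \<le> W + ennreal E'" by simp
    have "ennreal (\<alpha> * (E - E')) \<le> W"
    proof (cases W)
      case (real x)
      have "E * \<alpha> \<le> x + E'"
        using * real by (simp add: E_def E'_def flip: ennreal_plus)
      moreover have "E' \<le> \<alpha> * E'" using \<alpha> by (simp add: E'_def)
      ultimately show ?thesis using real by (simp add: algebra_simps ennreal_leI)
    qed simp
    then show ?thesis using True by (simp add: W_def w_def E_def E'_def)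
  qed (simp add: w_def)
  define I where "I = (\<integral>\<^sup>+t. ennreal (f t) * ennreal (w t) \<partial>lborel)"
  \<comment> \<open>Evaluating the pairing of \<open>f\<close> with \<open>w\<close> through the
    adjoint yields a factor \<alpha> > 1, while the supersolution inequality on the support of
    \<open>w\<close> allows only a factor 1.\<close>
  have "ennreal \<alpha> * I = (\<integral>\<^sup>+t. ennreal (f t) * ennreal (\<alpha> * w t) \<partial>lborel)"
    unfolding I_def using \<alpha> w_nonneg
    by (subst nn_integral_cmult[symmetric]) (auto simp: ennreal_mult' mult_ac)
  also have "\<dots> \<le> (\<integral>\<^sup>+t. ennreal (f t) * (\<integral>\<^sup>+s. k s * ennreal (w (t + s)) \<partial>lborel) \<partial>lborel)"
    by (intro nn_integral_mono mult_left_mono adj) auto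
  also have "\<dots> = (\<integral>\<^sup>+t. (\<integral>\<^sup>+s. k s * (ennreal (f t) * ennreal (w (t + s))) \<partial>lborel) \<partial>lborel)"
    by (subst nn_integral_cmult[symmetric]) (auto simp: mult_ac)
  also have "\<dots> = (\<integral>\<^sup>+s. (\<integral>\<^sup>+t. k s * (ennreal (f t) * ennreal (w (t + s))) \<partial>lborel) \<partial>lborel)"
    by (rule lborel_pair.Fubini') measurable
  also have "\<dots> = (\<integral>\<^sup>+s. (\<integral>\<^sup>+t. k s * (ennreal (f (t - s)) * ennreal (w t)) \<partial>lborel) \<partial>lborel)"
  proof (rule nn_integral_cong)
    fix s
    show "(\<integral>\<^sup>+t. k s * (ennreal (f t) * ennreal (w (t + s))) \<partial>lborel)
      = (\<integral>\<^sup>+t. k s * (ennreal (f (t - s)) * ennreal (w t)) \<partial>lborel)"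
      using nn_integral_shift[of "\<lambda>t. k s * (ennreal (f (t - s)) * ennreal (w t))" s] by simp
  qed
  also have "\<dots> = (\<integral>\<^sup>+t. (\<integral>\<^sup>+s. k s * (ennreal (f (t - s)) * ennreal (w t)) \<partial>lborel) \<partial>lborel)"
    by (rule lborel_pair.Fubini') measurable
  also have "\<dots> = (\<integral>\<^sup>+t. ennreal (w t) * (\<integral>\<^sup>+s. k s * ennreal (f (t - s)) \<partial>lborel) \<partial>lborel)"
    by (subst nn_integral_cmult[symmetric]) (auto simp: mult_ac)
  also have "\<dots> \<le> I"
    unfolding I_def
  proof (rule nn_integral_mono)
    fix t
    show "ennreal (w t) * (\<integral>\<^sup>+s. k s * ennreal (f (t - s)) \<partial>lborel) \<le> ennreal (f t) * ennreal (w t)"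
      using super[of t] by (cases "a \<le> t") (auto simp: mult.commute w_def intro!: mult_right_mono)
  qed
  finally have le: "ennreal \<alpha> * I \<le> I" .
  \<comment> \<open>Boundedness of \<open>f\<close> and decay of \<open>w\<close> make
    \<open>I\<close> finite; otherwise \<alpha> I <= I would not force I = 0.\<close>
  have "I \<le> (\<integral>\<^sup>+t. ennreal (\<bar>B\<bar> * exp (- \<epsilon> * (t - a))) * indicator {a..} t \<partial>lborel)"
    unfolding I_def
  proof (rule nn_integral_mono)
    fix t
    show "ennreal (f t) * ennreal (w t) \<le> ennreal (\<bar>B\<bar> * exp (- \<epsilon> * (t - a))) * indicator {a..} t"
      using f[of t] by (auto simp: w_def indicator_def ennreal_mult' intro!: mult_mono ennreal_leI)
  qed
  also have "\<dots> = ennreal (0 - (- \<bar>B\<bar> / \<epsilon> * exp (- \<epsilon> * (a - a))))"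
  proof (rule nn_integral_FTC_atLeast[where F = "\<lambda>t. - \<bar>B\<bar> / \<epsilon> * exp (- \<epsilon> * (t - a))"])
    show "((\<lambda>t. - \<bar>B\<bar> / \<epsilon> * exp (- \<epsilon> * (t - a))) \<longlongrightarrow> 0) at_top"
      using \<epsilon>(1) by real_asymp
  qed (use \<epsilon>(1) in \<open>auto intro!: derivative_eq_intros\<close>)
  finally have "I < \<infinity>" using ennreal_less_top order_le_less_trans infinity_ennreal_def by metis
  with le \<alpha> have "I = 0"
    by (cases I) (auto simp: ennreal_mult'[symmetric] mult_le_cancel_right2)
  then have "AE t in lborel. ennreal (f t) * ennreal (w t) = 0"
    unfolding I_def by (subst (asm) nn_integral_0_iff_AE) auto
  then show ?thesis
  proof eventually_elim
    case (elim t)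
    then show ?case using w_pos[of t] f(1)[of t] by (auto simp: ennreal_eq_0_iff)
  qed
qed

text \<open>Integrate the inequality over t <= -R. A shift by at most \<open>R\<close> carries t <=
  -2 R into this region, so m X <= Y, while Y exceeds X by at most the integral over an interval of
  length \<open>R\<close> on which f <= \<delta>. Finiteness of X, with no bound on its size,
  permits the subtraction.\<close>

lemma supersolution_left_mass:
  fixes f :: "real \<Rightarrow> real"
  assumes [measurable]: "f \<in> borel_measurable borel" and f: "\<And>t. 0 \<le> f t" "\<And>t. t \<le> 0 \<Longrightarrow> f t \<le> \<delta>"
    and super: "\<And>t. t \<le> - R \<Longrightarrow> (\<integral>\<^sup>+s. k s * ennreal (f (t - s)) \<partial>lborel) \<le> ennreal (f t)"
    and fin: "(\<integral>\<^sup>+t. ennreal (f t) * indicator {..0} t \<partial>lborel) < \<infinity>"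
    and m: "1 < m" "ennreal m \<le> (\<integral>\<^sup>+s. k s \<partial>lborel)"
  shows "(\<integral>\<^sup>+t. ennreal (f t) * indicator {..- 2 * R} t \<partial>lborel) \<le> ennreal (R * \<delta> / (m - 1))"
proof -
  define X where "X = (\<integral>\<^sup>+t. ennreal (f t) * indicator {..- 2 * R} t \<partial>lborel)"
  define Y where "Y = (\<integral>\<^sup>+t. ennreal (f t) * indicator {..- R} t \<partial>lborel)"
  have \<delta>: "0 \<le> \<delta>" using f(1)[of 0] f(2)[of 0] by simp
  have "X \<le> (\<integral>\<^sup>+t. ennreal (f t) * indicator {..0} t \<partial>lborel)"
    unfolding X_def using R_pos by (intro nn_integral_mono) (auto simp: indicator_def)
  then have X_fin: "X < \<infinity>" using fin by (rule order_le_less_trans)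
  have "Y \<le> (\<integral>\<^sup>+t. ennreal (f t) * indicator {..- 2 * R} t + ennreal \<delta> * indicator {- 2 * R .. - R} t \<partial>lborel)"
    unfolding Y_def using f R_pos by (intro nn_integral_mono) (auto simp: indicator_def intro!: ennreal_leI)
  also have "\<dots> = X + ennreal (R * \<delta>)"
    unfolding X_def using R_pos \<delta>
    by (subst nn_integral_add) (auto simp: nn_integral_cmult_indicator ennreal_mult' mult.commute)
  finally have Y: "Y \<le> X + ennreal (R * \<delta>)" .
  have "ennreal m * X \<le> (\<integral>\<^sup>+s. k s \<partial>lborel) * X" using m by (intro mult_right_mono) auto
  also have "\<dots> = (\<integral>\<^sup>+s. k s * X \<partial>lborel)" by (simp add: nn_integral_multc)
  also have "\<dots> \<le> (\<integral>\<^sup>+s. k s * (\<integral>\<^sup>+t. ennreal (f (t - s)) * indicator {..- R} t \<partial>lborel) \<partial>lborel)"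
  proof (rule nn_integral_mono)
    fix s
    show "k s * X \<le> k s * (\<integral>\<^sup>+t. ennreal (f (t - s)) * indicator {..- R} t \<partial>lborel)"
    proof (cases "R < \<bar>s\<bar>")
      case False
      have "(\<integral>\<^sup>+t. ennreal (f (t - s)) * indicator {..- R} t \<partial>lborel) =
        (\<integral>\<^sup>+t. ennreal (f t) * indicator {..- R} (t + s) \<partial>lborel)"
        using nn_integral_shift[of "\<lambda>t. ennreal (f (t - s)) * indicator {..- R} t" s] by simp
      then show ?thesis using False unfolding X_def
        by (auto intro!: mult_left_mono nn_integral_mono simp: indicator_def)
    qed (simp add: supp)
  qed
  also have "\<dots> = (\<integral>\<^sup>+s. (\<integral>\<^sup>+t. k s * (ennreal (f (t - s)) * indicator {..- R} t) \<partial>lborel) \<partial>lborel)"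
    by (subst nn_integral_cmult) auto
  also have "\<dots> = (\<integral>\<^sup>+t. (\<integral>\<^sup>+s. k s * (ennreal (f (t - s)) * indicator {..- R} t) \<partial>lborel) \<partial>lborel)"
    by (rule lborel_pair.Fubini') measurable
  also have "\<dots> = (\<integral>\<^sup>+t. indicator {..- R} t * (\<integral>\<^sup>+s. k s * ennreal (f (t - s)) \<partial>lborel) \<partial>lborel)"
    by (subst nn_integral_cmult[symmetric]) (auto simp: mult_ac)
  also have "\<dots> \<le> Y"
    unfolding Y_def using super by (intro nn_integral_mono) (auto simp: indicator_def)
  finally have "ennreal m * X \<le> X + ennreal (R * \<delta>)" using Y by (rule order_trans)
  with X_fin show ?thesis
    unfolding X_def[symmetric] using m(1) \<delta> R_pos
    by (cases X) (auto simp: ennreal_mult'[symmetric] field_simps simp flip: ennreal_plus)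
qed

end

subsection \<open>One-dimensional dynamics\<close>

text \<open>If \<open>u < \<kappa>\<close>, then \<open>p\<close> must lie above and
  \<open>p'\<close> below \<kappa>, so some \<open>x\<close> between \<open>p'\<close> and \<kappa>
  has \<open>H x = p\<close>. Then \<open>H (H x) \<le> u \<le> x\<close>, which global attraction
  excludes.\<close>

lemma globally_attracting_interval:
  fixes H :: "real \<Rightarrow> real"
  assumes cont: "continuous_on {0..z} H"
    and maps: "\<And>s. 0 < s \<Longrightarrow> s \<le> z \<Longrightarrow> 0 < H s \<and> H s \<le> z"
    and below: "\<And>s. 0 < s \<Longrightarrow> s < \<kappa> \<Longrightarrow> s < H s"
    and above: "\<And>s. \<kappa> < s \<Longrightarrow> s \<le> z \<Longrightarrow> H s < s"
    and \<kappa>: "0 < \<kappa>" "\<kappa> \<le> z" "H \<kappa> = \<kappa>"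
    and attract: "\<And>s. 0 < s \<Longrightarrow> s \<le> z \<Longrightarrow> (\<lambda>n. (H ^^ n) s) \<longlonglongrightarrow> \<kappa>"
    and uv: "0 < u" "v \<le> z"
    and p: "p \<in> {u..v}" "H p \<le> u" and p': "p' \<in> {u..v}" "v \<le> H p'"
  shows "u = \<kappa>" "v = \<kappa>"
proof -
  \<comment> \<open>Attraction leaves no fixed point of the second iterate in (0, \<kappa>), so
    \<open>H (H w) - w\<close> has constant sign there. Were it negative, the even iterates starting
    at \<open>x\<close> would stay below \<open>x\<close> and could not tend to \<kappa>.\<close>
  have no_two_cycle: "\<not> H (H x) \<le> x" if x: "0 < x" "x < \<kappa>" for x
  proof
    assume le: "H (H x) \<le> x"
    have fixed: "H (H w) \<noteq> w" if w: "0 < w" "w < \<kappa>" for w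
    proof
      assume eq: "H (H w) = w"
      have "(H ^^ (2 * n)) w = w" for n by (induction n) (simp_all add: eq)
      moreover have "(\<lambda>n. (H ^^ (2 * n)) w) \<longlonglongrightarrow> \<kappa>"
        using LIMSEQ_subseq_LIMSEQ[OF attract[of w], of "\<lambda>n. 2 * n"] w \<kappa>(2)
        by (simp add: o_def strict_mono_def)
      ultimately have "w = \<kappa>" by (simp add: LIMSEQ_const_iff)
      then show False using w by simp
    qed
    have cont2: "continuous_on {0<..<\<kappa>} (\<lambda>w. H (H w) - w)"
      using maps \<kappa>(2)
      by (intro continuous_intros continuous_on_compose2[OF cont continuous_on_subset[OF cont]])
        (force intro: less_imp_le)+
    have less: "H (H w) < w" if w: "0 < w" "w \<le> x" for w
    proof (rule ccontr)
      assume "\<not> H (H w) < w"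
      moreover have "continuous_on {w..x} (\<lambda>w. H (H w) - w)"
        using w x by (intro continuous_on_subset[OF cont2]) auto
      ultimately obtain y where "w \<le> y" "y \<le> x" "H (H y) - y = 0"
        using IVT2'[of "\<lambda>w. H (H w) - w" x 0 w] le w by auto
      then show False using fixed[of y] w x by simp
    qed
    have iter: "0 < (H ^^ (2 * n)) x \<and> (H ^^ (2 * n)) x \<le> x" for n
    proof (induction n)
      case (Suc n)
      define w where "w = (H ^^ (2 * n)) x"
      have w: "0 < w" "w \<le> x" using Suc by (auto simp: w_def)
      then have "0 < H w" "H w \<le> z" using maps[of w] x \<kappa>(2) by auto
      then have "0 < H (H w)" using maps[of "H w"] by auto
      moreover have "(H ^^ (2 * Suc n)) x = H (H w)" by (simp add: w_def)
      ultimately show ?case using less[OF w] w by simp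
    qed (use x in simp)
    have "(\<lambda>n. (H ^^ (2 * n)) x) \<longlonglongrightarrow> \<kappa>"
      using LIMSEQ_subseq_LIMSEQ[OF attract[of x], of "\<lambda>n. 2 * n"] x \<kappa>(2)
      by (simp add: o_def strict_mono_def)
    then have "\<kappa> \<le> x" by (rule LIMSEQ_le_const2) (use iter in blast)
    then show False using x by simp
  qed
  have p_pos: "0 < p" "0 < p'" "p \<le> z" "p' \<le> z" using p p' uv by auto
  have "\<not> u < \<kappa>"
  proof
    assume u: "u < \<kappa>"
    have "\<kappa> < p"
    proof (rule ccontr)
      assume "\<not> \<kappa> < p"
      then consider "p < \<kappa>" | "p = \<kappa>" by linarith
      then show False using below[of p] p p_pos u \<kappa>(3) by cases auto
    qed
    then have "\<kappa> < v" using p by simp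
    have "p' < \<kappa>"
    proof (rule ccontr)
      assume "\<not> p' < \<kappa>"
      then consider "\<kappa> < p'" | "p' = \<kappa>" by linarith
      then show False using above[of p'] p' p_pos \<open>\<kappa> < v\<close> \<kappa>(3) by cases auto
    qed
    moreover have "continuous_on {p'..\<kappa>} H"
      using p_pos \<kappa> by (intro continuous_on_subset[OF cont]) auto
    moreover have "p \<le> H p'" "H \<kappa> \<le> p" using p p' \<kappa>(3) \<open>\<kappa> < p\<close> by auto
    ultimately obtain x where x: "p' \<le> x" "x \<le> \<kappa>" "H x = p"
      using IVT2'[of H \<kappa> p p'] by auto
    then have "x \<noteq> \<kappa>" using \<kappa>(3) \<open>\<kappa> < p\<close> by auto
    then show False using no_two_cycle[of x] x p p' p_pos by auto
  qed
  moreover have "\<not> \<kappa> < v" if "\<kappa> \<le> u"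
  proof
    assume "\<kappa> < v"
    have "\<kappa> < p' \<or> p' = \<kappa>" using p'(1) that by auto
    then consider "\<kappa> < p'" | "p' = \<kappa>" by blast
    then show False using above[of p'] p' p_pos \<open>\<kappa> < v\<close> \<kappa>(3) by cases auto
  qed
  moreover have "u \<le> v" using p by simp
  ultimately show "u = \<kappa>" "v = \<kappa>" by auto
qed

subsection \<open>The convolution operator\<close>

text \<open>The hypothesis on \<chi> is reduced to inequalities for \<open>chi_int\<close> at 0 and
  at one \<open>b > 0\<close>. In this form the case of a negative interval is an instance for the
  reflected kernel and \<open>- b\<close>.\<close>

locale semiwavefront_data = finite_measure M
  for M :: "'a measure" +
  fixes K :: "real \<Rightarrow> 'a \<Rightarrow> real" and g :: "real \<Rightarrow> 'a \<Rightarrow> real" and gd :: "'a \<Rightarrow> real"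
    and \<tau>0 :: 'a and \<zeta>1 \<zeta>2 b :: real
  assumes K_meas: "(\<lambda>(s, \<tau>). K s \<tau>) \<in> borel_measurable (lborel \<Otimes>\<^sub>M M)"
    and K_nonneg: "\<And>s \<tau>. \<tau> \<in> space M \<Longrightarrow> 0 \<le> K s \<tau>"
    and K_pos: "\<And>\<tau>. \<tau> \<in> space M \<Longrightarrow> 0 < (\<integral>\<^sup>+ s. ennreal (K s \<tau>) \<partial>lborel)"
    and g_meas: "(\<lambda>(v, \<tau>). g v \<tau>) \<in> borel_measurable (borel \<Otimes>\<^sub>M M)"
    and g_nonneg: "\<And>v \<tau>. \<tau> \<in> space M \<Longrightarrow> 0 \<le> v \<Longrightarrow> 0 \<le> g v \<tau>"
    and g_zero: "\<And>\<tau>. \<tau> \<in> space M \<Longrightarrow> g 0 \<tau> = 0"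
    and g_cont: "\<And>\<tau>. \<tau> \<in> space M \<Longrightarrow> continuous_on {0..} (\<lambda>v. g v \<tau>)"
    and g_deriv: "\<And>\<tau>. \<tau> \<in> space M \<Longrightarrow> ((\<lambda>v. g v \<tau>) has_real_derivative gd \<tau>) (at 0 within {0..})"
    and gd_pos: "\<And>\<tau>. \<tau> \<in> space M \<Longrightarrow> 0 < gd \<tau>"
    and N: "condN M K g \<tau>0 \<zeta>2"
    and g_sub: "\<And>s \<tau>. \<tau> \<in> space M \<Longrightarrow> 0 \<le> s \<Longrightarrow> g s \<tau> \<le> gd \<tau> * s"
    and \<zeta>1: "0 < \<zeta>1" "\<zeta>1 < \<zeta>2"
    and G_min: "\<And>s. s \<in> {\<zeta>1..\<zeta>2} \<Longrightarrow> Gmap M K g \<tau>0 \<zeta>2 \<zeta>1 \<le> Gmap M K g \<tau>0 \<zeta>2 s"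
    and G_above: "\<And>s. s \<in> {0<..\<zeta>1} \<Longrightarrow> s < Gmap M K g \<tau>0 \<zeta>2 s"
    and chi_0: "chi_int M K gd 0 < \<infinity>" "1 < chi_int M K gd 0"
    and b: "0 < b" "chi_int M K gd b < 1"
begin

lemma K_measurable[measurable (raw)]:
  assumes [measurable]: "f \<in> borel_measurable L" "h \<in> measurable L M"
  shows "(\<lambda>x. K (f x) (h x)) \<in> borel_measurable L"
proof -
  have "(\<lambda>x. (f x, h x)) \<in> measurable L (lborel \<Otimes>\<^sub>M M)" by measurable
  from measurable_compose[OF this K_meas] show ?thesis by simp
qed

lemma g_measurable[measurable (raw)]:
  assumes [measurable]: "f \<in> borel_measurable L" "h \<in> measurable L M"
  shows "(\<lambda>x. g (f x) (h x)) \<in> borel_measurable L"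
proof -
  have "(\<lambda>x. (f x, h x)) \<in> measurable L (borel \<Otimes>\<^sub>M M)" by measurable
  from measurable_compose[OF this g_meas] show ?thesis by simp
qed

text \<open>As a pointwise limit of difference quotients of \<open>g\<close> along 1/(n+1).\<close>

lemma gd_measurable[measurable]: "gd \<in> borel_measurable M"
proof (rule borel_measurable_LIMSEQ_real)
  show "(\<lambda>\<tau>. g (inverse (real (Suc n))) \<tau> / inverse (real (Suc n))) \<in> borel_measurable M" for n
    by measurable
  fix \<tau> assume \<tau>: "\<tau> \<in> space M"
  have "((\<lambda>v. g v \<tau> / v) \<longlongrightarrow> gd \<tau>) (at 0 within {0..})"
    using g_deriv[OF \<tau>] g_zero[OF \<tau>] by (simp add: has_field_derivative_iff)
  moreover have "filterlim (\<lambda>n. inverse (real (Suc n))) (at 0 within {0..}) sequentially"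
    unfolding filterlim_at using LIMSEQ_inverse_real_of_nat by (auto intro!: always_eventually)
  ultimately show "(\<lambda>n. g (inverse (real (Suc n))) \<tau> / inverse (real (Suc n))) \<longlonglongrightarrow> gd \<tau>"
    by (rule filterlim_compose)
qed

lemma
  shows \<tau>0[measurable]: "\<tau>0 \<in> space M" "{\<tau>0} \<in> sets M"
    and \<tau>0_mass: "emeasure M {\<tau>0} = 1"
    and g_mono: "\<tau> \<in> space M \<Longrightarrow> \<tau> \<noteq> \<tau>0 \<Longrightarrow> 0 \<le> u \<Longrightarrow> u \<le> v \<Longrightarrow> g u \<tau> \<le> g v \<tau>"
    and g0_pos: "0 < v \<Longrightarrow> 0 < g v \<tau>0"
    and \<zeta>2: "0 < \<zeta>2"
    and tilde_g_finite: "0 \<le> v \<Longrightarrow> v \<le> \<zeta>2 \<Longrightarrow> tilde_g M K g \<tau>0 v < \<infinity>"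
    and Theta_mono: "strict_mono_on {0..\<zeta>2} (Theta M K g \<tau>0)"
    and g0_max: "\<exists>v0 \<ge> 0. (\<forall>v \<ge> 0. g v \<tau>0 \<le> g v0 \<tau>0) \<and> Cconst K \<tau>0 * g v0 \<tau>0 < Theta M K g \<tau>0 \<zeta>2"
  using N by (auto simp: condN_def mono_on_def)

text \<open>(N1) states positivity only at \<open>\<tau>0\<close>; for other \<tau> the positive
  derivative gives it near 0 and monotonicity carries it to all v > 0.\<close>

lemma g_pos:
  assumes \<tau>: "\<tau> \<in> space M" and v: "0 < v"
  shows "0 < g v \<tau>"
proof (cases "\<tau> = \<tau>0")
  case False
  obtain d where d: "d > 0" "\<And>h. 0 < h \<Longrightarrow> h < d \<Longrightarrow> 0 < g h \<tau>"
    using has_real_derivative_pos_inc_right[OF g_deriv[OF \<tau>] gd_pos[OF \<tau>]] g_zero[OF \<tau>] by auto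
  have "0 < g (min (d/2) v) \<tau>" using d v by auto
  also have "\<dots> \<le> g v \<tau>" using d v by (intro g_mono \<tau> False) auto
  finally show ?thesis .
qed (use g0_pos v in simp)

lemma tendsto_g:
  assumes "\<tau> \<in> space M" "u \<longlonglongrightarrow> v" "\<And>n. 0 \<le> u n"
  shows "(\<lambda>n. g (u n) \<tau>) \<longlonglongrightarrow> g v \<tau>"
proof -
  have "0 \<le> v" using assms(2,3) by (intro LIMSEQ_le_const) auto
  then show ?thesis using assms by (intro continuous_on_tendsto_compose[OF g_cont]) auto
qed

text \<open>Measurability in place of continuity admits the step functions to which Brouwer's
  theorem is applied.\<close>

definition adm :: "(real \<Rightarrow> real) \<Rightarrow> bool" where
  "adm f \<longleftrightarrow> f \<in> borel_measurable borel \<and> (\<forall>t. 0 \<le> f t \<and> f t \<le> \<zeta>2)"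

lemma admD: "adm f \<Longrightarrow> f \<in> borel_measurable borel" "adm f \<Longrightarrow> 0 \<le> f t" "adm f \<Longrightarrow> f t \<le> \<zeta>2"
  by (auto simp: adm_def)

definition conv :: "(real \<Rightarrow> real) \<Rightarrow> real \<Rightarrow> ennreal" where
  "conv f t = (\<integral>\<^sup>+ \<tau>. (\<integral>\<^sup>+ s. ennreal (K s \<tau> * g (f (t - s)) \<tau>) \<partial>lborel) \<partial>M)"

definition A :: "(real \<Rightarrow> real) \<Rightarrow> real \<Rightarrow> real" where
  "A f t = enn2real (conv f t)"

lemma chi_int_0: "chi_int M K gd 0 = (\<integral>\<^sup>+ \<tau>. (\<integral>\<^sup>+ s. ennreal (K s \<tau> * gd \<tau>) \<partial>lborel) \<partial>M)"
  by (simp add: chi_int_def)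

lemma mass_cmult:
  assumes "0 \<le> z" shows "(\<integral>\<^sup>+ \<tau>. (\<integral>\<^sup>+ s. ennreal (z * (K s \<tau> * gd \<tau>)) \<partial>lborel) \<partial>M) = ennreal z * chi_int M K gd 0"
proof -
  have "(\<integral>\<^sup>+ \<tau>. (\<integral>\<^sup>+ s. ennreal (z * (K s \<tau> * gd \<tau>)) \<partial>lborel) \<partial>M) =
    (\<integral>\<^sup>+ \<tau>. ennreal z * (\<integral>\<^sup>+ s. ennreal (K s \<tau> * gd \<tau>) \<partial>lborel) \<partial>M)"
    using assms by (intro nn_integral_cong) (simp add: ennreal_mult' nn_integral_cmult)
  then show ?thesis by (simp add: chi_int_0 nn_integral_cmult)
qed

lemma AE_K_finite: "AE \<tau> in M. (\<integral>\<^sup>+ s. ennreal (K s \<tau>) \<partial>lborel) < \<infinity>"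
proof -
  have "AE \<tau> in M. (\<integral>\<^sup>+ s. ennreal (K s \<tau> * gd \<tau>) \<partial>lborel) \<noteq> \<infinity>"
    using chi_0(1) by (intro nn_integral_PInf_AE) (auto simp: chi_int_0)
  then show ?thesis
  proof (rule AE_mp, intro AE_I2 impI)
    fix \<tau> assume \<tau>: "\<tau> \<in> space M" and fin: "(\<integral>\<^sup>+ s. ennreal (K s \<tau> * gd \<tau>) \<partial>lborel) \<noteq> \<infinity>"
    have "(\<integral>\<^sup>+ s. ennreal (K s \<tau> * gd \<tau>) \<partial>lborel) = (\<integral>\<^sup>+ s. ennreal (K s \<tau>) \<partial>lborel) * ennreal (gd \<tau>)"
      using \<tau> gd_pos[OF \<tau>] by (simp add: ennreal_mult'' nn_integral_multc)
    then show "(\<integral>\<^sup>+ s. ennreal (K s \<tau>) \<partial>lborel) < \<infinity>"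
      using fin gd_pos[OF \<tau>] by (auto simp: ennreal_mult_eq_top_iff less_top)
  qed
qed

lemma g_bound:
  assumes "\<tau> \<in> space M" "0 \<le> v" "v \<le> z"
  shows "K s \<tau> * g v \<tau> \<le> z * (K s \<tau> * gd \<tau>)"
proof -
  have "g v \<tau> \<le> gd \<tau> * z"
    using g_sub[OF assms(1,2)] gd_pos[OF assms(1)] assms(3) by (meson mult_left_mono order_trans less_imp_le)
  from mult_left_mono[OF this K_nonneg[OF assms(1), of s]] show ?thesis by (simp add: mult_ac)
qed

lemma conv_finite:
  assumes "adm f" shows "conv f t < \<infinity>"
proof -
  have "conv f t \<le> (\<integral>\<^sup>+ \<tau>. (\<integral>\<^sup>+ s. ennreal (\<zeta>2 * (K s \<tau> * gd \<tau>)) \<partial>lborel) \<partial>M)"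
    unfolding conv_def by (intro nn_integral_mono ennreal_leI g_bound admD[OF assms])
  also have "\<dots> < \<infinity>" using chi_0(1) \<zeta>2 by (simp add: mass_cmult ennreal_mult_less_top)
  finally show ?thesis .
qed

lemma ennreal_A: "adm f \<Longrightarrow> ennreal (A f t) = conv f t"
  using conv_finite[of f t] by (simp add: A_def less_top)

lemma A_nonneg: "0 \<le> A f t" by (simp add: A_def)

text \<open>Since \<chi>(0) is finite, \<open>\<zeta>2 * (K s \<tau> * gd \<tau>)\<close> is a
  common integrable majorant. The inner dominated convergence works for those \<tau> at which
  \<open>K\<close> is integrable in \<open>s\<close>, the outer one needs it only almost
  everywhere.\<close>

lemma conv_tendsto:
  assumes adm: "\<And>n. adm (f n)" and lim: "\<And>t. (\<lambda>n. f n t) \<longlonglongrightarrow> h t"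
  shows "(\<lambda>n. conv (f n) t) \<longlonglongrightarrow> conv h t"
proof -
  have [measurable]: "f n \<in> borel_measurable borel" for n using adm by (rule admD)
  have [measurable]: "h \<in> borel_measurable borel"
    by (rule borel_measurable_LIMSEQ_real[OF lim]) measurable
  have bd: "K s \<tau> * g (f n (t - s)) \<tau> \<le> \<zeta>2 * (K s \<tau> * gd \<tau>)" if "\<tau> \<in> space M" for n s \<tau>
    using that by (intro g_bound admD[OF adm])
  show ?thesis
    unfolding conv_def
  proof (rule nn_integral_dominated_convergence[where w = "\<lambda>\<tau>. \<integral>\<^sup>+ s. ennreal (\<zeta>2 * (K s \<tau> * gd \<tau>)) \<partial>lborel"])
    show "(\<integral>\<^sup>+ \<tau>. (\<integral>\<^sup>+ s. ennreal (\<zeta>2 * (K s \<tau> * gd \<tau>)) \<partial>lborel) \<partial>M) < \<infinity>"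
      using chi_0(1) \<zeta>2 by (simp add: mass_cmult ennreal_mult_less_top)
    show "AE \<tau> in M. (\<integral>\<^sup>+ s. ennreal (K s \<tau> * g (f n (t - s)) \<tau>) \<partial>lborel)
        \<le> (\<integral>\<^sup>+ s. ennreal (\<zeta>2 * (K s \<tau> * gd \<tau>)) \<partial>lborel)" for n
      using bd by (intro AE_I2 nn_integral_mono ennreal_leI)
    show "AE \<tau> in M. (\<lambda>n. \<integral>\<^sup>+ s. ennreal (K s \<tau> * g (f n (t - s)) \<tau>) \<partial>lborel)
        \<longlonglongrightarrow> (\<integral>\<^sup>+ s. ennreal (K s \<tau> * g (h (t - s)) \<tau>) \<partial>lborel)"
      using AE_K_finite
    proof (rule AE_mp, intro AE_I2 impI)
      fix \<tau> assume \<tau>: "\<tau> \<in> space M" and fin: "(\<integral>\<^sup>+ s. ennreal (K s \<tau>) \<partial>lborel) < \<infinity>"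
      show "(\<lambda>n. \<integral>\<^sup>+ s. ennreal (K s \<tau> * g (f n (t - s)) \<tau>) \<partial>lborel)
        \<longlonglongrightarrow> (\<integral>\<^sup>+ s. ennreal (K s \<tau> * g (h (t - s)) \<tau>) \<partial>lborel)"
      proof (rule nn_integral_dominated_convergence[where w = "\<lambda>s. ennreal (\<zeta>2 * (K s \<tau> * gd \<tau>))"])
        show "(\<integral>\<^sup>+ s. ennreal (\<zeta>2 * (K s \<tau> * gd \<tau>)) \<partial>lborel) < \<infinity>"
          using fin \<tau> \<zeta>2 gd_pos[OF \<tau>]
          by (simp add: ennreal_mult' ennreal_mult'' nn_integral_cmult nn_integral_multc ennreal_mult_less_top)
        show "AE s in lborel. (\<lambda>n. ennreal (K s \<tau> * g (f n (t - s)) \<tau>)) \<longlonglongrightarrow> ennreal (K s \<tau> * g (h (t - s)) \<tau>)"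
          using \<tau> admD(2)[OF adm] lim by (intro AE_I2 tendsto_ennrealI tendsto_mult tendsto_const tendsto_g)
        show "AE s in lborel. ennreal (K s \<tau> * g (f n (t - s)) \<tau>) \<le> ennreal (\<zeta>2 * (K s \<tau> * gd \<tau>))" for n
          using bd[OF \<tau>] by (intro AE_I2 ennreal_leI)
      qed (use \<tau> in measurable)
    qed
  qed measurable
qed

text \<open>The L1 modulus of continuity of the kernel, weighted by \<open>gd\<close>. It contains
  no \<open>f\<close>, which makes the equicontinuity of \<open>A f\<close> uniform over all
  admissible \<open>f\<close>.\<close>

definition modulus :: "real \<Rightarrow> ennreal" where
  "modulus h = (\<integral>\<^sup>+ \<tau>. (\<integral>\<^sup>+ s. ennreal (\<bar>K (s + h) \<tau> - K s \<tau>\<bar>) * ennreal (gd \<tau>) \<partial>lborel) \<partial>M)"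

lemma modulus_tendsto_0:
  assumes h: "h \<longlonglongrightarrow> 0"
  shows "(\<lambda>n. modulus (h n)) \<longlonglongrightarrow> 0"
proof -
  have "(\<lambda>n. modulus (h n)) \<longlonglongrightarrow> (\<integral>\<^sup>+ \<tau>. 0 \<partial>M)"
    unfolding modulus_def
  proof (rule nn_integral_dominated_convergence[where w = "\<lambda>\<tau>. \<integral>\<^sup>+ s. ennreal (2 * (K s \<tau> * gd \<tau>)) \<partial>lborel"])
    show "(\<integral>\<^sup>+ \<tau>. (\<integral>\<^sup>+ s. ennreal (2 * (K s \<tau> * gd \<tau>)) \<partial>lborel) \<partial>M) < \<infinity>"
      using chi_0(1) mass_cmult[of 2] by (simp add: ennreal_mult_less_top)
    show "AE \<tau> in M. (\<integral>\<^sup>+ s. ennreal (\<bar>K (s + h n) \<tau> - K s \<tau>\<bar>) * ennreal (gd \<tau>) \<partial>lborel)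
        \<le> (\<integral>\<^sup>+ s. ennreal (2 * (K s \<tau> * gd \<tau>)) \<partial>lborel)" for n
    proof (rule AE_I2)
      fix \<tau> assume \<tau>: "\<tau> \<in> space M"
      have "(\<integral>\<^sup>+ s. ennreal (\<bar>K (s + h n) \<tau> - K s \<tau>\<bar>) * ennreal (gd \<tau>) \<partial>lborel)
        \<le> (\<integral>\<^sup>+ s. ennreal (K (s + h n) \<tau> * gd \<tau>) + ennreal (K s \<tau> * gd \<tau>) \<partial>lborel)"
      proof (rule nn_integral_mono)
        fix s
        have "\<bar>K (s + h n) \<tau> - K s \<tau>\<bar> * gd \<tau> \<le> (K (s + h n) \<tau> + K s \<tau>) * gd \<tau>"
          using K_nonneg[OF \<tau>, of s] K_nonneg[OF \<tau>, of "s + h n"] gd_pos[OF \<tau>] by (intro mult_right_mono) auto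
        then show "ennreal (\<bar>K (s + h n) \<tau> - K s \<tau>\<bar>) * ennreal (gd \<tau>) \<le> ennreal (K (s + h n) \<tau> * gd \<tau>) + ennreal (K s \<tau> * gd \<tau>)"
          using K_nonneg[OF \<tau>] gd_pos[OF \<tau>]
          by (simp add: ennreal_leI distrib_right less_imp_le flip: ennreal_mult' ennreal_plus)
      qed
      also have "\<dots> = (\<integral>\<^sup>+ s. ennreal (K (s + h n) \<tau> * gd \<tau>) \<partial>lborel) + (\<integral>\<^sup>+ s. ennreal (K s \<tau> * gd \<tau>) \<partial>lborel)"
        using \<tau> by (subst nn_integral_add) auto
      also have "\<dots> = 2 * (\<integral>\<^sup>+ s. ennreal (K s \<tau> * gd \<tau>) \<partial>lborel)"
        using \<tau> nn_integral_shift[of "\<lambda>s. ennreal (K s \<tau> * gd \<tau>)" "h n"] by (simp add: mult_2)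
      also have "\<dots> = (\<integral>\<^sup>+ s. ennreal 2 * ennreal (K s \<tau> * gd \<tau>) \<partial>lborel)"
        using \<tau> by (simp add: nn_integral_cmult)
      also have "\<dots> = (\<integral>\<^sup>+ s. ennreal (2 * (K s \<tau> * gd \<tau>)) \<partial>lborel)"
        by (simp only: ennreal_mult' zero_le_numeral)
      finally show "(\<integral>\<^sup>+ s. ennreal (\<bar>K (s + h n) \<tau> - K s \<tau>\<bar>) * ennreal (gd \<tau>) \<partial>lborel)
        \<le> (\<integral>\<^sup>+ s. ennreal (2 * (K s \<tau> * gd \<tau>)) \<partial>lborel)" .
    qed
    show "AE \<tau> in M. (\<lambda>n. \<integral>\<^sup>+ s. ennreal (\<bar>K (s + h n) \<tau> - K s \<tau>\<bar>) * ennreal (gd \<tau>) \<partial>lborel) \<longlonglongrightarrow> 0"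
      using AE_K_finite
    proof (rule AE_mp, intro AE_I2 impI)
      fix \<tau> assume \<tau>: "\<tau> \<in> space M" and fin: "(\<integral>\<^sup>+ s. ennreal (K s \<tau>) \<partial>lborel) < \<infinity>"
      have "integrable lborel (\<lambda>s. K s \<tau>)"
        using fin \<tau> K_nonneg[OF \<tau>] by (intro integrableI_nonneg) auto
      from ennreal_tendsto_cmult[OF _ L1_translation[OF this h], of "ennreal (gd \<tau>)"]
      show "(\<lambda>n. \<integral>\<^sup>+ s. ennreal (\<bar>K (s + h n) \<tau> - K s \<tau>\<bar>) * ennreal (gd \<tau>) \<partial>lborel) \<longlonglongrightarrow> 0"
        using \<tau> by (simp add: nn_integral_cmult mult.commute)
    qed
  qed measurable
  then show ?thesis by simp
qed

text \<open>The reflection s -> t - s moves the translation from \<open>f\<close> to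
  \<open>K\<close>, so no regularity of \<open>f\<close> is required.\<close>

lemma conv_translate:
  assumes adm: "adm f"
  shows "conv f t \<le> conv f t' + ennreal \<zeta>2 * modulus (t - t')"
proof -
  have [measurable]: "f \<in> borel_measurable borel" using adm by (rule admD)
  have conv_eq: "conv f t = (\<integral>\<^sup>+ \<tau>. (\<integral>\<^sup>+ s. ennreal (K (t - s) \<tau> * g (f s) \<tau>) \<partial>lborel) \<partial>M)" for t
    unfolding conv_def
  proof (rule nn_integral_cong)
    fix \<tau> assume "\<tau> \<in> space M"
    then show "(\<integral>\<^sup>+ s. ennreal (K s \<tau> * g (f (t - s)) \<tau>) \<partial>lborel) = (\<integral>\<^sup>+ s. ennreal (K (t - s) \<tau> * g (f s) \<tau>) \<partial>lborel)"
      using nn_integral_reflect[of "\<lambda>s. ennreal (K (t - s) \<tau> * g (f s) \<tau>)" t] by simp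
  qed
  have "conv f t \<le> (\<integral>\<^sup>+ \<tau>. (\<integral>\<^sup>+ s. ennreal (K (t' - s) \<tau> * g (f s) \<tau>) +
      ennreal \<zeta>2 * (ennreal \<bar>K (t - s) \<tau> - K (t' - s) \<tau>\<bar> * ennreal (gd \<tau>)) \<partial>lborel) \<partial>M)"
    unfolding conv_eq
  proof (intro nn_integral_mono)
    fix \<tau> s assume \<tau>: "\<tau> \<in> space M"
    have "K (t - s) \<tau> * g (f s) \<tau> \<le> (K (t' - s) \<tau> + \<bar>K (t - s) \<tau> - K (t' - s) \<tau>\<bar>) * g (f s) \<tau>"
      using g_nonneg[OF \<tau> admD(2)[OF adm]] by (intro mult_right_mono) auto
    also have "\<dots> = K (t' - s) \<tau> * g (f s) \<tau> + \<bar>K (t - s) \<tau> - K (t' - s) \<tau>\<bar> * g (f s) \<tau>"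
      by (simp add: algebra_simps)
    also have "\<dots> \<le> K (t' - s) \<tau> * g (f s) \<tau> + \<bar>K (t - s) \<tau> - K (t' - s) \<tau>\<bar> * (gd \<tau> * \<zeta>2)"
      using g_sub[OF \<tau> admD(2)[OF adm, of s]] admD(3)[OF adm, of s] gd_pos[OF \<tau>]
      by (intro add_left_mono mult_left_mono) (auto intro: order_trans mult_left_mono)
    finally have "K (t - s) \<tau> * g (f s) \<tau> \<le> K (t' - s) \<tau> * g (f s) \<tau> + \<zeta>2 * (\<bar>K (t - s) \<tau> - K (t' - s) \<tau>\<bar> * gd \<tau>)"
      by (simp add: mult_ac)
    moreover have "0 \<le> K (t' - s) \<tau> * g (f s) \<tau>"
      using K_nonneg[OF \<tau>] g_nonneg[OF \<tau> admD(2)[OF adm]] by simp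
    ultimately show "ennreal (K (t - s) \<tau> * g (f s) \<tau>) \<le> ennreal (K (t' - s) \<tau> * g (f s) \<tau>) +
      ennreal \<zeta>2 * (ennreal \<bar>K (t - s) \<tau> - K (t' - s) \<tau>\<bar> * ennreal (gd \<tau>))"
      using \<zeta>2 gd_pos[OF \<tau>] by (simp add: ennreal_leI less_imp_le flip: ennreal_mult' ennreal_plus)
  qed
  also have "\<dots> = (\<integral>\<^sup>+ \<tau>. (\<integral>\<^sup>+ s. ennreal (K (t' - s) \<tau> * g (f s) \<tau>) \<partial>lborel) + ennreal \<zeta>2 *
      (\<integral>\<^sup>+ s. ennreal \<bar>K (s + (t - t')) \<tau> - K s \<tau>\<bar> * ennreal (gd \<tau>) \<partial>lborel) \<partial>M)"
  proof (rule nn_integral_cong)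
    fix \<tau> assume \<tau>: "\<tau> \<in> space M"
    have "(\<integral>\<^sup>+ s. ennreal \<bar>K (t - s) \<tau> - K (t' - s) \<tau>\<bar> * ennreal (gd \<tau>) \<partial>lborel)
      = (\<integral>\<^sup>+ s. ennreal \<bar>K (s + (t - t')) \<tau> - K s \<tau>\<bar> * ennreal (gd \<tau>) \<partial>lborel)"
      using \<tau> nn_integral_reflect[of "\<lambda>s. ennreal \<bar>K (s + (t - t')) \<tau> - K s \<tau>\<bar> * ennreal (gd \<tau>)" t'] by simp
    then show "(\<integral>\<^sup>+ s. ennreal (K (t' - s) \<tau> * g (f s) \<tau>) +
      ennreal \<zeta>2 * (ennreal \<bar>K (t - s) \<tau> - K (t' - s) \<tau>\<bar> * ennreal (gd \<tau>)) \<partial>lborel) =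
      (\<integral>\<^sup>+ s. ennreal (K (t' - s) \<tau> * g (f s) \<tau>) \<partial>lborel) + ennreal \<zeta>2 *
      (\<integral>\<^sup>+ s. ennreal \<bar>K (s + (t - t')) \<tau> - K s \<tau>\<bar> * ennreal (gd \<tau>) \<partial>lborel)"
      using \<tau> by (subst nn_integral_add) (auto simp: nn_integral_cmult)
  qed
  also have "\<dots> = conv f t' + ennreal \<zeta>2 * modulus (t - t')"
    unfolding conv_eq modulus_def by (simp add: nn_integral_add nn_integral_cmult)
  finally show ?thesis .
qed

lemma A_equicontinuous:
  assumes e: "0 < e"
  shows "\<exists>d>0. \<forall>f x y. adm f \<longrightarrow> \<bar>x - y\<bar> < d \<longrightarrow> \<bar>A f x - A f y\<bar> < e"
proof -
  have "\<exists>d>0. \<forall>h. \<bar>h\<bar> < d \<longrightarrow> ennreal \<zeta>2 * modulus h < ennreal e"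
  proof (rule ccontr)
    assume "\<not> ?thesis"
    then have "\<forall>n. \<exists>h. \<bar>h\<bar> < inverse (real (Suc n)) \<and> ennreal e \<le> ennreal \<zeta>2 * modulus h"
      by (metis inverse_positive_iff_positive linorder_not_le of_nat_0_less_iff zero_less_Suc)
    then obtain h where h: "\<And>n. \<bar>h n\<bar> < inverse (real (Suc n))" "\<And>n. ennreal e \<le> ennreal \<zeta>2 * modulus (h n)"
      by metis
    have "h \<longlonglongrightarrow> 0"
    proof (rule tendsto_rabs_zero_cancel, rule tendsto_sandwich[OF _ _ tendsto_const])
      show "\<forall>\<^sub>F n in sequentially. \<bar>h n\<bar> \<le> inverse (real (Suc n))"
        using h(1) by (intro always_eventually allI less_imp_le)
    qed (use LIMSEQ_inverse_real_of_nat in auto)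
    then have "(\<lambda>n. ennreal \<zeta>2 * modulus (h n)) \<longlonglongrightarrow> ennreal \<zeta>2 * 0"
      by (intro ennreal_tendsto_cmult modulus_tendsto_0) auto
    then have "ennreal e \<le> ennreal \<zeta>2 * 0"
      using h(2) by (intro LIMSEQ_le_const) auto
    then show False using e by simp
  qed
  then obtain d where d: "d > 0" "\<And>h. \<bar>h\<bar> < d \<Longrightarrow> ennreal \<zeta>2 * modulus h < ennreal e" by blast
  have lt: "A f x < A f y + e" if "adm f" "\<bar>x - y\<bar> < d" for f x y
  proof -
    have "ennreal (A f x) \<le> ennreal (A f y) + ennreal \<zeta>2 * modulus (x - y)"
      using conv_translate[OF that(1), of x y] by (simp add: ennreal_A that(1))
    also have "\<dots> < ennreal (A f y) + ennreal e"
      using d(2)[OF that(2)] by (simp add: ennreal_add_left_cancel_less)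
    also have "\<dots> = ennreal (A f y + e)" using e A_nonneg by simp
    finally show ?thesis using A_nonneg by (simp add: ennreal_less_iff)
  qed
  show ?thesis
  proof (intro exI conjI allI impI)
    fix f x y assume "adm f" "\<bar>x - y\<bar> < d"
    then show "\<bar>A f x - A f y\<bar> < e" using lt[of f x y] lt[of f y x] by (simp add: abs_less_iff abs_minus_commute)
  qed (rule d(1))
qed

lemma A_continuous:
  assumes "adm f" shows "continuous_on UNIV (A f)"
  unfolding continuous_on_iff dist_real_def
proof (intro ballI allI impI)
  fix x e :: real assume "0 < e"
  from A_equicontinuous[OF this] obtain d
    where "d > 0" "\<forall>f x y. adm f \<longrightarrow> \<bar>x - y\<bar> < d \<longrightarrow> \<bar>A f x - A f y\<bar> < e" by blast
  then show "\<exists>d>0. \<forall>x'\<in>UNIV. \<bar>x' - x\<bar> < d \<longrightarrow> \<bar>A f x' - A f x\<bar> < e"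
    using assms by (intro exI[of _ d]) auto
qed

lemma A_le: "adm f \<Longrightarrow> A f t \<le> \<zeta>2 * enn2real (chi_int M K gd 0)"
proof -
  assume f: "adm f"
  have "conv f t \<le> (\<integral>\<^sup>+ \<tau>. (\<integral>\<^sup>+ s. ennreal (\<zeta>2 * (K s \<tau> * gd \<tau>)) \<partial>lborel) \<partial>M)"
    unfolding conv_def by (intro nn_integral_mono ennreal_leI g_bound admD[OF f])
  also have "\<dots> = ennreal \<zeta>2 * chi_int M K gd 0" using \<zeta>2 by (simp add: mass_cmult)
  also have "\<dots> = ennreal (\<zeta>2 * enn2real (chi_int M K gd 0))"
    using \<zeta>2 chi_0(1) by (simp add: ennreal_mult')
  finally show ?thesis using \<zeta>2 by (simp add: A_def enn2real_leI)
qed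

text \<open>Equicontinuity holds for \<open>A (f n)\<close>, not for \<open>f n\<close> itself, so
  the subsequence is chosen for the images and transferred through \<open>approx\<close>. The same
  statement covers the grid limit (with \<open>e\<close> the source), the limit of vanishing source
  and limits of translates (both with e = 0).\<close>

lemma compactness:
  assumes adm: "\<And>n. adm (f n)" and e: "continuous_on UNIV e"
    and approx: "\<And>t. (\<lambda>n. f n t - A (f n) t) \<longlonglongrightarrow> e t"
  obtains k \<phi> where "strict_mono (k :: nat \<Rightarrow> nat)" "\<And>t. (\<lambda>n. f (k n) t) \<longlonglongrightarrow> \<phi> t"
    "adm \<phi>" "\<And>t. \<phi> t = A \<phi> t + e t" "continuous_on UNIV \<phi>"
proof -
  have equi: "\<exists>d>0. \<forall>n x y. \<bar>x - y\<bar> < d \<longrightarrow> \<bar>A (f n) x - A (f n) y\<bar> < e" if "0 < e" for e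
    using A_equicontinuous[OF that] adm by blast
  have bd: "\<bar>A (f n) x\<bar> \<le> \<zeta>2 * enn2real (chi_int M K gd 0)" for n x
    using A_le[OF adm] A_nonneg by simp
  have "\<exists>k \<psi>. strict_mono (k :: nat \<Rightarrow> nat) \<and> (\<forall>t. (\<lambda>n. A (f (k n)) t) \<longlonglongrightarrow> \<psi> t)"
    by (rule equicontinuous_convergent_subsequence[OF bd equi]) (assumption, blast)
  then obtain k \<psi> where k: "strict_mono (k :: nat \<Rightarrow> nat)" and \<psi>: "\<And>t. (\<lambda>n. A (f (k n)) t) \<longlonglongrightarrow> \<psi> t"
    by blast
  define \<phi> where "\<phi> t = \<psi> t + e t" for t
  have \<phi>: "(\<lambda>n. f (k n) t) \<longlonglongrightarrow> \<phi> t" for t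
    using tendsto_add[OF \<psi>[of t] LIMSEQ_subseq_LIMSEQ[OF approx[of t] k]] by (simp add: \<phi>_def o_def)
  have [measurable]: "f n \<in> borel_measurable borel" for n using adm by (rule admD)
  have "\<phi> \<in> borel_measurable borel"
    by (rule borel_measurable_LIMSEQ_real[OF \<phi>]) measurable
  moreover have "0 \<le> \<phi> t" for t using \<phi>[of t] admD(2)[OF adm] by (intro LIMSEQ_le_const) auto
  moreover have "\<phi> t \<le> \<zeta>2" for t using \<phi>[of t] admD(3)[OF adm] by (intro LIMSEQ_le_const2) auto
  ultimately have adm_\<phi>: "adm \<phi>" by (simp add: adm_def)
  have "(\<lambda>n. A (f (k n)) t) \<longlonglongrightarrow> A \<phi> t" for t
    using conv_tendsto[OF adm \<phi>, of t] conv_finite[OF adm_\<phi>, of t] unfolding A_def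
    by (intro tendsto_enn2real) auto
  then have "\<psi> t = A \<phi> t" for t using \<psi> LIMSEQ_unique by blast
  then have eq: "\<phi> t = A \<phi> t + e t" for t by (simp add: \<phi>_def)
  have "continuous_on UNIV (\<lambda>t. A \<phi> t + e t)"
    using A_continuous[OF adm_\<phi>] e by (intro continuous_on_add)
  moreover have "(\<lambda>t. A \<phi> t + e t) = \<phi>" by (rule ext) (rule eq[symmetric])
  ultimately have "continuous_on UNIV \<phi>" by (rule back_subst[of "continuous_on UNIV"])
  then show thesis using that k \<phi> adm_\<phi> eq by blast
qed

subsection \<open>The map G\<close>

text \<open>A point of positive mass lies in no null set; this makes \<open>K\<close> integrable in
  \<open>s\<close> at \<open>\<tau>0\<close>.\<close>

lemma AE_at_\<tau>0: "AE \<tau> in M. P \<tau> \<Longrightarrow> P \<tau>0"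
proof (rule ccontr)
  assume "AE \<tau> in M. P \<tau>" "\<not> P \<tau>0"
  then obtain N where "{\<tau> \<in> space M. \<not> P \<tau>} \<subseteq> N" "emeasure M N = 0" "N \<in> sets M" by (auto elim: AE_E)
  then have "emeasure M {\<tau>0} \<le> emeasure M N" using \<open>\<not> P \<tau>0\<close> \<tau>0 by (intro emeasure_mono) auto
  then show False using \<tau>0_mass \<open>emeasure M N = 0\<close> by simp
qed

abbreviation "C \<equiv> Cconst K \<tau>0"

lemma ennreal_C: "(\<integral>\<^sup>+ s. ennreal (K s \<tau>0) \<partial>lborel) = ennreal C"
proof -
  have "integrable lborel (\<lambda>s. K s \<tau>0)"
    using AE_at_\<tau>0[OF AE_K_finite] K_nonneg \<tau>0 by (intro integrableI_nonneg) auto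
  then show ?thesis
    unfolding Cconst_def using K_nonneg \<tau>0 by (intro nn_integral_eq_integral) auto
qed

lemma C_pos: "0 < C"
  using K_pos[OF \<tau>0(1)] ennreal_C by simp

lemma nn_integral_split_\<tau>0:
  assumes [measurable]: "F \<in> borel_measurable M"
  shows "(\<integral>\<^sup>+ \<tau>. F \<tau> \<partial>M) = F \<tau>0 + (\<integral>\<^sup>+ \<tau> \<in> space M - {\<tau>0}. F \<tau> \<partial>M)"
proof -
  have "(\<integral>\<^sup>+ \<tau>. F \<tau> \<partial>M) = (\<integral>\<^sup>+ \<tau>. F \<tau> * indicator {\<tau>0} \<tau> + F \<tau> * indicator (space M - {\<tau>0}) \<tau> \<partial>M)"
    by (intro nn_integral_cong) (auto simp: indicator_def)
  also have "\<dots> = (\<integral>\<^sup>+ \<tau> \<in> {\<tau>0}. F \<tau> \<partial>M) + (\<integral>\<^sup>+ \<tau> \<in> space M - {\<tau>0}. F \<tau> \<partial>M)"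
    using \<tau>0 by (intro nn_integral_add) auto
  finally show ?thesis
    using nn_integral_indicator_singleton[of \<tau>0 M F] \<tau>0 \<tau>0_mass by simp
qed

text \<open>At the atom \<open>g\<close> need not be monotone, so bounds \<open>lo\<close> and
  \<open>hi\<close> for its values are supplied; at every other \<tau> monotonicity turns bounds on
  \<open>f\<close> into \<open>tilde_g\<close>.\<close>

lemma conv_bounds:
  assumes adm: "adm f" and f: "\<And>s. u \<le> f s" "\<And>s. f s \<le> v" and u: "0 \<le> u"
    and g0: "\<And>s. lo \<le> g (f s) \<tau>0" "\<And>s. g (f s) \<tau>0 \<le> hi" "0 \<le> lo"
  shows "ennreal (C * lo) + tilde_g M K g \<tau>0 u \<le> conv f t"
    and "conv f t \<le> ennreal (C * hi) + tilde_g M K g \<tau>0 v"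
proof -
  have [measurable]: "f \<in> borel_measurable borel" using adm by (rule admD)
  have v: "0 \<le> v" using u f[of 0] by simp
  have hi: "0 \<le> hi" using g0(1,2)[of 0] g0(3) by simp
  have const: "(\<integral>\<^sup>+ s. ennreal (K s \<tau> * c) \<partial>lborel) = ennreal c * (\<integral>\<^sup>+ s. ennreal (K s \<tau>) \<partial>lborel)"
    if "0 \<le> c" "\<tau> \<in> space M" for c \<tau>
    using that by (simp add: ennreal_mult'' nn_integral_multc) (simp add: mult.commute)
  have split: "conv f t = (\<integral>\<^sup>+ s. ennreal (K s \<tau>0 * g (f (t - s)) \<tau>0) \<partial>lborel) +
      (\<integral>\<^sup>+ \<tau> \<in> space M - {\<tau>0}. (\<integral>\<^sup>+ s. ennreal (K s \<tau> * g (f (t - s)) \<tau>) \<partial>lborel) \<partial>M)"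
    unfolding conv_def by (rule nn_integral_split_\<tau>0) measurable
  have "ennreal (C * lo) = (\<integral>\<^sup>+ s. ennreal (K s \<tau>0 * lo) \<partial>lborel)"
    using const[OF g0(3) \<tau>0(1)] g0(3) C_pos by (simp add: ennreal_C ennreal_mult' mult.commute)
  also have "\<dots> \<le> (\<integral>\<^sup>+ s. ennreal (K s \<tau>0 * g (f (t - s)) \<tau>0) \<partial>lborel)"
    using g0 \<tau>0 K_nonneg by (intro nn_integral_mono ennreal_leI mult_left_mono) auto
  finally have 1: "ennreal (C * lo) \<le> (\<integral>\<^sup>+ s. ennreal (K s \<tau>0 * g (f (t - s)) \<tau>0) \<partial>lborel)" .
  have "(\<integral>\<^sup>+ s. ennreal (K s \<tau>0 * g (f (t - s)) \<tau>0) \<partial>lborel) \<le> (\<integral>\<^sup>+ s. ennreal (K s \<tau>0 * hi) \<partial>lborel)"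
    using g0 \<tau>0 K_nonneg by (intro nn_integral_mono ennreal_leI mult_left_mono) auto
  also have "\<dots> = ennreal (C * hi)"
    using const[OF hi \<tau>0(1)] hi C_pos by (simp add: ennreal_C ennreal_mult' mult.commute)
  finally have 2: "(\<integral>\<^sup>+ s. ennreal (K s \<tau>0 * g (f (t - s)) \<tau>0) \<partial>lborel) \<le> ennreal (C * hi)" .
  have 3: "tilde_g M K g \<tau>0 u \<le> (\<integral>\<^sup>+ \<tau> \<in> space M - {\<tau>0}. (\<integral>\<^sup>+ s. ennreal (K s \<tau> * g (f (t - s)) \<tau>) \<partial>lborel) \<partial>M)"
    unfolding tilde_g_def
  proof (rule nn_integral_mono)
    fix \<tau> assume \<tau>: "\<tau> \<in> space M"
    show "ennreal (g u \<tau>) * (\<integral>\<^sup>+ s. ennreal (K s \<tau>) \<partial>lborel) * indicator (space M - {\<tau>0}) \<tau>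
      \<le> (\<integral>\<^sup>+ s. ennreal (K s \<tau> * g (f (t - s)) \<tau>) \<partial>lborel) * indicator (space M - {\<tau>0}) \<tau>"
    proof (cases "\<tau> = \<tau>0")
      case False
      then have "ennreal (g u \<tau>) * (\<integral>\<^sup>+ s. ennreal (K s \<tau>) \<partial>lborel) \<le> (\<integral>\<^sup>+ s. ennreal (K s \<tau> * g (f (t - s)) \<tau>) \<partial>lborel)"
        unfolding const[OF g_nonneg[OF \<tau> u] \<tau>, symmetric]
        using \<tau> u f K_nonneg by (intro nn_integral_mono ennreal_leI mult_left_mono g_mono) auto
      then show ?thesis by (rule mult_right_mono) simp
    qed simp
  qed
  have 4: "(\<integral>\<^sup>+ \<tau> \<in> space M - {\<tau>0}. (\<integral>\<^sup>+ s. ennreal (K s \<tau> * g (f (t - s)) \<tau>) \<partial>lborel) \<partial>M) \<le> tilde_g M K g \<tau>0 v"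
    unfolding tilde_g_def
  proof (rule nn_integral_mono)
    fix \<tau> assume \<tau>: "\<tau> \<in> space M"
    show "(\<integral>\<^sup>+ s. ennreal (K s \<tau> * g (f (t - s)) \<tau>) \<partial>lborel) * indicator (space M - {\<tau>0}) \<tau>
      \<le> ennreal (g v \<tau>) * (\<integral>\<^sup>+ s. ennreal (K s \<tau>) \<partial>lborel) * indicator (space M - {\<tau>0}) \<tau>"
    proof (cases "\<tau> = \<tau>0")
      case False
      then have "(\<integral>\<^sup>+ s. ennreal (K s \<tau> * g (f (t - s)) \<tau>) \<partial>lborel) \<le> ennreal (g v \<tau>) * (\<integral>\<^sup>+ s. ennreal (K s \<tau>) \<partial>lborel)"
        unfolding const[OF g_nonneg[OF \<tau> v] \<tau>, symmetric]
        using \<tau> admD(2)[OF adm] f K_nonneg by (intro nn_integral_mono ennreal_leI mult_left_mono g_mono) auto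
      then show ?thesis by (rule mult_right_mono) simp
    qed simp
  qed
  show "ennreal (C * lo) + tilde_g M K g \<tau>0 u \<le> conv f t"
    unfolding split using 1 3 by (rule add_mono)
  show "conv f t \<le> ennreal (C * hi) + tilde_g M K g \<tau>0 v"
    unfolding split using 2 4 by (rule add_mono)
qed

definition tg :: "real \<Rightarrow> real" where "tg v = enn2real (tilde_g M K g \<tau>0 v)"

abbreviation "\<Theta> \<equiv> Theta M K g \<tau>0"
abbreviation "G \<equiv> Gmap M K g \<tau>0 \<zeta>2"

lemma Theta_eq: "\<Theta> v = v - tg v"
  by (simp add: Theta_def tg_def)

lemma ennreal_tg: "v \<in> {0..\<zeta>2} \<Longrightarrow> tilde_g M K g \<tau>0 v = ennreal (tg v)"
  using tilde_g_finite[of v] by (simp add: tg_def less_top)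

lemma tg_nonneg: "0 \<le> tg v" by (simp add: tg_def)

lemma adm_const: "v \<in> {0..\<zeta>2} \<Longrightarrow> adm (\<lambda>_. v)" by (simp add: adm_def)

lemma A_bounds:
  assumes adm: "adm f" and f: "\<And>s. u \<le> f s" "\<And>s. f s \<le> v" and u: "0 \<le> u" "v \<le> \<zeta>2"
    and g0: "\<And>s. lo \<le> g (f s) \<tau>0" "\<And>s. g (f s) \<tau>0 \<le> hi" "0 \<le> lo"
  shows "C * lo + tg u \<le> A f t" "A f t \<le> C * hi + tg v"
proof -
  have "u \<in> {0..\<zeta>2}" "v \<in> {0..\<zeta>2}" using f[of 0] u by auto
  moreover have "0 \<le> C * lo" "0 \<le> C * hi" using g0(1,2)[of 0] g0(3) C_pos by auto
  ultimately show "C * lo + tg u \<le> A f t" "A f t \<le> C * hi + tg v"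
    using conv_bounds[OF adm f u(1) g0, of t] A_nonneg[of f t]
    by (auto simp: ennreal_A[OF adm, symmetric] ennreal_tg tg_nonneg simp flip: ennreal_plus)
qed

lemma A_const:
  assumes v: "v \<in> {0..\<zeta>2}" shows "A (\<lambda>_. v) t = C * g v \<tau>0 + tg v"
  using A_bounds[OF adm_const[OF v], of v v "g v \<tau>0" "g v \<tau>0" t] v g_nonneg[OF \<tau>0(1)] by simp

lemma g0_continuous: "continuous_on {0..} (\<lambda>v. g v \<tau>0)"
  by (rule g_cont[OF \<tau>0(1)])

text \<open>On constants \<open>A\<close> equals \<open>C * g v \<tau>0 + tg v\<close>, so the
  continuity follows from that of \<open>A\<close> and of \<open>g\<close> at the atom.\<close>

lemma tg_continuous: "continuous_on {0..\<zeta>2} tg"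
proof -
  have "continuous_on {0..\<zeta>2} (\<lambda>v. A (\<lambda>_. v) 0)"
    unfolding continuous_on_sequentially
  proof (intro allI ballI impI)
    fix v and x :: "nat \<Rightarrow> real" assume v: "v \<in> {0..\<zeta>2}" and x: "(\<forall>n. x n \<in> {0..\<zeta>2}) \<and> x \<longlonglongrightarrow> v"
    then have "(\<lambda>n. conv (\<lambda>_. x n) 0) \<longlonglongrightarrow> conv (\<lambda>_. v) 0"
      by (intro conv_tendsto adm_const) auto
    then show "((\<lambda>v. A (\<lambda>_. v) 0) \<circ> x) \<longlonglongrightarrow> A (\<lambda>_. v) 0"
      using conv_finite[OF adm_const[OF v], of 0] unfolding A_def o_def by (intro tendsto_enn2real) auto
  qed
  then have "continuous_on {0..\<zeta>2} (\<lambda>v. A (\<lambda>_. v) 0 - C * g v \<tau>0)"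
    by (intro continuous_intros continuous_on_subset[OF g0_continuous]) auto
  then show ?thesis
    by (rule continuous_on_eq) (simp add: A_const)
qed

lemma Theta_continuous: "continuous_on {0..\<zeta>2} \<Theta>"
  unfolding Theta_eq[abs_def] by (intro continuous_intros tg_continuous)

lemma Theta_0: "\<Theta> 0 = 0"
proof -
  have "A (\<lambda>_. 0) 0 = 0"
  proof -
    have "conv (\<lambda>_. 0) 0 = (\<integral>\<^sup>+ \<tau>. 0 \<partial>M)"
      unfolding conv_def by (intro nn_integral_cong) (simp add: g_zero)
    then show ?thesis by (simp add: A_def)
  qed
  then show ?thesis using A_const[of 0 0] \<zeta>2 g_zero[OF \<tau>0(1)] by (simp add: Theta_eq)
qed

lemma g0_range:
  assumes "0 \<le> v" shows "C * g v \<tau>0 \<in> {0..<\<Theta> \<zeta>2}"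
proof -
  obtain v0 where "g v \<tau>0 \<le> g v0 \<tau>0" "C * g v0 \<tau>0 < \<Theta> \<zeta>2" using g0_max assms by blast
  then show ?thesis
    using C_pos g_nonneg[OF \<tau>0(1) assms] by (auto intro: order_le_less_trans[OF mult_left_mono])
qed

text \<open>By (N2) the value \<open>C * g v \<tau>0\<close> lies between \<Theta>(0) = 0 and
  \<Theta>(\<zeta>2), hence in the range of \<Theta>; only there is \<open>the_inv_into\<close> a
  true inverse.\<close>

lemma Theta_G:
  assumes "0 \<le> v" shows "\<Theta> (G v) = C * g v \<tau>0" "G v \<in> {0..\<zeta>2}"
proof -
  have inj: "inj_on \<Theta> {0..\<zeta>2}" using Theta_mono by (rule strict_mono_on_imp_inj_on)
  have "\<exists>x. 0 \<le> x \<and> x \<le> \<zeta>2 \<and> \<Theta> x = C * g v \<tau>0"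
    using g0_range[OF assms] Theta_0 \<zeta>2 Theta_continuous by (intro IVT') auto
  then have mem: "C * g v \<tau>0 \<in> \<Theta> ` {0..\<zeta>2}" by force
  show "\<Theta> (G v) = C * g v \<tau>0"
    unfolding Gmap_def by (rule f_the_inv_into_f[OF inj mem])
  show "G v \<in> {0..\<zeta>2}"
    unfolding Gmap_def by (rule the_inv_into_into[OF inj mem]) simp
qed

lemma Theta_le_iff: "u \<in> {0..\<zeta>2} \<Longrightarrow> v \<in> {0..\<zeta>2} \<Longrightarrow> \<Theta> u \<le> \<Theta> v \<longleftrightarrow> u \<le> v"
  using strict_mono_on_less_eq[OF Theta_mono] by blast

lemma G_pos:
  assumes "0 < v" shows "0 < G v"
proof (rule ccontr)
  assume "\<not> 0 < G v"
  then have "G v = 0" using Theta_G(2)[of v] assms by auto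
  then show False using Theta_G(1)[of v] Theta_0 assms C_pos g0_pos[OF assms] by simp
qed

lemma G_continuous: "continuous_on {0..} G"
proof -
  have "continuous_on (\<Theta> ` {0..\<zeta>2}) (the_inv_into {0..\<zeta>2} \<Theta>)"
    using Theta_continuous strict_mono_on_imp_inj_on[OF Theta_mono]
    by (intro continuous_on_inv) (auto simp: the_inv_into_f_f)
  moreover have "continuous_on {0..} (\<lambda>v. C * g v \<tau>0)"
    by (intro continuous_intros g0_continuous)
  moreover have "(\<lambda>v. C * g v \<tau>0) ` {0..} \<subseteq> \<Theta> ` {0..\<zeta>2}"
  proof (rule image_subsetI)
    fix v :: real assume "v \<in> {0..}"
    then show "C * g v \<tau>0 \<in> \<Theta> ` {0..\<zeta>2}"
      using Theta_G[of v] by (intro image_eqI[of _ _ "G v"]) auto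
  qed
  ultimately show ?thesis
    unfolding Gmap_def[abs_def] by (rule continuous_on_compose2)
qed

text \<open>The bridge from the equation to the map \<open>G\<close>. For a minimum, let
  \<open>p\<close> minimise \<open>g\<close> at the atom over [u, v]; then
  \<open>u = A f 0 \<ge> C * g p \<tau>0 + tg u\<close>, that is \<Theta>(G p) <= \<Theta>(u), and
  \<Theta> is increasing. The maximum is symmetric.\<close>

lemma solution_extremal:
  assumes adm: "adm f" and sol: "f 0 = A f 0" and f: "\<And>s. u \<le> f s" "\<And>s. f s \<le> v" and uv: "0 \<le> u" "v \<le> \<zeta>2"
  shows "f 0 = u \<Longrightarrow> \<exists>p\<in>{u..v}. G p \<le> u" and "f 0 = v \<Longrightarrow> \<exists>p\<in>{u..v}. v \<le> G p"
proof -
  have ne: "{u..v} \<noteq> {}" using f[of 0] by auto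
  have cont: "continuous_on {u..v} (\<lambda>v. g v \<tau>0)" using uv by (intro continuous_on_subset[OF g0_continuous]) auto
  obtain p where p: "p \<in> {u..v}" "\<And>w. w \<in> {u..v} \<Longrightarrow> g p \<tau>0 \<le> g w \<tau>0"
    using continuous_attains_inf[OF compact_Icc ne cont] by blast
  obtain p' where p': "p' \<in> {u..v}" "\<And>w. w \<in> {u..v} \<Longrightarrow> g w \<tau>0 \<le> g p' \<tau>0"
    using continuous_attains_sup[OF compact_Icc ne cont] by blast
  have "0 \<le> g p \<tau>0" using p(1) uv by (intro g_nonneg \<tau>0) auto
  note bounds = A_bounds[OF adm f uv p(2) p'(2) this, of 0]
  { assume "f 0 = u"
    then have "\<Theta> (G p) \<le> \<Theta> u"
      using bounds(1) sol f p(1) uv by (simp add: Theta_G(1) Theta_eq[of u])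
    then have "G p \<le> u" using Theta_le_iff[of "G p" u] Theta_G(2)[of p] p(1) uv by auto
    then show "\<exists>p\<in>{u..v}. G p \<le> u" using p(1) by blast }
  { assume "f 0 = v"
    then have "\<Theta> v \<le> \<Theta> (G p')"
      using bounds(2) sol f p'(1) uv by (simp add: Theta_G(1) Theta_eq[of v])
    then have "v \<le> G p'" using Theta_le_iff[of v "G p'"] Theta_G(2)[of p'] p'(1) uv by auto
    then show "\<exists>p\<in>{u..v}. v \<le> G p" using p'(1) by blast }
qed

subsection \<open>Positivity of nonzero solutions\<close>

interpretation P: pair_sigma_finite lborel M by unfold_locales

lemma gd_bound_conv:
  assumes "adm f"
  shows "conv f t \<le> (\<integral>\<^sup>+ \<tau>. (\<integral>\<^sup>+ s. ennreal (K s \<tau> * gd \<tau>) * ennreal (f (t - s)) \<partial>lborel) \<partial>M)"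
  unfolding conv_def
proof (intro nn_integral_mono)
  fix \<tau> s assume \<tau>: "\<tau> \<in> space M"
  show "ennreal (K s \<tau> * g (f (t - s)) \<tau>) \<le> ennreal (K s \<tau> * gd \<tau>) * ennreal (f (t - s))"
    using ennreal_leI[OF g_bound[OF \<tau> admD(2)[OF assms] order_refl, of s "t - s"]] admD(2)[OF assms, of "t - s"]
    by (simp add: ennreal_mult' mult.commute[of "ennreal (f (t - s))"])
qed

definition \<beta> :: real where "\<beta> = enn2real (chi_int M K gd b)"

lemma \<beta>: "0 \<le> \<beta>" "\<beta> < 1" "chi_int M K gd b = ennreal \<beta>"
proof -
  have "chi_int M K gd b < \<infinity>" using b(2) by (simp add: less_top order_less_trans)
  then show *: "chi_int M K gd b = ennreal \<beta>" by (simp add: \<beta>_def)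
  show "0 \<le> \<beta>" by (simp add: \<beta>_def)
  then show "\<beta> < 1" using b(2) unfolding * by simp
qed

text \<open>Exponentials are eigenfunctions of the linearised convolution, and \<beta> = 1 -
  \<chi>(b) is the eigenvalue of \<open>exp (b * t)\<close>.\<close>

lemma A_exp_bound:
  assumes adm: "adm f" and f: "\<And>t. f t \<le> q * exp (b * t)" and q: "0 \<le> q"
  shows "A f t \<le> q * \<beta> * exp (b * t)"
proof -
  have "conv f t \<le> (\<integral>\<^sup>+ \<tau>. (\<integral>\<^sup>+ s. ennreal (K s \<tau> * gd \<tau>) * ennreal (f (t - s)) \<partial>lborel) \<partial>M)"
    by (rule gd_bound_conv[OF adm])
  also have "\<dots> \<le> (\<integral>\<^sup>+ \<tau>. (\<integral>\<^sup>+ s. ennreal (q * exp (b * t)) * ennreal (K s \<tau> * gd \<tau> * exp (- s * b)) \<partial>lborel) \<partial>M)"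
  proof (intro nn_integral_mono)
    fix \<tau> s assume \<tau>: "\<tau> \<in> space M"
    have K: "0 \<le> K s \<tau> * gd \<tau>" using K_nonneg[OF \<tau>] gd_pos[OF \<tau>] by simp
    have "K s \<tau> * gd \<tau> * f (t - s) \<le> K s \<tau> * gd \<tau> * (q * exp (b * (t - s)))"
      by (rule mult_left_mono[OF f K])
    also have "exp (b * (t - s)) = exp (b * t) * exp (- s * b)"
      by (simp add: algebra_simps flip: exp_add)
    finally have "K s \<tau> * gd \<tau> * f (t - s) \<le> (q * exp (b * t)) * (K s \<tau> * gd \<tau> * exp (- s * b))"
      by (simp add: mult_ac)
    then have "ennreal (K s \<tau> * gd \<tau> * f (t - s)) \<le> ennreal ((q * exp (b * t)) * (K s \<tau> * gd \<tau> * exp (- s * b)))"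
      by (rule ennreal_leI)
    then show "ennreal (K s \<tau> * gd \<tau>) * ennreal (f (t - s)) \<le> ennreal (q * exp (b * t)) * ennreal (K s \<tau> * gd \<tau> * exp (- s * b))"
      using K q by (simp only: ennreal_mult' mult_nonneg_nonneg exp_ge_zero)
  qed
  also have "\<dots> = (\<integral>\<^sup>+ \<tau>. ennreal (q * exp (b * t)) * (\<integral>\<^sup>+ s. ennreal (K s \<tau> * gd \<tau> * exp (- s * b)) \<partial>lborel) \<partial>M)"
    by (intro nn_integral_cong nn_integral_cmult) measurable
  also have "\<dots> = ennreal (q * exp (b * t)) * chi_int M K gd b"
    unfolding chi_int_def by (intro nn_integral_cmult) measurable
  also have "\<dots> = ennreal (q * \<beta> * exp (b * t))"
    using q \<beta>(1) by (simp add: \<beta>(3) mult_ac flip: ennreal_mult')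
  finally show ?thesis using q \<beta>(1) by (simp add: A_def enn2real_leI)
qed

text \<open>A bounded function vanishing on a left half-line is dominated by a multiple of \<open>e\<^sup>b\<^sup>t\<close>, and \<open>A\<close>
  contracts such bounds by the factor \<open>\<beta> < 1\<close>.\<close>

lemma zero_if_zero_left:
  assumes adm: "adm f" and sol: "\<And>t. f t = A f t" and left: "\<And>t. t < T \<Longrightarrow> f t = 0"
  shows "f t = 0"
proof -
  \<comment> \<open>With this constant \<open>B * exp (b * t)\<close> equals \<zeta>2 at
    \<open>T\<close>, hence dominates \<open>f\<close> from \<open>T\<close> on.\<close>
  define B where "B = \<zeta>2 * exp (- b * T)"
  have B: "0 \<le> B" using \<zeta>2 by (simp add: B_def)
  have bound: "\<forall>t. f t \<le> B * \<beta> ^ n * exp (b * t)" for n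
  proof (induction n)
    case 0
    show ?case
    proof
      fix t
      show "f t \<le> B * \<beta> ^ 0 * exp (b * t)"
      proof (cases "t < T")
        case False
        then have "1 \<le> exp (b * (t - T))" using b(1) by simp
        then have "\<zeta>2 \<le> \<zeta>2 * exp (b * (t - T))" using \<zeta>2 by simp
        also have "\<dots> = B * exp (b * t)" by (simp add: B_def algebra_simps flip: exp_add)
        finally show ?thesis using admD(3)[OF adm, of t] by simp
      qed (use left B in simp)
    qed
  next
    case (Suc n)
    show ?case
    proof
      fix t
      have "A f t \<le> B * \<beta> ^ n * \<beta> * exp (b * t)"
        using Suc.IH B \<beta>(1) by (intro A_exp_bound adm) auto
      then show "f t \<le> B * \<beta> ^ Suc n * exp (b * t)" using sol[of t] by (simp add: mult_ac)
    qed
  qed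
  have "(\<lambda>n. B * \<beta> ^ n * exp (b * t)) \<longlonglongrightarrow> B * 0 * exp (b * t)"
    using \<beta> by (intro tendsto_intros LIMSEQ_power_zero) auto
  then have "f t \<le> B * 0 * exp (b * t)" by (rule LIMSEQ_le_const) (use bound in blast)
  then show ?thesis using admD(2)[OF adm, of t] by simp
qed

text \<open>The kernel of the linearisation in the variable \<open>s\<close> alone; its two-sided
  Laplace transform is 1 - \<chi>.\<close>

definition kern :: "real \<Rightarrow> ennreal" where
  "kern s = (\<integral>\<^sup>+ \<tau>. ennreal (K s \<tau> * gd \<tau>) \<partial>M)"

lemma kern_measurable[measurable]: "kern \<in> borel_measurable borel"
  unfolding kern_def by measurable

lemma chi_int_kern: "chi_int M K gd z = (\<integral>\<^sup>+ s. kern s * ennreal (exp (- s * z)) \<partial>lborel)"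
proof -
  have "chi_int M K gd z = (\<integral>\<^sup>+ s. (\<integral>\<^sup>+ \<tau>. ennreal (K s \<tau> * gd \<tau> * exp (- s * z)) \<partial>M) \<partial>lborel)"
    unfolding chi_int_def by (rule P.Fubini') measurable
  also have "\<dots> = (\<integral>\<^sup>+ s. kern s * ennreal (exp (- s * z)) \<partial>lborel)"
    unfolding kern_def
    by (intro nn_integral_cong) (simp add: ennreal_mult'' nn_integral_multc)
  finally show ?thesis .
qed

text \<open>If \<open>kern\<close> vanished almost everywhere on the positive axis, then
  \<open>exp (- s * b)\<close> would be at least 1 on the rest, giving
  \<open>chi_int M K gd 0 \<le> chi_int M K gd b\<close>, contrary to the values on the two sides of
  1. The cut at \<open>n\<close> makes the measure finite.\<close>

lemma kern_positive_part:
  obtains D where "D \<in> sets borel" "D \<subseteq> {0<..}" "0 < emeasure lborel D" "emeasure lborel D < \<infinity>"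
    "\<forall>s\<in>D. 0 < kern s"
proof -
  define D where "D n = {s \<in> {0<..real n}. 0 < kern s}" for n :: nat
  have D_meas[measurable]: "D n \<in> sets borel" for n unfolding D_def by measurable
  have "\<exists>n. 0 < emeasure lborel (D n)"
  proof (rule ccontr)
    assume "\<not> ?thesis"
    then have "D n \<in> null_sets lborel" for n by (simp add: null_sets_def)
    then have "(\<Union>n. D n) \<in> null_sets lborel" by (rule null_sets_UN)
    then have AE: "AE s in lborel. s \<notin> (\<Union>n. D n)" by (rule AE_not_in)
    have "chi_int M K gd 0 = (\<integral>\<^sup>+ s. kern s \<partial>lborel)" by (simp add: chi_int_kern)
    also have "\<dots> \<le> (\<integral>\<^sup>+ s. kern s * ennreal (exp (- s * b)) \<partial>lborel)"
    proof (rule nn_integral_mono_AE, use AE in eventually_elim)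
      fix s assume s: "s \<notin> (\<Union>n. D n)"
      show "kern s \<le> kern s * ennreal (exp (- s * b))"
      proof (cases "0 < s")
        case True
        obtain n where "s \<le> real n" using real_arch_simple by blast
        then have "kern s = 0" using s True by (auto simp: D_def)
        then show ?thesis by simp
      next
        case False
        then have "0 \<le> - s * b" using b(1) by (intro mult_nonneg_nonneg) auto
        then have "ennreal 1 \<le> ennreal (exp (- s * b))" by (intro ennreal_leI) simp
        from mult_left_mono[OF this, of "kern s"] show ?thesis by simp
      qed
    qed
    also have "\<dots> = chi_int M K gd b" by (simp add: chi_int_kern)
    finally show False using b(2) chi_0(2) by simp
  qed
  then obtain n where n: "0 < emeasure lborel (D n)" by blast
  have "emeasure lborel (D n) \<le> emeasure lborel {0<..real n}"
    by (intro emeasure_mono) (auto simp: D_def)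
  also have "\<dots> < \<infinity>" by simp
  finally show thesis using n D_meas[of n] by (intro that[of "D n"]) (auto simp: D_def)
qed

text \<open>A vanishing integral of a nonnegative function has an integrand that is 0 almost
  everywhere, and \<open>g\<close> is positive at positive arguments; so \<open>f (t - s)\<close> is
  0 wherever the kernel charges \<open>s\<close>.\<close>

lemma zero_spreads:
  assumes adm: "adm f" and sol: "\<And>t. f t = A f t" and zero: "f t = 0"
  shows "AE s in lborel. 0 < kern s \<longrightarrow> f (t - s) = 0"
proof -
  have [measurable]: "f \<in> borel_measurable borel" using adm by (rule admD)
  have "(\<integral>\<^sup>+ s. (\<integral>\<^sup>+ \<tau>. ennreal (K s \<tau> * g (f (t - s)) \<tau>) \<partial>M) \<partial>lborel) = conv f t"
    unfolding conv_def by (rule P.Fubini'[symmetric]) measurable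
  also have "\<dots> = 0" using sol[of t] zero ennreal_A[OF adm, of t] by simp
  finally have "AE s in lborel. (\<integral>\<^sup>+ \<tau>. ennreal (K s \<tau> * g (f (t - s)) \<tau>) \<partial>M) = 0"
    by (subst (asm) nn_integral_0_iff_AE) measurable
  then show ?thesis
  proof eventually_elim
    case (elim s)
    show ?case
    proof (intro impI, rule ccontr)
      assume kern: "0 < kern s" and "f (t - s) \<noteq> 0"
      then have pos: "0 < f (t - s)" using admD(2)[OF adm, of "t - s"] by simp
      have "AE \<tau> in M. ennreal (K s \<tau> * g (f (t - s)) \<tau>) = 0"
        using elim by (subst (asm) nn_integral_0_iff_AE) measurable
      then have "AE \<tau> in M. ennreal (K s \<tau> * gd \<tau>) = 0"
      proof (rule AE_mp, intro AE_I2 impI)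
        fix \<tau> assume \<tau>: "\<tau> \<in> space M" "ennreal (K s \<tau> * g (f (t - s)) \<tau>) = 0"
        then have "K s \<tau> = 0"
          using g_pos[OF \<tau>(1) pos] K_nonneg[OF \<tau>(1), of s] by (auto simp: mult_le_0_iff ennreal_eq_0_iff)
        then show "ennreal (K s \<tau> * gd \<tau>) = 0" by simp
      qed
      then have "kern s = 0"
        unfolding kern_def by (subst nn_integral_0_iff_AE) measurable
      then show False using kern by simp
    qed
  qed
qed

text \<open>If \<open>D\<close> has positive measure, then \<open>D + D\<close> contains an interval (Steinhaus). With \<open>D\<close> the part of the
  support of the kernel in \<open>(0, \<infinity>)\<close>, the zero set of a solution is closed under subtracting
  elements of that interval, hence contains a left half-line.\<close>

lemma solution_zero:
  assumes adm: "adm f" and cont: "continuous_on UNIV f" and sol: "\<And>t. f t = A f t" and t1: "f t1 = 0"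
  shows "f t = 0"
proof -
  have [measurable]: "f \<in> borel_measurable borel" using adm by (rule admD)
  obtain D where D[measurable]: "D \<in> sets borel" and D_pos: "D \<subseteq> {0<..}" "0 < emeasure lborel D" "emeasure lborel D < \<infinity>"
    and D_kern: "\<forall>s\<in>D. 0 < kern s"
    by (rule kern_positive_part)
  obtain p q where pq: "0 < p" "p < q"
    and conv_pos: "\<And>x. p < x \<Longrightarrow> x < q \<Longrightarrow> 0 < (\<integral>\<^sup>+s. indicator D s * indicator D (x - s) \<partial>lborel)"
    by (rule convolution_indicator_pos[OF D D_pos(2,3,1)]) blast
  have zero_D: "(\<integral>\<^sup>+s. indicator D s * ennreal (f (t - s)) \<partial>lborel) = 0" if "f t = 0" for t
  proof -
    have "AE s in lborel. indicator D s * ennreal (f (t - s)) = 0"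
      using zero_spreads[OF adm sol that]
      by eventually_elim (use D_kern in \<open>auto simp: indicator_def\<close>)
    then show ?thesis by (subst nn_integral_0_iff_AE) auto
  qed
  \<comment> \<open>Two uses of \<open>zero_spreads\<close>, with both shifts in \<open>D\<close>,
    show that \<open>f (t - x)\<close> integrates to 0 against the convolution of
    \<open>indicator D\<close> with itself. Continuity then removes the exceptional null
    set.\<close>
  have step: "f (t - x) = 0" if t: "f t = 0" and x: "p < x" "x < q" for t x
  proof -
    have "(\<integral>\<^sup>+x. ennreal (f (t - x)) * (\<integral>\<^sup>+s. indicator D s * indicator D (x - s) \<partial>lborel) \<partial>lborel)
      = (\<integral>\<^sup>+x. (\<integral>\<^sup>+s. ennreal (f (t - x)) * (indicator D s * indicator D (x - s)) \<partial>lborel) \<partial>lborel)"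
      by (intro nn_integral_cong nn_integral_cmult[symmetric]) measurable
    also have "\<dots> = (\<integral>\<^sup>+s. (\<integral>\<^sup>+x. ennreal (f (t - x)) * (indicator D s * indicator D (x - s)) \<partial>lborel) \<partial>lborel)"
      by (rule lborel_pair.Fubini') measurable
    also have "\<dots> = (\<integral>\<^sup>+(s::real). 0 \<partial>lborel)"
    proof (rule nn_integral_cong_AE, use zero_spreads[OF adm sol t] in eventually_elim)
      fix s assume s: "0 < kern s \<longrightarrow> f (t - s) = 0"
      have "(\<integral>\<^sup>+x. ennreal (f (t - x)) * (indicator D s * indicator D (x - s)) \<partial>lborel)
        = (\<integral>\<^sup>+x. indicator D s * (indicator D x * ennreal (f (t - s - x))) \<partial>lborel)"
        using nn_integral_shift[of "\<lambda>x. ennreal (f (t - x)) * (indicator D s * indicator D (x - s))" s]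
        by (simp add: algebra_simps)
      also have "\<dots> = indicator D s * (\<integral>\<^sup>+x. indicator D x * ennreal (f (t - s - x)) \<partial>lborel)"
        by (intro nn_integral_cmult) measurable
      also have "\<dots> = 0" using s D_kern zero_D[of "t - s"] by (cases "s \<in> D") simp_all
      finally show "(\<integral>\<^sup>+x. ennreal (f (t - x)) * (indicator D s * indicator D (x - s)) \<partial>lborel) = 0" .
    qed
    also have "\<dots> = 0" by simp
    finally have "AE x in lborel. ennreal (f (t - x)) * (\<integral>\<^sup>+s. indicator D s * indicator D (x - s) \<partial>lborel) = 0"
      by (subst (asm) nn_integral_0_iff_AE) auto
    then have "AE x in lborel. p < x \<longrightarrow> x < q \<longrightarrow> f (t - x) = 0"
    proof eventually_elim
      case (elim x)
      then show ?case using conv_pos[of x] admD(2)[OF adm, of "t - x"] by (auto simp: ennreal_eq_0_iff)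
    qed
    then show ?thesis
      by (rule continuous_AE_eq_0[rotated])
        (use x in \<open>auto intro!: continuous_intros continuous_on_compose2[OF cont]\<close>)
  qed
  obtain T where "\<And>t. t < T \<Longrightarrow> t \<in> {t. f t = 0}"
    by (rule left_ray_of_shift_invariant[of p q "{t. f t = 0}" t1]) (use pq step t1 in auto)
  then show ?thesis using zero_if_zero_left[OF adm sol] by blast
qed

subsection \<open>Existence of solutions with a source\<close>

text \<open>Schauder's theorem is bypassed: Brouwer's theorem is applied to step functions on finer and
  finer grids, cut off at the supersolution \<open>u\<close>, and \<open>compactness\<close> gives the limit.\<close>

lemma source_solution:
  obtains \<epsilon>0 where "0 < \<epsilon>0"
    "\<And>\<epsilon>. 0 < \<epsilon> \<Longrightarrow> \<epsilon> \<le> \<epsilon>0 \<Longrightarrow> \<exists>\<phi>. adm \<phi> \<and> continuous_on UNIV \<phi> \<and>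
       (\<forall>t. \<phi> t = A \<phi> t + \<epsilon> * min 1 (exp (b * t))) \<and> (\<forall>t. \<phi> t \<le> \<epsilon> / (1 - \<beta>) * exp (b * t))"
proof -
  obtain v0 where v0: "0 \<le> v0" "\<And>v. 0 \<le> v \<Longrightarrow> g v \<tau>0 \<le> g v0 \<tau>0" "C * g v0 \<tau>0 < \<Theta> \<zeta>2"
    using g0_max by blast
  \<comment> \<open>The slack in (N2): it is exactly what makes
    \<open>C * g v0 \<tau>0 + tg \<zeta>2 + \<epsilon>0\<close> equal to \<zeta>2.\<close>
  define \<epsilon>0 where "\<epsilon>0 = \<Theta> \<zeta>2 - C * g v0 \<tau>0"
  have A_le: "A f t + \<epsilon>0 \<le> \<zeta>2" if f: "adm f" for f t
  proof -
    have "A f t \<le> C * g v0 \<tau>0 + tg \<zeta>2"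
      by (rule A_bounds(2)[OF f, of 0 \<zeta>2 0]) (use admD[OF f] v0 g_nonneg[OF \<tau>0(1)] in auto)
    then show ?thesis by (simp add: \<epsilon>0_def Theta_eq)
  qed
  show thesis
  proof (rule that)
    show "0 < \<epsilon>0" using v0(3) by (simp add: \<epsilon>0_def)
    fix \<epsilon> assume \<epsilon>: "0 < \<epsilon>" "\<epsilon> \<le> \<epsilon>0"
    \<comment> \<open>The solution of \<open>q * \<beta> + \<epsilon> = q\<close>, so that adding
      the source to the image keeps functions below \<open>u\<close>.\<close>
    define q where "q = \<epsilon> / (1 - \<beta>)"
    define e where "e t = \<epsilon> * min 1 (exp (b * t))" for t
    define u where "u t = min \<zeta>2 (q * exp (b * t))" for t
    have q: "0 < q" "q * \<beta> + \<epsilon> = q"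
      using \<epsilon>(1) \<beta>(2) by (simp_all add: q_def field_simps)
    have e_cont: "continuous_on UNIV e" unfolding e_def by (intro continuous_intros)
    have e_bounds: "0 \<le> e t" "e t \<le> \<epsilon>" "e t \<le> \<epsilon> * exp (b * t)" for t
      using \<epsilon>(1) by (auto simp: e_def min_def)
    have u_nonneg: "0 \<le> u t" "u t \<le> \<zeta>2" for t using q \<zeta>2 by (auto simp: u_def)
    have Au: "A f t + e t \<le> u t" if f: "adm f" "\<And>t. f t \<le> u t" for f t
    proof -
      have "A f t \<le> q * \<beta> * exp (b * t)"
        using f(2) q(1) by (intro A_exp_bound f(1)) (auto simp: u_def)
      then have "A f t + e t \<le> (q * \<beta> + \<epsilon>) * exp (b * t)"
        using e_bounds(3)[of t] by (simp add: algebra_simps)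
      moreover have "A f t + e t \<le> \<zeta>2" using A_le[OF f(1), of t] e_bounds(2)[of t] \<epsilon>(2) by simp
      ultimately show ?thesis using q(2) by (simp add: u_def)
    qed
    \<comment> \<open>The interval [-N, N) is cut into \<open>2 * N * N\<close> cells of length 1/N;
      \<open>node N i\<close> is the left end of cell \<open>i\<close>.\<close>
    define idx where "idx N t = nat \<lfloor>(t + real N) * real N\<rfloor>" for N :: nat and t :: real
    define node where "node N i = real i / real N - real N" for N i :: nat
    \<comment> \<open>A nodal value may exceed the cut-off \<open>u\<close> inside its cell, hence
      the minimum. In the limit the cut is harmless because \<open>A f + e\<close> stays below
      \<open>u\<close>.\<close>
    define stp where "stp N y t = (if - real N \<le> t \<and> t < real N then min (y (idx N t)) (u t) else 0)"
      for N :: nat and y :: "nat \<Rightarrow> real" and t :: real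
    have idx: "idx N t < 2 * N * N" "\<bar>node N (idx N t) - t\<bar> \<le> 1 / real N"
      if "0 < N" "- real N \<le> t" "t < real N" for N t
    proof -
      have "0 \<le> (t + real N) * real N" using that by simp
      then have fl: "real (idx N t) \<le> (t + real N) * real N" "(t + real N) * real N < real (idx N t) + 1"
        unfolding idx_def by linarith+
      have "(t + real N) * real N < (real N + real N) * real N"
        using that by (intro mult_strict_right_mono) auto
      then have "real (idx N t) < real (2 * N * N)" using fl(1) by (simp add: algebra_simps)
      then show "idx N t < 2 * N * N" by (simp only: of_nat_less_iff)
      have "real (idx N t) / real N \<le> t + real N" "t + real N < (real (idx N t) + 1) / real N"
        using fl that(1) by (simp_all only: pos_divide_le_eq pos_less_divide_eq of_nat_0_less_iff)
      then show "\<bar>node N (idx N t) - t\<bar> \<le> 1 / real N"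
        by (simp add: node_def add_divide_distrib)
    qed
    have u_meas[measurable]: "u \<in> borel_measurable borel" unfolding u_def by measurable
    have stp_adm: "adm (stp N y)" and stp_le: "stp N y t \<le> u t"
      if N: "0 < N" and y: "\<And>j. j < 2 * N * N \<Longrightarrow> y j \<in> {0..\<zeta>2}" for N y t
    proof -
      have "0 \<le> stp N y t \<and> stp N y t \<le> u t" for t
        using y[OF idx(1)[OF N, of t]] u_nonneg[of t] by (auto simp: stp_def)
      moreover have "stp N y \<in> borel_measurable borel"
        unfolding stp_def idx_def by measurable
      ultimately show "adm (stp N y)" "stp N y t \<le> u t"
        using u_nonneg(2) by (auto simp: adm_def intro: order_trans)
    qed
    \<comment> \<open>The unknowns are the nodal values; the fixed point makes a step function agree
      at the nodes with its image, up to the cut-off.\<close>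
    have "\<exists>y. (\<forall>i<2 * N * N. y i \<in> {0..\<zeta>2} \<and> A (stp N y) (node N i) + e (node N i) = y i)" if N: "0 < N" for N
    proof (rule brouwer_box[OF \<zeta>2, of "2 * N * N" "\<lambda>y i. A (stp N y) (node N i) + e (node N i)"])
      fix y :: "nat \<Rightarrow> real" and i assume "\<And>j. j < 2 * N * N \<Longrightarrow> y j \<in> {0..\<zeta>2}"
      from stp_adm[OF N this] stp_le[OF N this]
      have "A (stp N y) (node N i) + e (node N i) \<le> u (node N i)" by (rule Au)
      then show "A (stp N y) (node N i) + e (node N i) \<in> {0..\<zeta>2}"
        using A_nonneg e_bounds(1)[of "node N i"] u_nonneg(2)[of "node N i"] by (auto intro: order_trans)
    next
      fix x :: "nat \<Rightarrow> nat \<Rightarrow> real" and y i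
      assume x: "\<And>k j. j < 2 * N * N \<Longrightarrow> x k j \<in> {0..\<zeta>2}"
        and lim: "\<And>j. j < 2 * N * N \<Longrightarrow> (\<lambda>k. x k j) \<longlonglongrightarrow> y j"
      have y: "y j \<in> {0..\<zeta>2}" if "j < 2 * N * N" for j
        using x[OF that] by (intro closed_sequentially[OF closed_atLeastAtMost _ lim[OF that]])
      have "(\<lambda>k. stp N (x k) t) \<longlonglongrightarrow> stp N y t" for t
        using idx(1)[OF N, of t] by (auto simp: stp_def intro!: tendsto_min lim)
      then have "(\<lambda>k. conv (stp N (x k)) (node N i)) \<longlonglongrightarrow> conv (stp N y) (node N i)"
        by (intro conv_tendsto stp_adm[OF N x])
      moreover have "conv (stp N y) (node N i) < \<infinity>" by (intro conv_finite stp_adm N y)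
      ultimately have "(\<lambda>k. A (stp N (x k)) (node N i)) \<longlonglongrightarrow> A (stp N y) (node N i)"
        unfolding A_def
        by (intro tendsto_enn2real) auto
      then show "(\<lambda>k. A (stp N (x k)) (node N i) + e (node N i)) \<longlonglongrightarrow> A (stp N y) (node N i) + e (node N i)"
        by (intro tendsto_intros)
    qed blast
    then have "\<forall>n. \<exists>y. \<forall>i<2 * Suc n * Suc n. y i \<in> {0..\<zeta>2} \<and>
        A (stp (Suc n) y) (node (Suc n) i) + e (node (Suc n) i) = y i" by blast
    from choice[OF this] obtain y where y: "\<And>n i. i < 2 * Suc n * Suc n \<Longrightarrow> y n i \<in> {0..\<zeta>2}"
      and fixp: "\<And>n i. i < 2 * Suc n * Suc n \<Longrightarrow> A (stp (Suc n) (y n)) (node (Suc n) i) + e (node (Suc n) i) = y n i"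
      by blast
    define f where "f n = stp (Suc n) (y n)" for n
    have f_adm: "adm (f n)" for n
      unfolding f_def by (rule stp_adm, simp, rule y)
    have f_le: "f n t \<le> u t" for n t
      unfolding f_def by (rule stp_le, simp, rule y)
    have approx: "(\<lambda>n. f n t - A (f n) t) \<longlonglongrightarrow> e t" for t
    proof (rule LIMSEQ_I)
      fix r :: real assume r: "0 < r"
      obtain d1 where d1: "d1 > 0" "\<forall>f x y. adm f \<longrightarrow> \<bar>x - y\<bar> < d1 \<longrightarrow> \<bar>A f x - A f y\<bar> < r / 2"
        using A_equicontinuous[of "r / 2"] r by auto
      obtain d2 where d2: "d2 > 0" "\<And>x. \<bar>x - t\<bar> < d2 \<Longrightarrow> \<bar>e x - e t\<bar> < r / 2"
        using e_cont r unfolding continuous_on_iff dist_real_def by (metis UNIV_I half_gt_zero)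
      obtain N1 where N1: "\<bar>t\<bar> < real N1" using reals_Archimedean2 by blast
      obtain N2 where N2: "inverse (real (Suc N2)) < min d1 d2"
        using reals_Archimedean[of "min d1 d2"] d1(1) d2(1) by auto
      have "norm (f n t - A (f n) t - e t) < r" if n: "n \<ge> max N1 N2" for n
      proof -
        have t: "- real (Suc n) \<le> t" "t < real (Suc n)" using N1 n by linarith+
        define i where "i = idx (Suc n) t"
        have i: "i < 2 * Suc n * Suc n" "\<bar>node (Suc n) i - t\<bar> \<le> 1 / real (Suc n)"
          unfolding i_def using idx[OF _ t] by auto
        have "1 / real (Suc n) \<le> inverse (real (Suc N2))"
          using n by (simp add: field_simps)
        then have near: "\<bar>node (Suc n) i - t\<bar> < d1" "\<bar>node (Suc n) i - t\<bar> < d2" using N2 i(2) by auto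
        have "\<bar>A (f n) (node (Suc n) i) - A (f n) t\<bar> < r / 2" using d1(2) f_adm near(1) by blast
        moreover have "\<bar>e (node (Suc n) i) - e t\<bar> < r / 2" by (rule d2(2)[OF near(2)])
        moreover have "y n i = A (f n) (node (Suc n) i) + e (node (Suc n) i)" unfolding f_def fixp[OF i(1)] ..
        ultimately have "\<bar>y n i - (A (f n) t + e t)\<bar> < r" by linarith
        moreover have "f n t = min (y n i) (u t)" using t by (simp add: f_def stp_def i_def)
        moreover have "A (f n) t + e t \<le> u t" by (rule Au[OF f_adm f_le])
        ultimately show ?thesis by (auto simp: min_def abs_less_iff)
      qed
      then show "\<exists>no. \<forall>n\<ge>no. norm (f n t - A (f n) t - e t) < r" by blast
    qed
    obtain k \<phi> where "strict_mono (k :: nat \<Rightarrow> nat)" and lim: "\<And>t. (\<lambda>n. f (k n) t) \<longlonglongrightarrow> \<phi> t"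
      and \<phi>: "adm \<phi>" "\<And>t. \<phi> t = A \<phi> t + e t" "continuous_on UNIV \<phi>"
      by (rule compactness[of f e]) (use f_adm e_cont approx in \<open>assumption | blast\<close>)+
    have "\<phi> t \<le> q * exp (b * t)" for t
      by (rule LIMSEQ_le_const2[OF lim]) (use f_le in \<open>auto simp: u_def\<close>)
    then show "\<exists>\<phi>. adm \<phi> \<and> continuous_on UNIV \<phi> \<and>
       (\<forall>t. \<phi> t = A \<phi> t + \<epsilon> * min 1 (exp (b * t))) \<and> (\<forall>t. \<phi> t \<le> \<epsilon> / (1 - \<beta>) * exp (b * t))"
      using \<phi> unfolding e_def q_def by blast
  qed
qed

section \<open>A minorizing kernel near zero\<close>

text \<open>The sets \<open>E n\<close> collect the \<tau> with g >= \<theta> gd v for v up to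
  1/(n+1); they increase to the whole space. Restricting \<theta> K gd to \<open>E n\<close> and to
  |s| <= n gives kernels whose masses increase to \<theta> c > 1, so one of them has mass above 1.
  The moment at \<open>b\<close> stays below 1 because the kernel has only become smaller.\<close>

lemma minorizing_kernel:
  obtains k R \<delta> where "drift_kernel k R b" "0 < \<delta>"
    "\<And>f t. adm f \<Longrightarrow> (\<And>s. \<bar>s\<bar> \<le> R \<Longrightarrow> f (t - s) \<le> \<delta>) \<Longrightarrow> (\<integral>\<^sup>+ s. k s * ennreal (f (t - s)) \<partial>lborel) \<le> ennreal (A f t)"
proof -
  define c where "c = enn2real (chi_int M K gd 0)"
  have c: "chi_int M K gd 0 = ennreal c" using chi_0(1) by (simp add: c_def)
  then have "1 < c" using chi_0(2) by (metis ennreal_1 ennreal_less_iff zero_le_one)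
  \<comment> \<open>The midpoint of 1/c and 1, so that \<theta> < 1 < \<theta> c.\<close>
  define \<theta> where "\<theta> = (1 + c) / (2 * c)"
  have \<theta>: "0 < \<theta>" "\<theta> < 1" "1 < \<theta> * c" using \<open>1 < c\<close> by (auto simp: \<theta>_def field_simps)
  \<comment> \<open>Testing only rational arguments makes the set measurable; \<open>E_le\<close>
    recovers all real arguments by continuity of \<open>g\<close>.\<close>
  define E where "E n = {\<tau> \<in> space M. \<forall>q\<in>\<rat> \<inter> {0<..inverse (real (Suc n))}. \<theta> * gd \<tau> * q \<le> g q \<tau>}" for n
  have cQ: "countable (\<rat> \<inter> {0<..inverse (real (Suc n))})" for n using countable_rat by blast
  have [measurable]: "E n \<in> sets M" for n
    unfolding E_def using cQ by measurable
  have E_mono: "E m \<subseteq> E n" if "m \<le> n" for m n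
  proof -
    have "inverse (real (Suc n)) \<le> inverse (real (Suc m))" using that by (simp add: field_simps)
    then have "\<rat> \<inter> {0<..inverse (real (Suc n))} \<subseteq> \<rat> \<inter> {0<..inverse (real (Suc m))}"
      by (intro Int_mono order_refl subsetI) (simp only: greaterThanAtMost_iff, blast intro: order_trans)
    then show ?thesis unfolding E_def by blast
  qed
  have E_ev: "\<exists>n. \<tau> \<in> E n" if \<tau>: "\<tau> \<in> space M" for \<tau>
  proof -
    have "((\<lambda>v. g v \<tau> / v) \<longlongrightarrow> gd \<tau>) (at 0 within {0..})"
      using g_deriv[OF \<tau>] g_zero[OF \<tau>] by (simp add: has_field_derivative_iff)
    moreover have "\<theta> * gd \<tau> < gd \<tau>" using \<theta>(2) gd_pos[OF \<tau>] by simp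
    ultimately have "\<forall>\<^sub>F v in at 0 within {0..}. \<theta> * gd \<tau> < g v \<tau> / v" by (rule order_tendstoD(1))
    then obtain d where d: "d > 0" "\<And>v. 0 < v \<Longrightarrow> v < d \<Longrightarrow> \<theta> * gd \<tau> < g v \<tau> / v"
      unfolding eventually_at by auto
    obtain n where n: "inverse (real (Suc n)) < d" using reals_Archimedean[OF d(1)] by blast
    have "\<theta> * gd \<tau> * v \<le> g v \<tau>" if "0 < v" "v \<le> inverse (real (Suc n))" for v
      using d(2)[of v] that n by (simp add: pos_less_divide_eq)
    then have "\<tau> \<in> E n" using \<tau> by (auto simp: E_def)
    then show ?thesis by blast
  qed
  have E_le: "\<theta> * gd \<tau> * v \<le> g v \<tau>" if \<tau>: "\<tau> \<in> E n" and v: "0 \<le> v" "v \<le> inverse (real (Suc n))" for \<tau> n v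
  proof (cases "v = 0")
    case False
    have \<tau>M: "\<tau> \<in> space M" using \<tau> by (simp add: E_def)
    have "\<exists>q. q \<in> \<rat> \<and> v - v / real (Suc (Suc k)) < q \<and> q < v" for k
      using Rats_dense_in_real[of "v - v / real (Suc (Suc k))" v] False v by auto
    then obtain q where q: "\<And>k. q k \<in> \<rat>" "\<And>k. v - v / real (Suc (Suc k)) < q k" "\<And>k. q k < v" by metis
    have q_pos: "0 < q k" for k
    proof -
      have "v / real (Suc (Suc k)) \<le> v / 1" using v by (intro divide_left_mono) auto
      then show ?thesis using q(2)[of k] by simp
    qed
    have lim: "q \<longlonglongrightarrow> v"
    proof (rule tendsto_sandwich[OF _ _ _ tendsto_const])
      have "(\<lambda>k. v / real (Suc (Suc k))) \<longlonglongrightarrow> 0"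
        using LIMSEQ_Suc[OF LIMSEQ_Suc[OF lim_const_over_n[of v]]] by simp
      from tendsto_diff[OF tendsto_const this, of v]
      show "(\<lambda>k. v - v / real (Suc (Suc k))) \<longlonglongrightarrow> v" by simp
    qed (use q in \<open>auto intro!: always_eventually less_imp_le\<close>)
    have "\<theta> * gd \<tau> * q k \<le> g (q k) \<tau>" for k
      using \<tau> q(1)[of k] q_pos[of k] q(3)[of k] v(2) by (auto simp: E_def)
    moreover have "(\<lambda>k. g (q k) \<tau>) \<longlonglongrightarrow> g v \<tau>" using q_pos by (intro tendsto_g \<tau>M lim less_imp_le)
    moreover have "(\<lambda>k. \<theta> * gd \<tau> * q k) \<longlonglongrightarrow> \<theta> * gd \<tau> * v" by (intro tendsto_intros lim)
    ultimately show ?thesis by (intro LIMSEQ_le) auto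
  qed (use \<tau> g_zero in \<open>auto simp: E_def\<close>)
  define F where "F n s \<tau> = ennreal (\<theta> * (K s \<tau> * gd \<tau>)) * (indicator {- real n..real n} s * indicator (E n) \<tau>)" for n s \<tau>
  have [measurable]: "(\<lambda>s. F n s \<tau>) \<in> borel_measurable borel" if "\<tau> \<in> space M" for n \<tau>
    unfolding F_def using that by measurable
  have [measurable]: "(\<lambda>\<tau>. F n s \<tau>) \<in> borel_measurable M" for n s
    unfolding F_def by measurable
  have F_mono: "F m s \<tau> \<le> F n s \<tau>" if "m \<le> n" for m n s \<tau>
    unfolding F_def using E_mono[OF that] that by (intro mult_left_mono) (auto simp: indicator_def)
  have F_lim: "(\<lambda>n. F n s \<tau>) \<longlonglongrightarrow> ennreal (\<theta> * (K s \<tau> * gd \<tau>))" if \<tau>: "\<tau> \<in> space M" for s \<tau>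
  proof (rule tendsto_eventually)
    obtain n1 where n1: "\<tau> \<in> E n1" using E_ev[OF \<tau>] by blast
    obtain n2 where n2: "\<bar>s\<bar> \<le> real n2" using real_arch_simple by blast
    show "\<forall>\<^sub>F n in sequentially. F n s \<tau> = ennreal (\<theta> * (K s \<tau> * gd \<tau>))"
    proof (rule eventually_sequentiallyI[of "max n1 n2"])
      fix n assume n: "max n1 n2 \<le> n"
      then have "\<tau> \<in> E n" using E_mono[of n1 n] n1 by auto
      moreover have "s \<in> {- real n..real n}" using n2 n by auto
      ultimately show "F n s \<tau> = ennreal (\<theta> * (K s \<tau> * gd \<tau>))" by (simp add: F_def)
    qed
  qed
  define k where "k n s = (\<integral>\<^sup>+ \<tau>. F n s \<tau> \<partial>M)" for n s
  have [measurable]: "k n \<in> borel_measurable borel" for n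
    unfolding k_def F_def by measurable
  have k_integral: "(\<integral>\<^sup>+ s. k n s * h s \<partial>lborel) = (\<integral>\<^sup>+ \<tau>. (\<integral>\<^sup>+ s. F n s \<tau> * h s \<partial>lborel) \<partial>M)"
    if [measurable]: "h \<in> borel_measurable borel" for n h
  proof -
    have "(\<integral>\<^sup>+ s. k n s * h s \<partial>lborel) = (\<integral>\<^sup>+ s. (\<integral>\<^sup>+ \<tau>. F n s \<tau> * h s \<partial>M) \<partial>lborel)"
      unfolding k_def by (intro nn_integral_cong) (simp add: nn_integral_multc)
    also have "\<dots> = (\<integral>\<^sup>+ \<tau>. (\<integral>\<^sup>+ s. F n s \<tau> * h s \<partial>lborel) \<partial>M)"
      unfolding F_def by (rule P.Fubini'[symmetric]) measurable
    finally show ?thesis .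
  qed
  have F_outside: "F n s \<tau> = 0" if "\<tau> \<notin> space M" for n s \<tau>
    using that by (simp add: F_def E_def)
  have "(\<lambda>n. \<integral>\<^sup>+ \<tau>. (\<integral>\<^sup>+ s. F n s \<tau> \<partial>lborel) \<partial>M) \<longlonglongrightarrow>
      (\<integral>\<^sup>+ \<tau>. (\<integral>\<^sup>+ s. ennreal (\<theta> * (K s \<tau> * gd \<tau>)) \<partial>lborel) * indicator (space M) \<tau> \<partial>M)"
  proof (rule nn_integral_LIMSEQ)
    show "incseq (\<lambda>n \<tau>. \<integral>\<^sup>+ s. F n s \<tau> \<partial>lborel)"
      by (auto simp: incseq_def le_fun_def intro!: nn_integral_mono F_mono)
    show "(\<lambda>\<tau>. \<integral>\<^sup>+ s. F n s \<tau> \<partial>lborel) \<in> borel_measurable M" for n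
      unfolding F_def by measurable
    fix \<tau>
    show "(\<lambda>n. \<integral>\<^sup>+ s. F n s \<tau> \<partial>lborel) \<longlonglongrightarrow>
        (\<integral>\<^sup>+ s. ennreal (\<theta> * (K s \<tau> * gd \<tau>)) \<partial>lborel) * indicator (space M) \<tau>"
    proof (cases "\<tau> \<in> space M")
      case True
      have "(\<lambda>n. \<integral>\<^sup>+ s. F n s \<tau> \<partial>lborel) \<longlonglongrightarrow> (\<integral>\<^sup>+ s. ennreal (\<theta> * (K s \<tau> * gd \<tau>)) \<partial>lborel)"
        by (rule nn_integral_LIMSEQ) (use True F_lim F_mono in \<open>auto simp: incseq_def le_fun_def\<close>)
      then show ?thesis using True by simp
    qed (simp add: F_outside)
  qed
  moreover have "(\<integral>\<^sup>+ \<tau>. (\<integral>\<^sup>+ s. ennreal (\<theta> * (K s \<tau> * gd \<tau>)) \<partial>lborel) * indicator (space M) \<tau> \<partial>M)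
      = (\<integral>\<^sup>+ \<tau>. (\<integral>\<^sup>+ s. ennreal (\<theta> * (K s \<tau> * gd \<tau>)) \<partial>lborel) \<partial>M)"
    by (intro nn_integral_cong) simp
  moreover have "(\<integral>\<^sup>+ \<tau>. (\<integral>\<^sup>+ s. ennreal (\<theta> * (K s \<tau> * gd \<tau>)) \<partial>lborel) \<partial>M) = ennreal (\<theta> * c)"
    unfolding mass_cmult[OF less_imp_le[OF \<theta>(1)]] c using \<theta>(1) by (simp add: ennreal_mult')
  moreover have "ennreal 1 < ennreal (\<theta> * c)" using \<theta>(3) by (simp add: ennreal_lessI)
  ultimately have "\<forall>\<^sub>F n in sequentially. ennreal 1 < (\<integral>\<^sup>+ \<tau>. (\<integral>\<^sup>+ s. F n s \<tau> \<partial>lborel) \<partial>M)"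
    by (metis order_tendstoD(1))
  then obtain n where n: "ennreal 1 < (\<integral>\<^sup>+ \<tau>. (\<integral>\<^sup>+ s. F n s \<tau> \<partial>lborel) \<partial>M)"
    unfolding eventually_sequentially by blast
  show thesis
  proof (rule that)
    \<comment> \<open>The support lies in [-n, n]; the radius \<open>Suc n\<close> is used since
      \<open>n\<close> may be 0 and \<open>drift_kernel\<close> needs a positive radius.\<close>
    show "drift_kernel (k n) (real (Suc n)) b"
    proof
      show "k n s = 0" if "real (Suc n) < \<bar>s\<bar>" for s
      proof -
        have "s \<notin> {- real n..real n}" using that by auto
        then have "F n s \<tau> = 0" for \<tau> by (simp add: F_def)
        then show ?thesis by (simp add: k_def)
      qed
      show "1 < (\<integral>\<^sup>+ s. k n s \<partial>lborel)"
        using n k_integral[of "\<lambda>_. 1" n] by simp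
      have exp_meas: "(\<lambda>s. ennreal (exp (- b * s))) \<in> borel_measurable borel" by measurable
      have "(\<integral>\<^sup>+ s. k n s * ennreal (exp (- b * s)) \<partial>lborel) \<le> chi_int M K gd b"
        unfolding k_integral[OF exp_meas] chi_int_def
      proof (intro nn_integral_mono)
        fix \<tau> s assume \<tau>: "\<tau> \<in> space M"
        have K: "0 \<le> K s \<tau> * gd \<tau>" using K_nonneg[OF \<tau>] gd_pos[OF \<tau>] by simp
        have "F n s \<tau> \<le> ennreal (\<theta> * (K s \<tau> * gd \<tau>))" by (auto simp: F_def indicator_def)
        also have "\<dots> \<le> ennreal (K s \<tau> * gd \<tau>)"
          using K \<theta> by (intro ennreal_leI mult_left_le_one_le) auto
        finally have "F n s \<tau> * ennreal (exp (- b * s)) \<le> ennreal (K s \<tau> * gd \<tau>) * ennreal (exp (- s * b))"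
          by (intro mult_mono) (auto simp: mult.commute)
        then show "F n s \<tau> * ennreal (exp (- b * s)) \<le> ennreal (K s \<tau> * gd \<tau> * exp (- s * b))"
          using K by (simp add: ennreal_mult')
      qed
      then show "(\<integral>\<^sup>+ s. k n s * ennreal (exp (- b * s)) \<partial>lborel) < 1" using b(2) by (rule order_le_less_trans)
    qed (use b in auto)
    show "0 < inverse (real (Suc n))" by simp
    fix f t assume f: "adm f" and small: "\<And>s. \<bar>s\<bar> \<le> real (Suc n) \<Longrightarrow> f (t - s) \<le> inverse (real (Suc n))"
    have [measurable]: "f \<in> borel_measurable borel" using f by (rule admD)
    have "(\<integral>\<^sup>+ s. k n s * ennreal (f (t - s)) \<partial>lborel) = (\<integral>\<^sup>+ \<tau>. (\<integral>\<^sup>+ s. F n s \<tau> * ennreal (f (t - s)) \<partial>lborel) \<partial>M)"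
      by (rule k_integral) measurable
    also have "\<dots> \<le> conv f t"
      unfolding conv_def
    proof (intro nn_integral_mono)
      fix \<tau> s assume \<tau>: "\<tau> \<in> space M"
      show "F n s \<tau> * ennreal (f (t - s)) \<le> ennreal (K s \<tau> * g (f (t - s)) \<tau>)"
      proof (cases "\<bar>s\<bar> \<le> real n \<and> \<tau> \<in> E n")
        case True
        have K: "0 \<le> K s \<tau> * gd \<tau>" using K_nonneg[OF \<tau>] gd_pos[OF \<tau>] by simp
        have "K s \<tau> * (\<theta> * gd \<tau> * f (t - s)) \<le> K s \<tau> * g (f (t - s)) \<tau>"
          using True by (intro mult_left_mono E_le[of \<tau> n] admD(2)[OF f] small K_nonneg \<tau>) auto
        moreover have "F n s \<tau> = ennreal (\<theta> * (K s \<tau> * gd \<tau>))" using True by (simp add: F_def abs_le_iff)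
        moreover have "ennreal (\<theta> * (K s \<tau> * gd \<tau>)) * ennreal (f (t - s)) = ennreal (K s \<tau> * (\<theta> * gd \<tau> * f (t - s)))"
          using K \<theta>(1) by (subst ennreal_mult'[symmetric]) (auto simp: mult_ac)
        ultimately show ?thesis by (simp only: ennreal_leI)
      qed (auto simp: F_def abs_le_iff)
    qed
    finally show "(\<integral>\<^sup>+ s. k n s * ennreal (f (t - s)) \<partial>lborel) \<le> ennreal (A f t)"
      by (simp add: ennreal_A[OF f])
  qed
qed

subsection \<open>Emergence and persistence\<close>

lemma adm_shift: "adm f \<Longrightarrow> adm (\<lambda>t. f (t + c))"
  unfolding adm_def by (auto intro: measurable_compose)

lemma A_shift: "A (\<lambda>t. f (t + c)) t = A f (t + c)"
  by (simp add: A_def conv_def algebra_simps)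

text \<open>The condition \<open>A f t \<le> f t\<close> covers exact solutions as well as those
  with a source. The kernel is hidden from here on; only \<delta> and \<open>R\<close>
  remain.\<close>

definition vanishing_level :: "real \<Rightarrow> real \<Rightarrow> bool" where
  "vanishing_level \<delta> R \<longleftrightarrow> (\<forall>f a t. adm f \<longrightarrow> continuous_on UNIV f \<longrightarrow> (\<forall>t. A f t \<le> f t) \<longrightarrow>
     (\<forall>t\<ge>a. f t \<le> \<delta>) \<longrightarrow> a + R < t \<longrightarrow> f t = 0)"

text \<open>Finiteness is an assumption on the individual \<open>f\<close>, whereas \<open>B\<close>
  is the same for all \<open>f\<close>.\<close>

definition left_mass_level :: "real \<Rightarrow> real \<Rightarrow> real \<Rightarrow> bool" where
  "left_mass_level \<delta> R B \<longleftrightarrow> (\<forall>f. adm f \<longrightarrow> (\<forall>t. A f t \<le> f t) \<longrightarrow> (\<forall>t\<le>0. f t \<le> \<delta>) \<longrightarrow>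
     (\<integral>\<^sup>+t. ennreal (f t) * indicator {..0} t \<partial>lborel) < \<infinity> \<longrightarrow>
     (\<integral>\<^sup>+t. ennreal (f t) * indicator {..- 2 * R} t \<partial>lborel) \<le> ennreal B)"

lemma vanishing_levelD:
  assumes "vanishing_level \<delta> R" "adm f" "continuous_on UNIV f" "\<And>t. A f t \<le> f t"
    "\<And>t. a \<le> t \<Longrightarrow> f t \<le> \<delta>" "a + R < t"
  shows "f t = 0"
  using assms unfolding vanishing_level_def by blast

text \<open>The offset \<open>R\<close> in both properties keeps the window of radius
  \<open>R\<close> around \<open>t\<close> inside the half-line on which f <= \<delta>, where
  \<open>A f\<close> dominates the convolution with \<open>k\<close>.\<close>

lemma small_level:
  obtains \<delta> R B where "0 < \<delta>" "vanishing_level \<delta> R" "left_mass_level \<delta> R B"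
proof -
  obtain k R \<delta> where k: "drift_kernel k R b" and \<delta>: "0 < \<delta>"
    and minor: "\<And>f t. adm f \<Longrightarrow> (\<And>s. \<bar>s\<bar> \<le> R \<Longrightarrow> f (t - s) \<le> \<delta>) \<Longrightarrow>
      (\<integral>\<^sup>+ s. k s * ennreal (f (t - s)) \<partial>lborel) \<le> ennreal (A f t)"
    by (rule minorizing_kernel) blast
  interpret drift_kernel k R b by (rule k)
  obtain m where m: "1 < m" "ennreal m \<le> (\<integral>\<^sup>+s. k s \<partial>lborel)"
    using mass_lower_bound by (metis less_imp_le)
  have "vanishing_level \<delta> R"
    unfolding vanishing_level_def
  proof (intro allI impI)
    fix f a t assume f_all: "adm f" "continuous_on UNIV f" "\<forall>t. A f t \<le> f t"
      and small_all: "\<forall>t\<ge>a. f t \<le> \<delta>" and t: "a + R < t"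
    note f = f_all(1,2) f_all(3)[rule_format] and small = small_all[rule_format]
    have "AE t in lborel. a + R < t \<longrightarrow> f t = 0"
    proof (rule supersolution_eventually_0[OF admD(1)[OF f(1)] admD(2)[OF f(1)] admD(3)[OF f(1)]])
      fix t assume t: "a + R \<le> t"
      have "(\<integral>\<^sup>+ s. k s * ennreal (f (t - s)) \<partial>lborel) \<le> ennreal (A f t)"
        using t by (intro minor f(1) small) auto
      also have "\<dots> \<le> ennreal (f t)" by (intro ennreal_leI f(3))
      finally show "(\<integral>\<^sup>+ s. k s * ennreal (f (t - s)) \<partial>lborel) \<le> ennreal (f t)" .
    qed
    then have "AE x in lborel. a + R < x \<longrightarrow> x < t + 1 \<longrightarrow> f x = 0"
      by eventually_elim simp
    then show "f t = 0" by (rule continuous_AE_eq_0[OF f(2)]) (use t in auto)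
  qed
  moreover have "left_mass_level \<delta> R (R * \<delta> / (m - 1))"
    unfolding left_mass_level_def
  proof (intro allI impI)
    fix f assume f_all: "adm f" "\<forall>t. A f t \<le> f t" and small_all: "\<forall>t\<le>0. f t \<le> \<delta>"
      and fin: "(\<integral>\<^sup>+t. ennreal (f t) * indicator {..0} t \<partial>lborel) < \<infinity>"
    note f = f_all(1) f_all(2)[rule_format] and small = small_all[rule_format]
    show "(\<integral>\<^sup>+t. ennreal (f t) * indicator {..- 2 * R} t \<partial>lborel) \<le> ennreal (R * \<delta> / (m - 1))"
    proof (rule supersolution_left_mass[OF admD(1)[OF f(1)] admD(2)[OF f(1)] small _ fin m])
      fix t assume t: "t \<le> - R"
      have "(\<integral>\<^sup>+ s. k s * ennreal (f (t - s)) \<partial>lborel) \<le> ennreal (A f t)"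
        using t by (intro minor f(1) small) auto
      also have "\<dots> \<le> ennreal (f t)" by (intro ennreal_leI f(2))
      finally show "(\<integral>\<^sup>+ s. k s * ennreal (f (t - s)) \<partial>lborel) \<le> ennreal (f t)" .
    qed
  qed
  ultimately show thesis using that \<delta> by blast
qed

lemma solution_compactness:
  assumes adm: "\<And>n. adm (f n)" and sol: "\<And>n t. f n t = A (f n) t"
  obtains k \<phi> where "strict_mono (k :: nat \<Rightarrow> nat)" "\<And>t. (\<lambda>n. f (k n) t) \<longlonglongrightarrow> \<phi> t"
    "adm \<phi>" "\<And>t. \<phi> t = A \<phi> t" "continuous_on UNIV \<phi>"
proof -
  have "(\<lambda>n. f n t - A (f n) t) \<longlonglongrightarrow> 0" for t using sol[of _ t] by simp
  then obtain k \<phi> where "strict_mono (k :: nat \<Rightarrow> nat)" "\<And>t. (\<lambda>n. f (k n) t) \<longlonglongrightarrow> \<phi> t"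
    "adm \<phi>" "\<And>t. \<phi> t = A \<phi> t + 0" "continuous_on UNIV \<phi>"
    using compactness[of f "\<lambda>_. 0", OF adm continuous_on_const] by blast
  then show thesis using that[of k \<phi>] by simp
qed

lemma solution_continuous:
  assumes adm: "adm f" and sol: "\<And>t. f t = A f t"
  shows "continuous_on UNIV f"
proof -
  have "f = A f" by (rule ext) (rule sol)
  then show ?thesis using A_continuous[OF adm] by simp
qed

text \<open>Two contradictions by limits of translates. Within a fixed time after height \<delta>
  the solution cannot become arbitrarily small, or a limit would have a zero. Hence values near 0
  require ever longer excursions below \<delta>, and their limit would stay below \<delta> on a
  right half-line without being zero.\<close>

lemma persistence:
  assumes level: "vanishing_level \<delta> R" and \<delta>: "0 < \<delta>"
    and adm: "adm \<phi>" and sol: "\<And>t. \<phi> t = A \<phi> t" and \<phi>0: "\<delta> \<le> \<phi> 0"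
  obtains c T where "0 < c" "\<And>t. T \<le> t \<Longrightarrow> c \<le> \<phi> t"
proof -
  have cont: "continuous_on UNIV \<phi>" by (rule solution_continuous[OF adm sol])
  have unif_pos: "\<exists>c>0. \<forall>a s. \<delta> \<le> \<phi> a \<longrightarrow> 0 \<le> s \<longrightarrow> s \<le> L \<longrightarrow> c \<le> \<phi> (a + s)" for L
  proof (rule ccontr)
    assume "\<not> ?thesis"
    then have "\<forall>n. \<exists>a s. \<delta> \<le> \<phi> a \<and> 0 \<le> s \<and> s \<le> L \<and> \<phi> (a + s) < inverse (real (Suc n))"
      by (metis inverse_positive_iff_positive not_le of_nat_0_less_iff zero_less_Suc)
    then obtain a s where as: "\<And>n. \<delta> \<le> \<phi> (a n)" "\<And>n. s n \<in> {0..L}" "\<And>n. \<phi> (a n + s n) < inverse (real (Suc n))"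
      unfolding atLeastAtMost_iff by metis
    have "compact {0..L}" by simp
    then obtain l r where r: "strict_mono (r :: nat \<Rightarrow> nat)" and lim: "(s \<circ> r) \<longlonglongrightarrow> l"
      unfolding compact_eq_seq_compact_metric seq_compact_def using as(2) by blast
    define f where "f n t = \<phi> (t + a (r n))" for n t
    have f: "adm (f n)" "f n t = A (f n) t" for n t
      unfolding f_def using adm_shift[OF adm] A_shift[of \<phi>] sol by auto
    obtain k \<psi> where k: "strict_mono (k :: nat \<Rightarrow> nat)" and \<psi>_lim: "\<And>t. (\<lambda>n. f (k n) t) \<longlonglongrightarrow> \<psi> t"
      and \<psi>: "adm \<psi>" "\<And>t. \<psi> t = A \<psi> t" "continuous_on UNIV \<psi>"
      by (rule solution_compactness[of f]) (rule f | blast)+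
    have "\<delta> \<le> \<psi> 0" by (rule LIMSEQ_le_const[OF \<psi>_lim]) (use as(1) in \<open>auto simp: f_def\<close>)
    have "\<psi> l = 0"
    proof (rule LIMSEQ_unique[OF \<psi>_lim])
      have sl: "(\<lambda>n. s (r (k n))) \<longlonglongrightarrow> l"
        using LIMSEQ_subseq_LIMSEQ[OF lim k] by (simp add: o_def)
      \<comment> \<open>Equicontinuity moves the evaluation point from the varying times to their
        limit \<open>l\<close>.\<close>
      have "(\<lambda>n. f (k n) l - f (k n) (s (r (k n)))) \<longlonglongrightarrow> 0"
      proof (rule LIMSEQ_I)
        fix e :: real assume "0 < e"
        from A_equicontinuous[OF this] obtain d where d: "d > 0"
          "\<forall>f x y. adm f \<longrightarrow> \<bar>x - y\<bar> < d \<longrightarrow> \<bar>A f x - A f y\<bar> < e" by blast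
        obtain N where N: "\<And>n. n \<ge> N \<Longrightarrow> \<bar>s (r (k n)) - l\<bar> < d"
          using LIMSEQ_D[OF sl d(1)] by (auto simp: real_norm_def)
        have "norm (f (k n) l - f (k n) (s (r (k n))) - 0) < e" if "n \<ge> N" for n
        proof -
          have "\<bar>A (f (k n)) l - A (f (k n)) (s (r (k n)))\<bar> < e"
            using d(2) f(1) N[OF that] by (simp add: abs_minus_commute)
          then show ?thesis using f(2)[of "k n" l] f(2)[of "k n" "s (r (k n))"] by simp
        qed
        then show "\<exists>no. \<forall>n\<ge>no. norm (f (k n) l - f (k n) (s (r (k n))) - 0) < e" by blast
      qed
      moreover have "(\<lambda>n. f (k n) (s (r (k n)))) \<longlonglongrightarrow> 0"
      proof (rule tendsto_sandwich[OF _ _ tendsto_const])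
        show "\<forall>\<^sub>F n in sequentially. 0 \<le> f (k n) (s (r (k n)))" using admD(2)[OF f(1)] by simp
        have "f (k n) (s (r (k n))) \<le> inverse (real (Suc (r (k n))))" for n
          using as(3)[of "r (k n)"] by (simp add: f_def add.commute less_imp_le)
        then show "\<forall>\<^sub>F n in sequentially. f (k n) (s (r (k n))) \<le> inverse (real (Suc (r (k n))))" by simp
        show "(\<lambda>n. inverse (real (Suc (r (k n))))) \<longlonglongrightarrow> 0"
          using LIMSEQ_subseq_LIMSEQ[OF LIMSEQ_subseq_LIMSEQ[OF LIMSEQ_inverse_real_of_nat r] k] by (simp add: o_def)
      qed
      ultimately have "(\<lambda>n. f (k n) l - f (k n) (s (r (k n))) + f (k n) (s (r (k n)))) \<longlonglongrightarrow> 0 + 0"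
        by (rule tendsto_add)
      then show "(\<lambda>n. f (k n) l) \<longlonglongrightarrow> 0" by simp
    qed
    then have "\<psi> 0 = 0" by (rule solution_zero[OF \<psi>(1,3,2)])
    then show False using \<open>\<delta> \<le> \<psi> 0\<close> \<delta> by simp
  qed
  have "\<exists>c>0. \<exists>T. \<forall>t\<ge>T. c \<le> \<phi> t"
  proof (rule ccontr)
    assume neg: "\<not> ?thesis"
    have "\<exists>a. \<delta> \<le> \<phi> a \<and> (\<forall>s. 0 < s \<longrightarrow> s \<le> real n \<longrightarrow> \<phi> (a + s) \<le> \<delta>)" for n
    proof -
      obtain c where c: "c > 0" "\<And>a s. \<delta> \<le> \<phi> a \<Longrightarrow> 0 \<le> s \<Longrightarrow> s \<le> real n \<Longrightarrow> c \<le> \<phi> (a + s)"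
        using unif_pos[of "real n"] by blast
      obtain t where t: "0 \<le> t" "\<phi> t < c" using neg c(1) by (meson not_le)
      \<comment> \<open>Its supremum is the last time before \<open>t\<close> at height at least
        \<delta>, where the long excursion starts; \<open>\<phi>0\<close> makes the set
        nonempty.\<close>
      define S where "S = {0..t} \<inter> {x. \<delta> \<le> \<phi> x}"
      have "closed S"
        unfolding S_def using cont
        by (intro closed_Int closed_Collect_le continuous_intros) auto
      moreover have "bdd_above S" "S \<noteq> {}" using \<phi>0 t(1) by (auto simp: S_def bdd_above_def)
      ultimately have mem: "Sup S \<in> S" by (intro closed_contains_Sup)
      show ?thesis
      proof (intro exI conjI allI impI)
        show "\<delta> \<le> \<phi> (Sup S)" using mem by (simp add: S_def)
        fix s assume s: "0 < s" "s \<le> real n"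
        \<comment> \<open>Otherwise \<open>t\<close> would come at most \<open>n\<close> after a
          point of height \<delta>, and \<open>c\<close> would bound \<open>\<phi> t\<close> from
          below.\<close>
        have "real n < t - Sup S"
        proof (rule ccontr)
          assume "\<not> real n < t - Sup S"
          then have "c \<le> \<phi> (Sup S + (t - Sup S))" using mem by (intro c(2)) (auto simp: S_def)
          then show False using t(2) by simp
        qed
        then have "Sup S + s \<in> {0..t}" using mem s by (auto simp: S_def)
        moreover have "Sup S + s \<notin> S" using cSup_upper[OF _ \<open>bdd_above S\<close>, of "Sup S + s"] s(1) by auto
        ultimately show "\<phi> (Sup S + s) \<le> \<delta>" by (simp add: S_def)
      qed
    qed
    then obtain a where a: "\<And>n. \<delta> \<le> \<phi> (a n)" "\<And>n s. 0 < s \<Longrightarrow> s \<le> real n \<Longrightarrow> \<phi> (a n + s) \<le> \<delta>"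
      by metis
    define f where "f n t = \<phi> (t + a n)" for n t
    have f: "adm (f n)" "f n t = A (f n) t" for n t
      unfolding f_def using adm_shift[OF adm] A_shift[of \<phi>] sol by auto
    obtain k \<psi> where k: "strict_mono (k :: nat \<Rightarrow> nat)" and \<psi>_lim: "\<And>t. (\<lambda>n. f (k n) t) \<longlonglongrightarrow> \<psi> t"
      and \<psi>: "adm \<psi>" "\<And>t. \<psi> t = A \<psi> t" "continuous_on UNIV \<psi>"
      by (rule solution_compactness[of f]) (rule f | blast)+
    have "\<delta> \<le> \<psi> 0" by (rule LIMSEQ_le_const[OF \<psi>_lim]) (use a(1) in \<open>auto simp: f_def\<close>)
    have "\<psi> t \<le> \<delta>" if t: "1 \<le> t" for t
    proof (rule LIMSEQ_le_const2[OF \<psi>_lim])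
      obtain N where N: "t \<le> real N" using real_arch_simple by blast
      have "f (k n) t \<le> \<delta>" if "n \<ge> N" for n
        using a(2)[of t "k n"] t N that seq_suble[OF k, of n] by (simp add: f_def add.commute)
      then show "\<exists>N. \<forall>n\<ge>N. f (k n) t \<le> \<delta>" by blast
    qed
    moreover have "A \<psi> t \<le> \<psi> t" for t using \<psi>(2)[of t] by simp
    ultimately have "\<psi> (1 + R + 1) = 0" by (intro vanishing_levelD[OF level \<psi>(1,3), of 1]) auto
    then have "\<psi> 0 = 0" by (rule solution_zero[OF \<psi>(1,3,2)])
    then show False using \<open>\<delta> \<le> \<psi> 0\<close> \<delta> by simp
  qed
  then show thesis using that by blast
qed

text \<open>Fixing the height \<delta> at 0 keeps the limit nonzero, and the uniform bound on the
  left mass survives by Fatou. Integrability and uniform continuity then give the decay.\<close>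

lemma emerging_solution:
  assumes level: "vanishing_level \<delta> R" and \<delta>: "0 < \<delta>" and left: "left_mass_level \<delta> R B"
  obtains \<phi> where "adm \<phi>" "\<And>t. \<phi> t = A \<phi> t" "\<phi> 0 = \<delta>" "(\<phi> \<longlongrightarrow> 0) at_bot"
proof -
  obtain \<epsilon>0 where \<epsilon>0: "0 < \<epsilon>0" and ex: "\<And>\<epsilon>. 0 < \<epsilon> \<Longrightarrow> \<epsilon> \<le> \<epsilon>0 \<Longrightarrow> \<exists>\<phi>. adm \<phi> \<and> continuous_on UNIV \<phi> \<and>
       (\<forall>t. \<phi> t = A \<phi> t + \<epsilon> * min 1 (exp (b * t))) \<and> (\<forall>t. \<phi> t \<le> \<epsilon> / (1 - \<beta>) * exp (b * t))"
    by (rule source_solution) blast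
  have one: "\<exists>f. adm f \<and> (\<forall>t. A f t \<le> f t \<and> f t \<le> A f t + \<epsilon>) \<and> f 0 = \<delta> \<and> (\<forall>t\<le>0. f t \<le> \<delta>) \<and>
      (\<integral>\<^sup>+t. ennreal (f t) * indicator {..0} t \<partial>lborel) < \<infinity>"
    if \<epsilon>: "0 < \<epsilon>" "\<epsilon> \<le> \<epsilon>0" for \<epsilon>
  proof -
    obtain \<phi> where \<phi>: "adm \<phi>" "continuous_on UNIV \<phi>"
      and eq: "\<And>t. \<phi> t = A \<phi> t + \<epsilon> * min 1 (exp (b * t))"
      and bound: "\<And>t. \<phi> t \<le> \<epsilon> / (1 - \<beta>) * exp (b * t)"
      using ex[OF \<epsilon>] by blast
    define q where "q = \<epsilon> / (1 - \<beta>)"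
    have q: "0 < q" using \<epsilon>(1) \<beta>(2) by (simp add: q_def)
    have src: "0 < \<epsilon> * min 1 (exp (b * t))" "\<epsilon> * min 1 (exp (b * t)) \<le> \<epsilon>" for t
      using \<epsilon>(1) by (auto simp: min_def)
    have pos: "0 < \<phi> t" for t using eq[of t] A_nonneg[of \<phi> t] src(1)[of t] by linarith
    have super: "A \<phi> t \<le> \<phi> t" "\<phi> t \<le> A \<phi> t + \<epsilon>" for t using eq[of t] src[of t] by linarith+
    \<comment> \<open>Staying below \<delta> would produce a zero by \<open>vanishing_level\<close>,
      while the source keeps \<phi> positive.\<close>
    have "\<exists>t. \<delta> \<le> \<phi> t"
    proof (rule ccontr)
      assume "\<not> ?thesis"
      then have "\<phi> (0 + R + 1) = 0"
        by (intro vanishing_levelD[OF level \<phi> super(1), of 0]) (auto intro: less_imp_le simp: not_le)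
      then show False using pos by (simp add: less_le)
    qed
    then obtain t1 where t1: "\<delta> \<le> \<phi> t1" by blast
    define S where "S = {t. \<delta> \<le> \<phi> t}"
    have "filterlim (\<lambda>t. q * exp (b * t)) (nhds 0) at_bot"
      using b(1) by real_asymp
    then have "\<forall>\<^sub>F t in at_bot. q * exp (b * t) < \<delta>" using \<delta> by (rule order_tendstoD(2))
    then obtain t0 where t0: "\<And>t. t \<le> t0 \<Longrightarrow> q * exp (b * t) < \<delta>"
      by (auto simp: eventually_at_bot_linorder)
    \<comment> \<open>Here the exponential bound provides a first time at height \<delta>: it keeps
      \<open>S\<close> away from a left half-line.\<close>
    have S_ge: "t0 < t" if "t \<in> S" for t
      using t0[of t] bound[of t] that unfolding S_def q_def by force
    have "closed S" unfolding S_def using \<phi>(2) by (intro closed_Collect_le continuous_intros) auto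
    moreover have bdd: "bdd_below S" using S_ge by (auto intro!: bdd_belowI[of _ t0] less_imp_le)
    moreover have "S \<noteq> {}" using t1 by (auto simp: S_def)
    ultimately have mem: "Inf S \<in> S" by (intro closed_contains_Inf)
    define c where "c = Inf S"
    have before: "\<phi> t < \<delta>" if "t < c" for t
    proof (rule ccontr)
      assume "\<not> \<phi> t < \<delta>"
      then have "t \<in> S" by (simp add: S_def)
      then have "Inf S \<le> t" using bdd by (rule cInf_lower)
      then show False using that by (simp add: c_def)
    qed
    have "\<exists>x. t0 \<le> x \<and> x \<le> c \<and> \<phi> x = \<delta>"
    proof (rule IVT')
      show "\<phi> t0 \<le> \<delta>" using t0[of t0] bound[of t0] by (simp add: q_def)
      show "\<delta> \<le> \<phi> c" "t0 \<le> c" using mem S_ge[OF mem] by (auto simp: c_def S_def)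
      show "continuous_on {t0..c} \<phi>" using \<phi>(2) by (rule continuous_on_subset) simp
    qed
    then have c: "\<phi> c = \<delta>" using before by (metis less_le order_less_irrefl)
    define f where "f t = \<phi> (t + c)" for t
    have f_adm: "adm f" unfolding f_def by (rule adm_shift[OF \<phi>(1)])
    have Af: "A f t = A \<phi> (t + c)" for t unfolding f_def by (rule A_shift)
    \<comment> \<open>The factor \<open>q * exp (b * c)\<close> is not bounded uniformly in
      \<epsilon>; only finiteness is extracted from it.\<close>
    have "(\<integral>\<^sup>+t. ennreal (f t) * indicator {..0} t \<partial>lborel) \<le>
        (\<integral>\<^sup>+t. ennreal (q * exp (b * c) * exp (b * t)) * indicator {..0} t \<partial>lborel)"
    proof (intro nn_integral_mono mult_right_mono ennreal_leI)
      fix t show "f t \<le> q * exp (b * c) * exp (b * t)"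
        using bound[of "t + c"] by (simp add: f_def q_def distrib_left exp_add mult_ac)
    qed simp
    also have "\<dots> < \<infinity>" using b(1) q by (intro nn_integral_exp_left_finite) auto
    finally have "(\<integral>\<^sup>+t. ennreal (f t) * indicator {..0} t \<partial>lborel) < \<infinity>" .
    moreover have "f t \<le> \<delta>" if "t \<le> 0" for t
      using before[of "t + c"] c that by (cases "t = 0") (auto simp: f_def intro: less_imp_le)
    moreover have "f 0 = \<delta>" using c by (simp add: f_def)
    moreover have "A f t \<le> f t \<and> f t \<le> A f t + \<epsilon>" for t using super[of "t + c"] by (simp add: Af) (simp add: f_def)
    ultimately show ?thesis using f_adm by blast
  qed
  define \<epsilon> where "\<epsilon> n = \<epsilon>0 / real (Suc n)" for n
  have \<epsilon>: "0 < \<epsilon> n" "\<epsilon> n \<le> \<epsilon>0" for n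
    using \<epsilon>0 by (auto simp: \<epsilon>_def divide_le_eq mult_le_cancel_left1)
  have "\<forall>n. \<exists>f. adm f \<and> (\<forall>t. A f t \<le> f t \<and> f t \<le> A f t + \<epsilon> n) \<and> f 0 = \<delta> \<and> (\<forall>t\<le>0. f t \<le> \<delta>) \<and>
      (\<integral>\<^sup>+t. ennreal (f t) * indicator {..0} t \<partial>lborel) < \<infinity>"
    using one[OF \<epsilon>] by blast
  from choice[OF this] obtain f where f_adm: "\<And>n. adm (f n)"
    and f_super: "\<And>n t. A (f n) t \<le> f n t" and f_upper: "\<And>n t. f n t \<le> A (f n) t + \<epsilon> n"
    and f0: "\<And>n. f n 0 = \<delta>" and f_small: "\<And>n t. t \<le> 0 \<Longrightarrow> f n t \<le> \<delta>"
    and f_fin: "\<And>n. (\<integral>\<^sup>+t. ennreal (f n t) * indicator {..0} t \<partial>lborel) < \<infinity>"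
    by blast
  have f_mass: "(\<integral>\<^sup>+t. ennreal (f n t) * indicator {..- 2 * R} t \<partial>lborel) \<le> ennreal B" for n
    using left f_adm f_super f_small f_fin unfolding left_mass_level_def by blast
  have lim0: "(\<lambda>n. f n t - A (f n) t) \<longlonglongrightarrow> 0" for t
  proof (rule tendsto_sandwich[OF _ _ tendsto_const])
    show "\<epsilon> \<longlonglongrightarrow> 0" unfolding \<epsilon>_def using LIMSEQ_Suc[OF lim_const_over_n[of \<epsilon>0]] by simp
    show "\<forall>\<^sub>F n in sequentially. 0 \<le> f n t - A (f n) t" using f_super by simp
    show "\<forall>\<^sub>F n in sequentially. f n t - A (f n) t \<le> \<epsilon> n"
      using f_upper[of _ t] by (intro always_eventually allI) (simp add: algebra_simps)
  qed
  obtain k \<phi> where k: "strict_mono (k :: nat \<Rightarrow> nat)" and lim: "\<And>t. (\<lambda>n. f (k n) t) \<longlonglongrightarrow> \<phi> t"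
    and \<phi>: "adm \<phi>" "\<And>t. \<phi> t = A \<phi> t + 0" "continuous_on UNIV \<phi>"
    by (rule compactness[of f "\<lambda>_. 0"]) (rule f_adm continuous_on_const lim0 | blast)+
  have sol: "\<phi> t = A \<phi> t" for t using \<phi>(2)[of t] by simp
  have [measurable]: "f n \<in> borel_measurable borel" "\<phi> \<in> borel_measurable borel" for n
    using admD(1)[OF f_adm] admD(1)[OF \<phi>(1)] by auto
  have "\<phi> 0 = \<delta>" using lim[of 0] by (simp add: f0 LIMSEQ_const_iff)
  have "(\<integral>\<^sup>+t. ennreal (\<phi> t) * indicator {..- 2 * R} t \<partial>lborel) =
      (\<integral>\<^sup>+t. liminf (\<lambda>n. ennreal (f (k n) t) * indicator {..- 2 * R} t) \<partial>lborel)"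
  proof (rule nn_integral_cong)
    fix t
    have "(\<lambda>n. ennreal (f (k n) t) * indicator {..- 2 * R} t) \<longlonglongrightarrow> ennreal (\<phi> t) * indicator {..- 2 * R} t"
      using lim[of t] by (cases "t \<le> - 2 * R") auto
    then show "ennreal (\<phi> t) * indicator {..- 2 * R} t = liminf (\<lambda>n. ennreal (f (k n) t) * indicator {..- 2 * R} t)"
      by (intro lim_imp_Liminf[symmetric]) auto
  qed
  also have "\<dots> \<le> liminf (\<lambda>n. \<integral>\<^sup>+t. ennreal (f (k n) t) * indicator {..- 2 * R} t \<partial>lborel)"
    by (rule nn_integral_liminf) measurable
  also have "\<dots> \<le> limsup (\<lambda>n. \<integral>\<^sup>+t. ennreal (f (k n) t) * indicator {..- 2 * R} t \<partial>lborel)"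
    by (rule Liminf_le_Limsup) simp
  also have "\<dots> \<le> ennreal B"
    by (rule Limsup_bounded) (use f_mass in simp)
  finally have fin: "(\<integral>\<^sup>+t. ennreal (\<phi> t) * indicator {..- 2 * R} t \<partial>lborel) < \<infinity>"
    by (simp add: order_le_less_trans)
  have "(\<phi> \<longlongrightarrow> 0) at_bot"
  proof (rule tendsto_at_bot_0_of_integrable[OF admD(1)[OF \<phi>(1)] admD(2)[OF \<phi>(1)] _ fin])
    fix e :: real assume "0 < e"
    from A_equicontinuous[OF this] obtain d where "d > 0"
      "\<forall>f x y. adm f \<longrightarrow> \<bar>x - y\<bar> < d \<longrightarrow> \<bar>A f x - A f y\<bar> < e" by blast
    then have "d > 0 \<and> (\<forall>x y. \<bar>x - y\<bar> < d \<longrightarrow> \<bar>\<phi> x - \<phi> y\<bar> < e)" using \<phi>(1) by (auto simp flip: sol)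
    then show "\<exists>d>0. \<forall>x y. \<bar>x - y\<bar> < d \<longrightarrow> \<bar>\<phi> x - \<phi> y\<bar> < e" by blast
  qed
  then show thesis using that \<phi>(1) sol \<open>\<phi> 0 = \<delta>\<close> by blast
qed

subsection \<open>Asymptotic values\<close>

text \<open>This turns an asymptotic value of \<phi> into one attained at 0 by a solution whose
  values stay in the asymptotic range at all times.\<close>

lemma limit_translate:
  assumes adm: "adm \<phi>" and sol: "\<And>t. \<phi> t = A \<phi> t"
    and t: "filterlim t at_top sequentially" and lim: "(\<lambda>n. \<phi> (t n)) \<longlonglongrightarrow> w"
    and lower: "\<And>y. y < u \<Longrightarrow> \<forall>\<^sub>F x in at_top. y < \<phi> x" and upper: "\<And>y. v < y \<Longrightarrow> \<forall>\<^sub>F x in at_top. \<phi> x < y"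
  obtains \<psi> where "adm \<psi>" "\<And>s. \<psi> s = A \<psi> s" "\<psi> 0 = w" "\<And>s. u \<le> \<psi> s" "\<And>s. \<psi> s \<le> v"
proof -
  define f where "f n s = \<phi> (s + t n)" for n s
  have f: "adm (f n)" "f n s = A (f n) s" for n s
    unfolding f_def using adm_shift[OF adm] A_shift[of \<phi>] sol by auto
  obtain k \<psi> where k: "strict_mono (k :: nat \<Rightarrow> nat)" and \<psi>_lim: "\<And>s. (\<lambda>n. f (k n) s) \<longlonglongrightarrow> \<psi> s"
    and \<psi>: "adm \<psi>" "\<And>s. \<psi> s = A \<psi> s" "continuous_on UNIV \<psi>"
    by (rule solution_compactness[of f]) (rule f | blast)+
  have "filterlim (\<lambda>n. t (k n)) at_top sequentially"
    using filterlim_compose[OF t filterlim_subseq[OF k]] .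
  then have far: "filterlim (\<lambda>n. s + t (k n)) at_top sequentially" for s
    by (rule filterlim_tendsto_add_at_top[OF tendsto_const])
  have "\<psi> 0 = w"
  proof (rule LIMSEQ_unique[OF \<psi>_lim])
    show "(\<lambda>n. f (k n) 0) \<longlonglongrightarrow> w" using LIMSEQ_subseq_LIMSEQ[OF lim k] by (simp add: f_def o_def)
  qed
  moreover have "u \<le> \<psi> s" for s
  proof (rule dense_le)
    fix y assume "y < u"
    have "\<forall>\<^sub>F n in sequentially. y < \<phi> (s + t (k n))"
      using filterlim_iff[THEN iffD1, OF far[of s]] lower[OF \<open>y < u\<close>] by blast
    then show "y \<le> \<psi> s"
      by (intro tendsto_lowerbound[OF \<psi>_lim]) (auto simp: f_def elim!: eventually_mono)
  qed
  moreover have "\<psi> s \<le> v" for s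
  proof (rule dense_ge)
    fix y assume "v < y"
    have "\<forall>\<^sub>F n in sequentially. \<phi> (s + t (k n)) < y"
      using filterlim_iff[THEN iffD1, OF far[of s]] upper[OF \<open>v < y\<close>] by blast
    then show "\<psi> s \<le> y"
      by (intro tendsto_upperbound[OF \<psi>_lim]) (auto simp: f_def elim!: eventually_mono)
  qed
  ultimately show thesis using that[OF \<psi>(1,2)] by blast
qed

text \<open>\<open>u\<close> and \<open>v\<close> are the lower and upper limits of \<phi> at
  infinity. Each is attained by a limit of translates with values in [u, v], to which
  \<open>solution_extremal\<close> applies.\<close>

lemma limit_interval:
  assumes adm: "adm \<phi>" and sol: "\<And>t. \<phi> t = A \<phi> t" and c: "0 < c" "\<And>t. T \<le> t \<Longrightarrow> c \<le> \<phi> t"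
  obtains u v where "0 < u" "v \<le> \<zeta>2" "\<exists>p\<in>{u..v}. G p \<le> u" "\<exists>p\<in>{u..v}. v \<le> G p"
    "\<And>y. y < u \<Longrightarrow> \<forall>\<^sub>F x in at_top. y < \<phi> x" "\<And>y. v < y \<Longrightarrow> \<forall>\<^sub>F x in at_top. \<phi> x < y"
proof -
  define lo where "lo = Liminf at_top (\<lambda>t. ereal (\<phi> t))"
  define hi where "hi = Limsup at_top (\<lambda>t. ereal (\<phi> t))"
  have "ereal c \<le> lo"
    unfolding lo_def by (rule Liminf_bounded) (use c(2) in \<open>auto simp: eventually_at_top_linorder\<close>)
  moreover have "hi \<le> ereal \<zeta>2"
    unfolding hi_def by (rule Limsup_bounded) (use admD(3)[OF adm] in simp)
  moreover have "lo \<le> hi" unfolding lo_def hi_def by (rule Liminf_le_Limsup) simp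
  ultimately have fin: "\<bar>lo\<bar> \<noteq> \<infinity>" "\<bar>hi\<bar> \<noteq> \<infinity>" by auto
  define u v where "u = real_of_ereal lo" and "v = real_of_ereal hi"
  have lo: "lo = ereal u" and hi: "hi = ereal v" using fin by (simp_all add: u_def v_def ereal_real)
  have u: "0 < u" using \<open>ereal c \<le> lo\<close> c(1) by (simp add: lo)
  have v: "v \<le> \<zeta>2" using \<open>hi \<le> ereal \<zeta>2\<close> by (simp add: hi)
  have lower: "\<forall>\<^sub>F x in at_top. y < \<phi> x" if "y < u" for y
    using less_LiminfD[of "ereal y" at_top "\<lambda>t. ereal (\<phi> t)"] that by (simp flip: lo_def add: lo)
  have upper: "\<forall>\<^sub>F x in at_top. \<phi> x < y" if "v < y" for y
    using Limsup_lessD[of at_top "\<lambda>t. ereal (\<phi> t)" "ereal y"] that by (simp flip: hi_def add: hi)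
  have seq: "\<exists>t. filterlim t at_top sequentially \<and> (\<lambda>n. \<phi> (t n)) \<longlonglongrightarrow> w"
    if freq: "\<And>e X. 0 < e \<Longrightarrow> \<exists>x\<ge>X. \<bar>\<phi> x - w\<bar> < e" for w
  proof -
    have "\<forall>n. \<exists>x\<ge>real n. \<bar>\<phi> x - w\<bar> < inverse (real (Suc n))" using freq by simp
    then obtain t where t: "\<And>n. real n \<le> t n" "\<And>n. \<bar>\<phi> (t n) - w\<bar> < inverse (real (Suc n))" by metis
    have "filterlim t at_top sequentially"
      by (rule filterlim_at_top_mono[OF filterlim_real_sequentially]) (simp add: t(1))
    moreover have "(\<lambda>n. \<phi> (t n) - w) \<longlonglongrightarrow> 0"
    proof (rule tendsto_rabs_zero_cancel, rule tendsto_sandwich[OF _ _ tendsto_const])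
      show "\<forall>\<^sub>F n in sequentially. \<bar>\<phi> (t n) - w\<bar> \<le> inverse (real (Suc n))"
        using t(2) by (intro always_eventually allI less_imp_le)
    qed (use LIMSEQ_inverse_real_of_nat in auto)
    then have "(\<lambda>n. \<phi> (t n)) \<longlonglongrightarrow> w" by (rule LIM_zero_cancel)
    ultimately show ?thesis by blast
  qed
  have "\<exists>x\<ge>X. \<bar>\<phi> x - u\<bar> < e" if e: "0 < e" for e X
  proof (rule ccontr)
    assume neg: "\<not> ?thesis"
    have "\<forall>\<^sub>F x in at_top. u - e < \<phi> x" using e by (intro lower) simp
    moreover have "\<forall>\<^sub>F x in at_top. X \<le> x" by (rule eventually_ge_at_top)
    ultimately have "\<forall>\<^sub>F x in at_top. ereal (u + e) \<le> ereal (\<phi> x)"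
      by eventually_elim (use neg in \<open>force simp: not_less abs_le_iff\<close>)
    then have "ereal (u + e) \<le> lo" unfolding lo_def by (rule Liminf_bounded)
    then show False using e by (simp add: lo)
  qed
  from seq[OF this] obtain t where t: "filterlim t at_top sequentially" "(\<lambda>n. \<phi> (t n)) \<longlonglongrightarrow> u" by blast
  obtain \<psi> where \<psi>: "adm \<psi>" "\<And>s. \<psi> s = A \<psi> s" "\<psi> 0 = u" "\<And>s. u \<le> \<psi> s" "\<And>s. \<psi> s \<le> v"
    by (rule limit_translate[OF adm sol t lower upper]) blast+
  have 1: "\<exists>p\<in>{u..v}. G p \<le> u"
    using u by (intro solution_extremal(1)[OF \<psi>(1) \<psi>(2)[of 0] \<psi>(4,5) _ v \<psi>(3)]) simp
  have "\<exists>x\<ge>X. \<bar>\<phi> x - v\<bar> < e" if e: "0 < e" for e X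
  proof (rule ccontr)
    assume neg: "\<not> ?thesis"
    have "\<forall>\<^sub>F x in at_top. \<phi> x < v + e" using e by (intro upper) simp
    moreover have "\<forall>\<^sub>F x in at_top. X \<le> x" by (rule eventually_ge_at_top)
    ultimately have "\<forall>\<^sub>F x in at_top. ereal (\<phi> x) \<le> ereal (v - e)"
      by eventually_elim (use neg in \<open>force simp: not_less abs_le_iff\<close>)
    then have "hi \<le> ereal (v - e)" unfolding hi_def by (rule Limsup_bounded)
    then show False using e by (simp add: hi)
  qed
  from seq[OF this] obtain t' where t': "filterlim t' at_top sequentially" "(\<lambda>n. \<phi> (t' n)) \<longlonglongrightarrow> v" by blast
  obtain \<psi>' where \<psi>': "adm \<psi>'" "\<And>s. \<psi>' s = A \<psi>' s" "\<psi>' 0 = v" "\<And>s. u \<le> \<psi>' s" "\<And>s. \<psi>' s \<le> v"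
    by (rule limit_translate[OF adm sol t' lower upper]) blast+
  have 2: "\<exists>p\<in>{u..v}. v \<le> G p"
    using u by (intro solution_extremal(2)[OF \<psi>'(1) \<psi>'(2)[of 0] \<psi>'(4,5) _ v \<psi>'(3)]) simp
  show thesis by (rule that[OF u v 1 2]) (rule lower upper, assumption)+
qed

text \<open>With a single positive fixed point, \<open>G s - s\<close> keeps its sign on either side
  of \<kappa>. The sign is read off at \<zeta>1 on the left, and at \<zeta>2 on the right, since
  \<open>G\<close> takes values in [0, \<zeta>2].\<close>

lemma fixed_point_dynamics:
  assumes \<kappa>: "0 < \<kappa>" "{s. 0 \<le> s \<and> G s = s} = {0, \<kappa>}"
  shows "G \<kappa> = \<kappa>" "\<kappa> \<le> \<zeta>2" and "\<And>s. 0 < s \<Longrightarrow> s < \<kappa> \<Longrightarrow> s < G s" and "\<And>s. \<kappa> < s \<Longrightarrow> s \<le> \<zeta>2 \<Longrightarrow> G s < s"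
proof -
  have fixed: "s = \<kappa>" if "0 < s" "G s = s" for s
  proof -
    have "s \<in> {0, \<kappa>}" unfolding \<kappa>(2)[symmetric] using that by simp
    then show ?thesis using that(1) by simp
  qed
  have "\<kappa> \<in> {s. 0 \<le> s \<and> G s = s}" unfolding \<kappa>(2) by simp
  then show G\<kappa>: "G \<kappa> = \<kappa>" by simp
  show "\<kappa> \<le> \<zeta>2" using Theta_G(2)[of \<kappa>] \<kappa>(1) G\<kappa> by simp
  have cont: "continuous_on {x..y} (\<lambda>w. G w - w)" if "0 \<le> x" for x y
    using that by (intro continuous_intros continuous_on_subset[OF G_continuous]) auto
  show "s < G s" if s: "0 < s" "s < \<kappa>" for s
  proof (rule ccontr)
    assume "\<not> s < G s"
    then have le: "G s \<le> s" by simp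
    then have "\<zeta>1 \<le> s" using G_above[of s] s(1) by force
    obtain y where "\<zeta>1 \<le> y" "y \<le> s" "G y - y = 0"
      using IVT2'[of "\<lambda>w. G w - w" s 0 \<zeta>1] le G_above[of \<zeta>1] \<zeta>1(1) \<open>\<zeta>1 \<le> s\<close> cont by force
    then show False using fixed[of y] \<zeta>1(1) s by simp
  qed
  show "G s < s" if s: "\<kappa> < s" "s \<le> \<zeta>2" for s
  proof (rule ccontr)
    assume "\<not> G s < s"
    then have le: "s \<le> G s" by simp
    have "G \<zeta>2 \<le> \<zeta>2" using Theta_G(2)[of \<zeta>2] \<zeta>2 by simp
    then obtain y where "s \<le> y" "y \<le> \<zeta>2" "G y - y = 0"
      using IVT2'[of "\<lambda>w. G w - w" \<zeta>2 0 s] le s \<kappa>(1) cont by force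
    then show False using fixed[of y] s \<kappa>(1) by simp
  qed
qed

lemma front_exists:
  "\<exists>\<phi>. semi_wavefront M K g \<phi> \<and> (\<phi> \<longlongrightarrow> 0) at_bot \<and> (\<forall>s. \<phi> s \<le> \<zeta>2) \<and>
     (\<exists>c>\<zeta>1. \<forall>\<^sub>F t in at_top. c \<le> \<phi> t) \<and>
     (\<forall>\<kappa>. 0 < \<kappa> \<and> {s. 0 \<le> s \<and> G s = s} = {0, \<kappa>} \<and> (\<forall>s \<in> {0<..\<zeta>2}. (\<lambda>n. (G ^^ n) s) \<longlonglongrightarrow> \<kappa>)
        \<longrightarrow> (\<phi> \<longlongrightarrow> \<kappa>) at_top)"
proof -
  obtain \<delta> R B where \<delta>: "0 < \<delta>" and level: "vanishing_level \<delta> R" "left_mass_level \<delta> R B"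
    by (rule small_level)
  obtain \<phi> where \<phi>: "adm \<phi>" "\<And>t. \<phi> t = A \<phi> t" "\<phi> 0 = \<delta>" "(\<phi> \<longlongrightarrow> 0) at_bot"
    by (rule emerging_solution[OF level(1) \<delta> level(2)]) (rule that)
  have cont: "continuous_on UNIV \<phi>" by (rule solution_continuous[OF \<phi>(1,2)])
  have pos: "0 < \<phi> t" for t
  proof (rule ccontr)
    assume "\<not> 0 < \<phi> t"
    then have "\<phi> t = 0" using admD(2)[OF \<phi>(1), of t] by simp
    then have "\<phi> 0 = 0" by (rule solution_zero[OF \<phi>(1) cont \<phi>(2)])
    then show False using \<phi>(3) \<delta> by simp
  qed
  have "is_solution M K g \<phi>"
    unfolding is_solution_def conv_def[symmetric]
    using cont admD(2)[OF \<phi>(1)] ennreal_A[OF \<phi>(1)] by (simp flip: \<phi>(2))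
  moreover have "bounded (range \<phi>)"
    using admD(2,3)[OF \<phi>(1)] by (intro boundedI[of _ \<zeta>2]) auto
  ultimately have wave: "semi_wavefront M K g \<phi>" using pos \<phi>(4) by (simp add: semi_wavefront_def)
  obtain c T where "0 < c" "\<And>t. T \<le> t \<Longrightarrow> c \<le> \<phi> t"
    by (rule persistence[OF level(1) \<delta> \<phi>(1,2)]) (use \<phi>(3) in auto)
  then obtain u v where u: "0 < u" and v: "v \<le> \<zeta>2"
    and p: "\<exists>p\<in>{u..v}. G p \<le> u" and p': "\<exists>p\<in>{u..v}. v \<le> G p"
    and lower: "\<And>y. y < u \<Longrightarrow> \<forall>\<^sub>F x in at_top. y < \<phi> x" and upper: "\<And>y. v < y \<Longrightarrow> \<forall>\<^sub>F x in at_top. \<phi> x < y"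
    by (rule limit_interval[OF \<phi>(1,2)]) (assumption | blast)+
  \<comment> \<open>Suppose u <= \<zeta>1 and take \<open>p\<close> with G p <= u. If p <= \<zeta>1,
    then G p > p >= u; if p > \<zeta>1, then G p >= G \<zeta>1 > \<zeta>1 >= u.\<close>
  have "\<zeta>1 < u"
  proof (rule ccontr)
    assume "\<not> \<zeta>1 < u"
    obtain p where p: "p \<in> {u..v}" "G p \<le> u" using p by blast
    show False
    proof (cases "p \<le> \<zeta>1")
      case True
      then show False using G_above[of p] p u by simp
    next
      case False
      then have "G \<zeta>1 \<le> G p" using p v by (intro G_min) auto
      moreover have "\<zeta>1 < G \<zeta>1" using \<zeta>1 by (intro G_above) auto
      ultimately show False using p \<open>\<not> \<zeta>1 < u\<close> by simp
    qed
  qed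
  \<comment> \<open>The midpoint leaves a gap above \<zeta>1, which yields the strict inequality for
    the lower limit.\<close>
  then have "\<exists>c>\<zeta>1. \<forall>\<^sub>F t in at_top. c \<le> \<phi> t"
    using lower[of "(\<zeta>1 + u) / 2"] by (intro exI[of _ "(\<zeta>1 + u) / 2"]) (auto elim: eventually_mono)
  moreover have "(\<phi> \<longlongrightarrow> \<kappa>) at_top"
    if \<kappa>: "0 < \<kappa>" "{s. 0 \<le> s \<and> G s = s} = {0, \<kappa>}" "\<forall>s \<in> {0<..\<zeta>2}. (\<lambda>n. (G ^^ n) s) \<longlonglongrightarrow> \<kappa>" for \<kappa>
  proof -
    note dyn = fixed_point_dynamics[OF \<kappa>(1,2)]
    obtain p where p: "p \<in> {u..v}" "G p \<le> u" using p by blast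
    obtain p' where p': "p' \<in> {u..v}" "v \<le> G p'" using p' by blast
    have cont: "continuous_on {0..\<zeta>2} G" by (rule continuous_on_subset[OF G_continuous]) auto
    have maps: "0 < G s \<and> G s \<le> \<zeta>2" if "0 < s" for s using G_pos[OF that] Theta_G(2)[of s] that by simp
    have "u = \<kappa>" "v = \<kappa>"
      by (rule globally_attracting_interval[OF cont _ dyn(3,4) \<kappa>(1) dyn(2,1) _ u v p p'];
        use maps \<kappa>(3) in simp)+
    then show ?thesis using lower upper by (intro order_tendstoI) auto
  qed
  ultimately show ?thesis using wave \<phi>(4) admD(3)[OF \<phi>(1)] by blast
qed

end

section \<open>Reflection of time and the theorem\<close>

lemma kernel_integral_reflect:
  fixes K :: "real \<Rightarrow> 'a \<Rightarrow> real" and h :: "real \<Rightarrow> real"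
  assumes K: "(\<lambda>(s, \<tau>). K s \<tau>) \<in> borel_measurable (lborel \<Otimes>\<^sub>M M)" and \<tau>: "\<tau> \<in> space M"
    and h: "h \<in> borel_measurable borel"
  shows "(\<integral>\<^sup>+ s. ennreal (K (- s) \<tau> * h s) \<partial>lborel) = (\<integral>\<^sup>+ s. ennreal (K s \<tau> * h (- s)) \<partial>lborel)"
proof -
  have [measurable]: "(\<lambda>s. K s \<tau>) \<in> borel_measurable borel"
    using measurable_Pair1[OF K \<tau>] by simp
  note [measurable] = h
  show ?thesis
    using nn_integral_reflect[of "\<lambda>s. ennreal (K s \<tau> * h (- s))" 0] by simp
qed

theorem theorem1p7:
  fixes M :: "'a measure" and K :: "real \<Rightarrow> 'a \<Rightarrow> real" and g :: "real \<Rightarrow> 'a \<Rightarrow> real"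
    and gd :: "'a \<Rightarrow> real" and \<tau>0 :: 'a and \<zeta>1 \<zeta>2 :: real
  assumes fin: "finite_measure M"
    and K_meas: "(\<lambda>(s, \<tau>). K s \<tau>) \<in> borel_measurable (lborel \<Otimes>\<^sub>M M)"
    and K_nonneg: "\<And>s \<tau>. \<tau> \<in> space M \<Longrightarrow> 0 \<le> K s \<tau>"
    and K_int: "integrable (lborel \<Otimes>\<^sub>M M) (\<lambda>(s, \<tau>). K s \<tau>)"
    and K_pos: "\<And>\<tau>. \<tau> \<in> space M \<Longrightarrow> 0 < (\<integral>\<^sup>+ s. ennreal (K s \<tau>) \<partial>lborel)"
    and g_meas: "(\<lambda>(v, \<tau>). g v \<tau>) \<in> borel_measurable (borel \<Otimes>\<^sub>M M)"
    and g_nonneg: "\<And>v \<tau>. \<tau> \<in> space M \<Longrightarrow> 0 \<le> v \<Longrightarrow> 0 \<le> g v \<tau>"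
    and g_zero: "\<And>\<tau>. \<tau> \<in> space M \<Longrightarrow> g 0 \<tau> = 0"
    and g_cont: "\<And>\<tau>. \<tau> \<in> space M \<Longrightarrow> continuous_on {0..} (\<lambda>v. g v \<tau>)"
    and g_deriv: "\<And>\<tau>. \<tau> \<in> space M \<Longrightarrow> ((\<lambda>v. g v \<tau>) has_real_derivative gd \<tau>) (at 0 within {0..})"
    and gd_pos: "\<And>\<tau>. \<tau> \<in> space M \<Longrightarrow> 0 < gd \<tau>"
    and N: "condN M K g \<tau>0 \<zeta>2"
    and G_diff: "Gmap M K g \<tau>0 \<zeta>2 differentiable (at 0 within {0..})"
    and g_sub: "\<And>s \<tau>. \<tau> \<in> space M \<Longrightarrow> 0 \<le> s \<Longrightarrow> g s \<tau> \<le> gd \<tau> * s"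
    and \<zeta>1: "0 < \<zeta>1" "\<zeta>1 < \<zeta>2"
    and G_inv: "Gmap M K g \<tau>0 \<zeta>2 ` {\<zeta>1..\<zeta>2} \<subseteq> {\<zeta>1..\<zeta>2}"
    and G_min: "\<And>s. s \<in> {\<zeta>1..\<zeta>2} \<Longrightarrow> Gmap M K g \<tau>0 \<zeta>2 \<zeta>1 \<le> Gmap M K g \<tau>0 \<zeta>2 s"
    and G_above: "\<And>s. s \<in> {0<..\<zeta>1} \<Longrightarrow> s < Gmap M K g \<tau>0 \<zeta>2 s"
    and chi0: "chi_defined M K gd 0" "chi M K gd 0 < 0"
  shows
    "((\<exists>\<omega>>0. (\<forall>z \<in> {0<..<\<omega>}. chi_defined M K gd z) \<and>
            (\<exists>a \<in> {0<..<\<omega>}. chi M K gd a < 0) \<and> (\<exists>b \<in> {0<..<\<omega>}. 0 < chi M K gd b))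
      \<longrightarrow> (\<exists>\<phi>. semi_wavefront M K g \<phi> \<and> (\<phi> \<longlongrightarrow> 0) at_bot \<and>
               (\<forall>s. \<phi> s \<le> \<zeta>2) \<and> ereal \<zeta>1 < Liminf at_top (\<lambda>t. ereal (\<phi> t)) \<and>
               (\<forall>\<kappa>. (0 < \<kappa> \<and> {s. 0 \<le> s \<and> Gmap M K g \<tau>0 \<zeta>2 s = s} = {0, \<kappa>} \<and>
                     (\<forall>s \<in> {0<..\<zeta>2}. (\<lambda>n. (Gmap M K g \<tau>0 \<zeta>2 ^^ n) s) \<longlonglongrightarrow> \<kappa>))
                    \<longrightarrow> (\<phi> \<longlongrightarrow> \<kappa>) at_top))) \<and>
     ((\<exists>\<omega>>0. (\<forall>z \<in> {-\<omega><..<0}. chi_defined M K gd z) \<and>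
            (\<exists>a \<in> {-\<omega><..<0}. chi M K gd a < 0) \<and> (\<exists>b \<in> {-\<omega><..<0}. 0 < chi M K gd b))
      \<longrightarrow> (\<exists>\<phi>. semi_wavefront M K g \<phi> \<and> (\<phi> \<longlongrightarrow> 0) at_top \<and>
               (\<forall>s. \<phi> s \<le> \<zeta>2) \<and> ereal \<zeta>1 < Liminf at_bot (\<lambda>t. ereal (\<phi> t)) \<and>
               (\<forall>\<kappa>. (0 < \<kappa> \<and> {s. 0 \<le> s \<and> Gmap M K g \<tau>0 \<zeta>2 s = s} = {0, \<kappa>} \<and>
                     (\<forall>s \<in> {0<..\<zeta>2}. (\<lambda>n. (Gmap M K g \<tau>0 \<zeta>2 ^^ n) s) \<longlonglongrightarrow> \<kappa>))
                    \<longrightarrow> (\<phi> \<longlongrightarrow> \<kappa>) at_bot)))"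
proof -
  have chi_0: "chi_int M K gd 0 < \<infinity>" "1 < chi_int M K gd 0"
  proof -
    show *: "chi_int M K gd 0 < \<infinity>" using chi0(1) by (simp add: chi_defined_def)
    then have "chi_int M K gd 0 = ennreal (enn2real (chi_int M K gd 0))" by simp
    moreover have "1 < enn2real (chi_int M K gd 0)" using chi0(2) by (simp add: chi_def)
    ultimately show "1 < chi_int M K gd 0" by (metis ennreal_1 ennreal_less_iff zero_le_one)
  qed
  have chi_int_less: "chi_int M K gd z < 1" if "chi_defined M K gd z" "0 < chi M K gd z" for z
  proof -
    have "chi_int M K gd z = ennreal (enn2real (chi_int M K gd z))"
      using that(1) by (simp add: chi_defined_def)
    moreover have "enn2real (chi_int M K gd z) < 1" using that(2) by (simp add: chi_def)
    ultimately show ?thesis by (metis ennreal_1 ennreal_less_iff enn2real_nonneg)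
  qed
  have liminf: "ereal \<zeta>1 < Liminf F (\<lambda>t. ereal (\<phi> t))" if "\<zeta>1 < c" "\<forall>\<^sub>F t in F. c \<le> \<phi> t" for c F and \<phi> :: "real \<Rightarrow> real"
  proof -
    have "ereal c \<le> Liminf F (\<lambda>t. ereal (\<phi> t))" using that(2) by (intro Liminf_bounded) simp
    then show ?thesis by (rule less_le_trans[rotated]) (simp add: that(1))
  qed
  show ?thesis
  proof (intro conjI impI)
    assume "\<exists>\<omega>>0. (\<forall>z \<in> {0<..<\<omega>}. chi_defined M K gd z) \<and>
            (\<exists>a \<in> {0<..<\<omega>}. chi M K gd a < 0) \<and> (\<exists>b \<in> {0<..<\<omega>}. 0 < chi M K gd b)"
    then obtain b where b: "0 < b" "chi_defined M K gd b" "0 < chi M K gd b" by auto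
    interpret semiwavefront_data M K g gd \<tau>0 \<zeta>1 \<zeta>2 b
      by (intro semiwavefront_data.intro semiwavefront_data_axioms.intro fin)
        (fact K_meas K_nonneg K_pos g_meas g_nonneg g_zero g_cont g_deriv gd_pos N g_sub \<zeta>1 G_min G_above
          chi_0 b(1) chi_int_less[OF b(2,3)])+
    show "\<exists>\<phi>. semi_wavefront M K g \<phi> \<and> (\<phi> \<longlongrightarrow> 0) at_bot \<and>
               (\<forall>s. \<phi> s \<le> \<zeta>2) \<and> ereal \<zeta>1 < Liminf at_top (\<lambda>t. ereal (\<phi> t)) \<and>
               (\<forall>\<kappa>. (0 < \<kappa> \<and> {s. 0 \<le> s \<and> Gmap M K g \<tau>0 \<zeta>2 s = s} = {0, \<kappa>} \<and>
                     (\<forall>s \<in> {0<..\<zeta>2}. (\<lambda>n. (Gmap M K g \<tau>0 \<zeta>2 ^^ n) s) \<longlonglongrightarrow> \<kappa>))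
                    \<longrightarrow> (\<phi> \<longlongrightarrow> \<kappa>) at_top)"
      using front_exists liminf by blast
  next
    assume "\<exists>\<omega>>0. (\<forall>z \<in> {-\<omega><..<0}. chi_defined M K gd z) \<and>
            (\<exists>a \<in> {-\<omega><..<0}. chi M K gd a < 0) \<and> (\<exists>b \<in> {-\<omega><..<0}. 0 < chi M K gd b)"
    then obtain b where b: "b < 0" "chi_defined M K gd b" "0 < chi M K gd b" by auto
    \<comment> \<open>Reflecting time in the equation reflects the kernel and changes \<chi>(z) into
      \<chi>(-z), so \<open>- b\<close> takes the part of \<open>b\<close>. The map \<open>G\<close>
      is unchanged because it sees \<open>K\<close> only through its integrals over
      \<open>s\<close>.\<close>
    define K' where "K' s = K (- s)" for s
    note reflect = kernel_integral_reflect[OF K_meas]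
    have K'_int: "(\<integral>\<^sup>+ s. ennreal (K' s \<tau>) \<partial>lborel) = (\<integral>\<^sup>+ s. ennreal (K s \<tau>) \<partial>lborel)" if "\<tau> \<in> space M" for \<tau>
      using reflect[OF that, of "\<lambda>_. 1"] by (simp add: K'_def)
    have chi': "chi_int M K' gd z = chi_int M K gd (- z)" for z
      unfolding chi_int_def K'_def
    proof (rule nn_integral_cong)
      fix \<tau> assume \<tau>: "\<tau> \<in> space M"
      show "(\<integral>\<^sup>+ s. ennreal (K (- s) \<tau> * gd \<tau> * exp (- s * z)) \<partial>lborel) =
        (\<integral>\<^sup>+ s. ennreal (K s \<tau> * gd \<tau> * exp (- s * - z)) \<partial>lborel)"
        using reflect[OF \<tau>, of "\<lambda>s. gd \<tau> * exp (- s * z)"] by (simp add: mult.assoc)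
    qed
    have tilde': "tilde_g M K' g \<tau>0 = tilde_g M K g \<tau>0"
      unfolding tilde_g_def by (intro ext nn_integral_cong) (simp add: K'_int)
    have C': "Cconst K' \<tau>0 = Cconst K \<tau>0"
      using lborel_integral_real_affine[of "-1" "\<lambda>s. K s \<tau>0" 0] by (simp add: Cconst_def K'_def)
    have Theta': "Theta M K' g \<tau>0 = Theta M K g \<tau>0"
      by (simp add: Theta_def[abs_def] tilde')
    have G': "Gmap M K' g \<tau>0 \<zeta>2 = Gmap M K g \<tau>0 \<zeta>2"
      by (simp add: Gmap_def[abs_def] Theta' C')
    have N': "condN M K' g \<tau>0 \<zeta>2"
      using N unfolding condN_def tilde' C' Theta' .
    have "(\<lambda>(s, \<tau>). (- s, \<tau>)) \<in> measurable (lborel \<Otimes>\<^sub>M M) (lborel \<Otimes>\<^sub>M M)"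
      by measurable
    from measurable_compose[OF this K_meas]
    have K'_meas: "(\<lambda>(s, \<tau>). K' s \<tau>) \<in> borel_measurable (lborel \<Otimes>\<^sub>M M)"
      by (simp add: K'_def case_prod_beta')
    interpret semiwavefront_data M K' g gd \<tau>0 \<zeta>1 \<zeta>2 "- b"
    proof (intro semiwavefront_data.intro semiwavefront_data_axioms.intro fin)
      show "0 \<le> K' s \<tau>" if "\<tau> \<in> space M" for s \<tau> using K_nonneg[OF that] by (simp add: K'_def)
      show "0 < (\<integral>\<^sup>+ s. ennreal (K' s \<tau>) \<partial>lborel)" if "\<tau> \<in> space M" for \<tau>
        using K_pos[OF that] by (simp add: K'_int that)
      show "chi_int M K' gd (- b) < 1" using chi_int_less[OF b(2,3)] by (simp add: chi')
      show "chi_int M K' gd 0 < \<infinity>" "1 < chi_int M K' gd 0" using chi_0 by (simp_all add: chi')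
      show "0 < - b" using b(1) by simp
      show "Gmap M K' g \<tau>0 \<zeta>2 \<zeta>1 \<le> Gmap M K' g \<tau>0 \<zeta>2 s" if "s \<in> {\<zeta>1..\<zeta>2}" for s
        unfolding G' by (rule G_min[OF that])
      show "s < Gmap M K' g \<tau>0 \<zeta>2 s" if "s \<in> {0<..\<zeta>1}" for s
        unfolding G' by (rule G_above[OF that])
    qed (fact K'_meas g_meas g_nonneg g_zero g_cont g_deriv gd_pos N' g_sub \<zeta>1)+
    obtain \<psi> c where wave: "semi_wavefront M K' g \<psi>" and bot: "(\<psi> \<longlongrightarrow> 0) at_bot" and le: "\<forall>s. \<psi> s \<le> \<zeta>2"
      and c: "c > \<zeta>1" "\<forall>\<^sub>F t in at_top. c \<le> \<psi> t"
      and attract: "\<And>\<kappa>. 0 < \<kappa> \<and> {s. 0 \<le> s \<and> Gmap M K g \<tau>0 \<zeta>2 s = s} = {0, \<kappa>} \<and>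
          (\<forall>s \<in> {0<..\<zeta>2}. (\<lambda>n. (Gmap M K g \<tau>0 \<zeta>2 ^^ n) s) \<longlonglongrightarrow> \<kappa>) \<Longrightarrow> (\<psi> \<longlongrightarrow> \<kappa>) at_top"
      using front_exists unfolding G' by blast
    define \<phi> where "\<phi> t = \<psi> (- t)" for t
    have \<psi>: "continuous_on UNIV \<psi>" "\<And>t. 0 < \<psi> t" "bounded (range \<psi>)"
      and eq: "\<And>t. ennreal (\<psi> t) = (\<integral>\<^sup>+ \<tau>. (\<integral>\<^sup>+ s. ennreal (K' s \<tau> * g (\<psi> (t - s)) \<tau>) \<partial>lborel) \<partial>M)"
      using wave by (auto simp: semi_wavefront_def is_solution_def)
    have \<psi>_meas[measurable]: "\<psi> \<in> borel_measurable borel"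
      using \<psi>(1) by (rule borel_measurable_continuous_onI)
    have top: "(\<phi> \<longlongrightarrow> 0) at_top"
      using bot unfolding \<phi>_def[abs_def] by (simp add: filterlim_at_bot_mirror)
    have "is_solution M K g \<phi>"
      unfolding is_solution_def
    proof (intro conjI allI)
      show "continuous_on UNIV \<phi>"
        unfolding \<phi>_def[abs_def] by (rule continuous_on_compose2[OF \<psi>(1)]) (auto intro!: continuous_intros)
      show "0 \<le> \<phi> t" for t using \<psi>(2)[of "- t"] by (simp add: \<phi>_def)
      show "ennreal (\<phi> t) = (\<integral>\<^sup>+ \<tau>. (\<integral>\<^sup>+ s. ennreal (K s \<tau> * g (\<phi> (t - s)) \<tau>) \<partial>lborel) \<partial>M)" for t
        unfolding \<phi>_def eq
      proof (rule nn_integral_cong)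
        fix \<tau> assume \<tau>: "\<tau> \<in> space M"
        have "(\<lambda>s. g (\<psi> (- t - s)) \<tau>) \<in> borel_measurable borel" using \<tau> by measurable
        from reflect[OF \<tau> this]
        show "(\<integral>\<^sup>+ s. ennreal (K' s \<tau> * g (\<psi> (- t - s)) \<tau>) \<partial>lborel) = (\<integral>\<^sup>+ s. ennreal (K s \<tau> * g (\<psi> (- (t - s))) \<tau>) \<partial>lborel)"
          by (simp add: K'_def)
      qed
    qed
    moreover have "range \<phi> = range \<psi>"
      unfolding \<phi>_def[abs_def] using surj_uminus by (metis image_image)
    ultimately have "semi_wavefront M K g \<phi>"
      using top \<psi>(2,3) by (simp add: semi_wavefront_def \<phi>_def)
    moreover have "\<forall>\<^sub>F t in at_bot. c \<le> \<phi> t"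
      using c(2) unfolding \<phi>_def at_bot_mirror eventually_filtermap by simp
    moreover have "(\<phi> \<longlongrightarrow> \<kappa>) at_bot" if "(\<psi> \<longlongrightarrow> \<kappa>) at_top" for \<kappa>
      using that unfolding \<phi>_def[abs_def] by (simp add: filterlim_at_top_mirror)
    ultimately show "\<exists>\<phi>. semi_wavefront M K g \<phi> \<and> (\<phi> \<longlongrightarrow> 0) at_top \<and>
               (\<forall>s. \<phi> s \<le> \<zeta>2) \<and> ereal \<zeta>1 < Liminf at_bot (\<lambda>t. ereal (\<phi> t)) \<and>
               (\<forall>\<kappa>. (0 < \<kappa> \<and> {s. 0 \<le> s \<and> Gmap M K g \<tau>0 \<zeta>2 s = s} = {0, \<kappa>} \<and>
                     (\<forall>s \<in> {0<..\<zeta>2}. (\<lambda>n. (Gmap M K g \<tau>0 \<zeta>2 ^^ n) s) \<longlonglongrightarrow> \<kappa>))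
                    \<longrightarrow> (\<phi> \<longlongrightarrow> \<kappa>) at_bot)"
      using top le liminf[OF c(1), of \<phi> at_bot] attract
      by (intro exI[of _ \<phi>]) (simp add: \<phi>_def)
  qed
qed

end
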